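(* Let $\{(x_i,y_i)\}_{i\in\mathcal{D}}$ be a finite training dataset and $\{x_j\}_{j\in\mathcal{T}}$ a finite test set, with $x_i,x_j\in\mathbb{R}^{d_0}$, and put $\mathcal{X}:=\{x_i\}_{i\in\mathcal{D}}\cup\{x_j\}_{j\in\mathcal{T}}$. Consider the generalized deep network $(f^{(\ell)})_{\ell=0}^L$ on the input set $\mathcal{X}$ with auxiliary finite sets $\boldsymbol{S}=(S_1,\dots,S_L)$, auxiliary dimensions $\boldsymbol{a}=(a_1,\dots,a_L)$, widths $(n_1,\dots,n_L)$, activation functions $\boldsymbol{\sigma}=(\sigma^{(\ell)})_{\ell=1}^L$ and independent Gaussian weights (i.i.d. centered Gaussian entries of variance $1/n_{\ell-1}$ in layer $\ell$, $n_0:=1$), together with the infinite-width covariances $\boldsymbol{K}=(K^{(\ell)})_{\ell=1}^L$ and the Gaussian variable $G^{(L)}_{n_L}$, all as defined in the context. Assume that all the $\sigma^{(\ell)}$ are Lipschitz continuous. Let the likelihood be given by a function $g:\mathbb{R}^{n_L\times S_L}\to[0,\infty)$ of the network output that is Lipschitz continuous, uniformly bounded and such that $\mathbb{E}[g(G^{(L)}_{n_L})]>0$. Then there exists $\mathsf{c}=\mathsf{c}(\mathcal{X},\boldsymbol{S},\boldsymbol{a},\boldsymbol{\sigma},\boldsymbol{K},g,n_L)<\infty$ such that, if $n:=\min_{i=1,\dots,L-1}n_i\ge\mathsf{c}$, then $\mathbb{E}[g(f^{(L)})]>0$, the posterior laws of $f^{(L)}$ and $G^{(L)}_{n_L}$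 are both well defined, and $$\mathcal{W}_1\big(f^{(L)}_{|\mathcal{D}},G^{(L)}_{n_L|\mathcal{D}}\big)\le\mathsf{c}\,\frac1{\sqrt n}.$$ If moreover the matrices $K^{(\ell)}$, $\ell=1,\dots,L$, are all invertible, then (possibly with a different constant $\mathsf{c}<\infty$ depending on the same quantities) $$\mathcal{W}_1\big(f^{(L)}_{|\mathcal{D}},G^{(L)}_{n_L|\mathcal{D}}\big)\le\mathsf{c}\,\frac1n.$$
   Context: Notation. For a finite set $S$, $\mathbb{R}^S$ is the space of real functions on $S$ with Euclidean norm; an integer $m$ used as an index set means $\{1,\dots,m\}$. For a symmetric positive semidefinite $K\in\mathbb{R}^{S\times S}$, $\mathcal{N}_K$ denotes a centered Gaussian variable in $\mathbb{R}^S$ with covariance $K$. $\mathcal{W}_1$ is the Wasserstein distance of order $1$ (Euclidean norm). Posterior: for a random element $F$ of $\mathbb{R}^{n_L\times S_L}$ with law $\mu$ and $\mathbb{E}[g(F)]>0$, the posterior law $F_{|\mathcal{D}}$ is the probability measure $\frac{g}{\mathbb{E}[g(F)]}\mu$. (The function $g$ encodes the training data; its precise dependence on the $y_i$ is irrelevant.) Generalized network. Enumerate $\mathcal{X}=\{x_1,\dots,x_k\}$ and put $S_0:=d_0\times k$, $n_0:=1$. Activations are functions $\sigma^{(\ell)}:\mathbb{R}^{S_{\ell-1}}\to\mathbb{R}^{a_\ell\times S_\ell}$. The input is $f^{(0)}=(x_1,\dots,x_k)\in\mathbb{R}^{d_0\times k}=\mathbb{R}^{1\times S_0}$. With weights $W^{(\ell)}\in\mathbb{R}^{n_\ell\times(n_{\ell-1}\times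 a_\ell)}$, define $f^{(\ell)}\in\mathbb{R}^{n_\ell\times S_\ell}$ by $$f^{(\ell)}[i,s]=\sum_{j=1}^{n_{\ell-1}}\sum_{a=1}^{a_\ell}W^{(\ell)}[i,(j,a)]\;\sigma^{(\ell)}\big(f^{(\ell-1)}[j,:]\big)[a,s],$$ where $f^{(\ell-1)}[j,:]\in\mathbb{R}^{S_{\ell-1}}$. All entries of all $W^{(\ell)}$ are independent, centered Gaussian, with variance $1/n_{\ell-1}$ in layer $\ell$. Infinite-width Gaussian variables. $G^{(0)}:=f^{(0)}$ (deterministic, in $\mathbb{R}^{S_0}$). For $\ell\ge1$, $$K^{(\ell)}[s,t]=\sum_{a=1}^{a_\ell}\mathbb{E}\big[\sigma^{(\ell)}(G^{(\ell-1)})[a,s]\,\sigma^{(\ell)}(G^{(\ell-1)})[a,t]\big],\qquad s,t\in S_\ell,$$ and $G^{(\ell)}:=\mathcal{N}_{K^{(\ell)}}$. $G^{(L)}_{n_L}$ consists of $n_L$ independent copies of $G^{(L)}$ (a random element of $\mathbb{R}^{n_L\times S_L}$). If $L=1$ the minimum defining $n$ is $+\infty$ and $1/n=1/\sqrt n=0$. *)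

theory Defs
  imports "HOL-Probability.Probability"
begin

text \<open>
  For a finite set \<open>I\<close>, the space of real functions on \<open>I\<close> is represented by the functions that
  are extensional on \<open>I\<close>, that is, by the space of the measure space \<open>euclid I\<close> below, and its
  Euclidean norm is the library's \<open>L2_set _ I\<close>. Random elements are represented by their laws.
\<close>

definition euclid :: "'i set \<Rightarrow> ('i \<Rightarrow> real) measure" where
  "euclid I = (\<Pi>\<^sub>M i\<in>I. borel)"

definition lipschitz_map ::
    "'i set \<Rightarrow> 'j set \<Rightarrow> (('i \<Rightarrow> real) \<Rightarrow> 'j \<Rightarrow> real) \<Rightarrow> bool" where
  "lipschitz_map I J F \<longleftrightarrow> (\<exists>C. \<forall>u\<in>space (euclid I). \<forall>v\<in>space (euclid I).
     L2_set (\<lambda>j. F u j - F v j) J \<le> C * L2_set (\<lambda>i. u i - v i) I)"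

definition lipschitz_functional :: "'i set \<Rightarrow> (('i \<Rightarrow> real) \<Rightarrow> real) \<Rightarrow> bool" where
  "lipschitz_functional I g \<longleftrightarrow> (\<exists>C. \<forall>u\<in>space (euclid I). \<forall>v\<in>space (euclid I).
     \<bar>g u - g v\<bar> \<le> C * L2_set (\<lambda>i. u i - v i) I)"

definition invertible_matrix :: "'i set \<Rightarrow> ('i \<Rightarrow> 'i \<Rightarrow> real) \<Rightarrow> bool" where
  "invertible_matrix I K \<longleftrightarrow> (\<exists>B. \<forall>s\<in>I. \<forall>t\<in>I.
     (\<Sum>u\<in>I. K s u * B u t) = (if s = t then 1 else 0) \<and>
     (\<Sum>u\<in>I. B s u * K u t) = (if s = t then 1 else 0))"

text \<open>
  The centered Gaussian law with covariance \<open>K\<close> is the law of \<open>A Z\<close>, where \<open>Z\<close> is a standard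
  Gaussian vector and \<open>A A\<^sup>T = K\<close>. Such an \<open>A\<close> exists exactly when \<open>K\<close> is symmetric positive
  semidefinite (\<open>K\<close> may be singular), and the law does not depend on the choice of \<open>A\<close>.
\<close>

definition centered_gaussian :: "'i set \<Rightarrow> ('i \<Rightarrow> 'i \<Rightarrow> real) \<Rightarrow> ('i \<Rightarrow> real) measure" where
  "centered_gaussian I K =
     (let A = (SOME A. \<forall>s\<in>I. \<forall>t\<in>I. (\<Sum>u\<in>I. A s u * A t u) = K s t) in
      distr (\<Pi>\<^sub>M i\<in>I. density lborel std_normal_density) (euclid I)
        (\<lambda>z. \<lambda>s\<in>I. \<Sum>u\<in>I. A s u * z u))"

definition couplings ::
    "'i set \<Rightarrow> ('i \<Rightarrow> real) measure \<Rightarrow> ('i \<Rightarrow> real) measure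
      \<Rightarrow> (('i \<Rightarrow> real) \<times> ('i \<Rightarrow> real)) measure set" where
  "couplings I \<mu> \<nu> = {\<pi>. prob_space \<pi> \<and> sets \<pi> = sets (euclid I \<Otimes>\<^sub>M euclid I) \<and>
     distr \<pi> (euclid I) fst = \<mu> \<and> distr \<pi> (euclid I) snd = \<nu>}"

definition wasserstein1 ::
    "'i set \<Rightarrow> ('i \<Rightarrow> real) measure \<Rightarrow> ('i \<Rightarrow> real) measure \<Rightarrow> ennreal" where
  "wasserstein1 I \<mu> \<nu> =
     (INF \<pi>\<in>couplings I \<mu> \<nu>. \<integral>\<^sup>+ (u, v). ennreal (L2_set (\<lambda>i. u i - v i) I) \<partial>\<pi>)"

definition posterior :: "('b \<Rightarrow> real) \<Rightarrow> 'b measure \<Rightarrow> 'b measure" where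
  "posterior g \<mu> = density \<mu> (\<lambda>u. ennreal (g u / (\<integral>v. g v \<partial>\<mu>)))"

text \<open>
  The parameters \<open>S\<close>, \<open>a\<close>, \<open>n\<close> and \<open>\<sigma>\<close> are indexed by the layer; the index sets \<open>S\<close> and the
  widths \<open>n\<close> start at layer \<open>0\<close>, the dimensions \<open>a\<close> and the activations \<open>\<sigma>\<close> at layer \<open>1\<close>. The
  activation \<open>\<sigma> l\<close> maps functions on \<open>S (l - 1)\<close> to functions on \<open>{1..a l} \<times> S l\<close>, and
  \<open>W (l, i, j, b)\<close> is the weight in row \<open>i\<close> and column \<open>(j, b)\<close> of layer \<open>l\<close>.
\<close>

primrec network ::
    "(nat \<Rightarrow> 's set) \<Rightarrow> (nat \<Rightarrow> nat) \<Rightarrow> (nat \<Rightarrow> nat)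
      \<Rightarrow> (nat \<Rightarrow> ('s \<Rightarrow> real) \<Rightarrow> nat \<times> 's \<Rightarrow> real) \<Rightarrow> ('s \<Rightarrow> real)
      \<Rightarrow> (nat \<times> nat \<times> nat \<times> nat \<Rightarrow> real) \<Rightarrow> nat \<Rightarrow> nat \<times> 's \<Rightarrow> real" where
  "network S a n \<sigma> x W 0 = (\<lambda>(i, s)\<in>{1..n 0} \<times> S 0. x s)"
| "network S a n \<sigma> x W (Suc l) = (\<lambda>(i, s)\<in>{1..n (Suc l)} \<times> S (Suc l).
     \<Sum>j=1..n l. \<Sum>b=1..a (Suc l).
       W (Suc l, i, j, b) * \<sigma> (Suc l) (\<lambda>t\<in>S l. network S a n \<sigma> x W l (j, t)) (b, s))"

definition weight_law ::
    "(nat \<Rightarrow> nat) \<Rightarrow> (nat \<Rightarrow> nat) \<Rightarrow> nat \<Rightarrow> (nat \<times> nat \<times> nat \<times> nat \<Rightarrow> real) measure" where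
  "weight_law a n L =
     (\<Pi>\<^sub>M (l, i, j, b)\<in>(SIGMA l:{1..L}. {1..n l} \<times> {1..n (l - 1)} \<times> {1..a l}).
        density lborel (normal_density 0 (sqrt (1 / real (n (l - 1))))))"

definition network_law ::
    "(nat \<Rightarrow> 's set) \<Rightarrow> (nat \<Rightarrow> nat) \<Rightarrow> (nat \<Rightarrow> nat)
      \<Rightarrow> (nat \<Rightarrow> ('s \<Rightarrow> real) \<Rightarrow> nat \<times> 's \<Rightarrow> real) \<Rightarrow> ('s \<Rightarrow> real) \<Rightarrow> nat
      \<Rightarrow> (nat \<times> 's \<Rightarrow> real) measure" where
  "network_law S a n \<sigma> x L =
     distr (weight_law a n L) (euclid ({1..n L} \<times> S L)) (\<lambda>W. network S a n \<sigma> x W L)"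

definition layer_covariance ::
    "nat \<Rightarrow> (('s \<Rightarrow> real) \<Rightarrow> nat \<times> 's \<Rightarrow> real) \<Rightarrow> ('s \<Rightarrow> real) measure \<Rightarrow> 's \<Rightarrow> 's \<Rightarrow> real" where
  "layer_covariance m \<phi> \<mu> s t = (\<Sum>b=1..m. \<integral>z. \<phi> z (b, s) * \<phi> z (b, t) \<partial>\<mu>)"

primrec limit_law ::
    "(nat \<Rightarrow> 's set) \<Rightarrow> (nat \<Rightarrow> nat) \<Rightarrow> (nat \<Rightarrow> ('s \<Rightarrow> real) \<Rightarrow> nat \<times> 's \<Rightarrow> real)
      \<Rightarrow> ('s \<Rightarrow> real) \<Rightarrow> nat \<Rightarrow> ('s \<Rightarrow> real) measure" where
  "limit_law S a \<sigma> x 0 = return (euclid (S 0)) (\<lambda>s\<in>S 0. x s)"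
| "limit_law S a \<sigma> x (Suc l) = centered_gaussian (S (Suc l))
     (layer_covariance (a (Suc l)) (\<sigma> (Suc l)) (limit_law S a \<sigma> x l))"

definition limit_covariance ::
    "(nat \<Rightarrow> 's set) \<Rightarrow> (nat \<Rightarrow> nat) \<Rightarrow> (nat \<Rightarrow> ('s \<Rightarrow> real) \<Rightarrow> nat \<times> 's \<Rightarrow> real)
      \<Rightarrow> ('s \<Rightarrow> real) \<Rightarrow> nat \<Rightarrow> 's \<Rightarrow> 's \<Rightarrow> real" where
  "limit_covariance S a \<sigma> x l = layer_covariance (a l) (\<sigma> l) (limit_law S a \<sigma> x (l - 1))"

definition limit_output_law ::
    "(nat \<Rightarrow> 's set) \<Rightarrow> (nat \<Rightarrow> nat) \<Rightarrow> (nat \<Rightarrow> ('s \<Rightarrow> real) \<Rightarrow> nat \<times> 's \<Rightarrow> real)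
      \<Rightarrow> ('s \<Rightarrow> real) \<Rightarrow> nat \<Rightarrow> nat \<Rightarrow> (nat \<times> 's \<Rightarrow> real) measure" where
  "limit_output_law S a \<sigma> x L m =
     distr (\<Pi>\<^sub>M i\<in>{1..m}. limit_law S a \<sigma> x L) (euclid ({1..m} \<times> S L))
       (\<lambda>h. \<lambda>(i, s)\<in>{1..m} \<times> S L. h i s)"

text \<open>
  The index type of the auxiliary sets contains a copy \<open>Inl ` (UNIV \<times> {1..k})\<close> of the input index
  set, so that all layers, including the input, are indexed by subsets of one type.
\<close>

definition network_input :: "(nat \<Rightarrow> real ^ 'd) \<Rightarrow> ('d \<times> nat) + 's \<Rightarrow> real" where
  "network_input xs = (\<lambda>s. case s of Inl (c, j) \<Rightarrow> xs j $ c | Inr _ \<Rightarrow> 0)"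

text \<open>
  The smallest hidden width is extended-valued: it is \<open>\<infinity>\<close> when there is no hidden layer, and then
  its inverse is \<open>0\<close>.
\<close>

definition min_width :: "nat \<Rightarrow> (nat \<Rightarrow> nat) \<Rightarrow> ereal" where
  "min_width L n = (INF i\<in>{1..L - 1}. ereal (real (n i)))"

definition inverse_min_width :: "nat \<Rightarrow> (nat \<Rightarrow> nat) \<Rightarrow> real" where
  "inverse_min_width L n = real_of_ereal (1 / min_width L n)"

end

theory Submission
  imports Defs
begin

text \<open>
  The rate \<open>1 / n\<close> holds whether or not the covariances are invertible, so both claims follow from one
  estimate. Factor each limiting covariance as \<open>K = A A\<^sup>T\<close> with \<open>A\<close> injective. A standard Gaussian has
  full support and the activations are continuous, so their values on the support of the previous
  limiting law lie in the range of \<open>A\<close>; hence the network is, for every choice of the weights, the image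
  under \<open>A\<close> of a network all of whose limiting covariances are the identity.

  For the latter, conditionally on the previous layers the rows of a layer are independent and
  Gaussian with a random covariance \<open>N\<close>. For every measurable \<open>H\<close> of quartic growth the Gaussian
  expectation of \<open>H\<close> is an affine function of \<open>N - 1\<close> up to \<open>O(|N - 1|\<^sup>2)\<close>. As both the bias and the mean square of
  \<open>N - 1\<close> are \<open>O(1 / n)\<close>, the law of finitely many rows is \<open>O(1 / n)\<close>-close to its limit when tested against all
  such \<open>H\<close>, and this bounds bias and mean square for the next layer. Testing against all \<open>H\<close>, instead of the
  Lipschitz ones only, amounts to a weighted total variation distance, which passes to the posteriors
  of a bounded \<open>g\<close> and yields a coupling without Kantorovich duality.
\<close>

section \<open>Uniqueness of characteristic functions and Gaussian laws\<close>

text \<open>Testing against all measurable functions is hopeless for singular covariances: two such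
  Gaussian laws may be mutually singular. On the range of the limiting covariance the limit is
  standard, and laws with nearby covariances have densities that are smooth in the covariance, so
  the test function needs no regularity. The conditional covariance is typically only n^(-1/2) away
  from the identity. The rate 1/n survives because the coefficients of the linear term come from H
  alone: averaging over the weights meets the covariance error there only through its mean. Growth
  four is what the induction reproduces: activations grow linearly, the covariance error is
  quadratic in a row, and its square and its products over two rows are the next test functions. At
  the end linear growth is enough, for the normalising constant and for \<open>g\<close> times the
  norm, a product that is in general not Lipschitz. The final constant is used twice: as a threshold
  that keeps the normalising constant of the network above half of its limit, and as the factor of
  the rate.\<close>

lemma cis_borel_measurable [measurable (raw)]:
  fixes f :: "'a \<Rightarrow> real"
  assumes "f \<in> borel_measurable M"
  shows "(\<lambda>x. cis (f x)) \<in> borel_measurable M"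
  unfolding cis_conv_exp using assms by measurable

text \<open>Levy's theorem concerns probability measures. Frequency 0 shows that the total masses
  agree, so both measures may be divided by the same number; mass 0 has to be settled
  separately.\<close>

lemma finite_borel_measure_eq_if_char_eq:
  fixes \<mu> \<nu> :: "real measure"
  assumes "finite_measure \<mu>" "finite_measure \<nu>" and sets: "sets \<mu> = sets borel" "sets \<nu> = sets borel"
    and char: "\<And>t. (\<integral>x. cis (t * x) \<partial>\<mu>) = (\<integral>x. cis (t * x) \<partial>\<nu>)"
  shows "\<mu> = \<nu>"
proof -
  interpret \<mu>: finite_measure \<mu> by fact
  interpret \<nu>: finite_measure \<nu> by fact
  have sp: "space \<mu> = UNIV" "space \<nu> = UNIV"
    using sets by (simp_all add: sets_eq_imp_space_eq[of _ borel])
  define m where "m = measure \<mu> UNIV"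
  have "complex_of_real (measure \<mu> UNIV) = complex_of_real (measure \<nu> UNIV)"
    using char[of 0] by (simp add: sp scaleR_conv_of_real)
  then have m: "measure \<nu> UNIV = m" by (simp add: m_def)
  have eU: "emeasure \<mu> UNIV = ennreal m" "emeasure \<nu> UNIV = ennreal m"
    using m by (simp_all add: m_def \<mu>.emeasure_eq_measure \<nu>.emeasure_eq_measure)
  show ?thesis
  proof (cases "m = 0")
    case True
    show ?thesis
    proof (rule measure_eqI)
      fix A assume "A \<in> sets \<mu>"
      have "emeasure \<mu> A \<le> emeasure \<mu> UNIV" "emeasure \<nu> A \<le> emeasure \<nu> UNIV"
        using sets by (auto intro!: emeasure_mono)
      then show "emeasure \<mu> A = emeasure \<nu> A" using eU True by simp
    qed (use sets in simp)
  next
    case False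
    then have mpos: "0 < m" using m_def by (simp add: zero_less_measure_iff order.strict_iff_order)
    define s where "s M = density M (\<lambda>_. ennreal (1 / m))" for M :: "real measure"
    have rd: "real_distribution (s M)" if "sets M = sets borel" "emeasure M UNIV = ennreal m" for M
    proof -
      have [simp]: "space M = UNIV" using that by (simp add: sets_eq_imp_space_eq[of _ borel])
      have "emeasure (s M) (space (s M)) = 1"
        using mpos that by (simp add: s_def emeasure_density ennreal_mult[symmetric])
      then interpret prob_space "s M" by (rule prob_spaceI)
      show ?thesis by unfold_locales (simp add: s_def that)
    qed
    have ch: "char (s M) t = (\<integral>x. cis (t * x) \<partial>M) /\<^sub>R m" if "sets M = sets borel" for M t
    proof -
      note [measurable_cong] = that
      show ?thesis unfolding s_def char_def cis_conv_exp
        using mpos by (subst integral_density) (auto simp: that field_simps)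
    qed
    have "char (s \<mu>) = char (s \<nu>)" using char by (auto simp: ch sets fun_eq_iff)
    then have eq: "s \<mu> = s \<nu>" by (intro Levy_uniqueness rd sets eU)
    have inv: "emeasure M A = ennreal m * emeasure (s M) A" if "A \<in> sets M" for M A
      using mpos that by (simp add: s_def emeasure_density nn_integral_cmult
          mult.assoc[symmetric] ennreal_mult[symmetric])
    show ?thesis by (rule measure_eqI) (use sets eq in \<open>auto simp: inv\<close>)
  qed
qed

text \<open>The coordinates are treated one at a time: the cosine factor of a coordinate is turned into
  the indicator of an arbitrary Borel set by one-dimensional uniqueness, applied to the finite
  measures with densities \<open>1 + cos (\<theta> + \<alpha>)\<close>, which are nonnegative.\<close>

lemma PiM_measure_eq_if_char_eq:
  fixes \<mu> \<nu> :: "('i \<Rightarrow> real) measure"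
  assumes fin: "finite I" and "finite_measure \<mu>" "finite_measure \<nu>"
    and sets: "sets \<mu> = sets (\<Pi>\<^sub>M i\<in>I. borel)" "sets \<nu> = sets (\<Pi>\<^sub>M i\<in>I. borel)"
    and char: "\<And>t. (\<integral>x. cis (\<Sum>i\<in>I. t i * x i) \<partial>\<mu>) = (\<integral>x. cis (\<Sum>i\<in>I. t i * x i) \<partial>\<nu>)"
  shows "\<mu> = \<nu>"
proof -
  interpret \<mu>: finite_measure \<mu> by fact
  interpret \<nu>: finite_measure \<nu> by fact
  note [measurable_cong] = sets
  have bdd: "integrable M f" 
    if "f \<in> borel_measurable M" "\<And>x. norm (f x) \<le> B" "M = \<mu> \<or> M = \<nu>" 
    for M and f :: "('i \<Rightarrow> real) \<Rightarrow> 'b::{banach,second_countable_topology}" and B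
    using that(3)
  proof
    assume "M = \<mu>"
    then show ?thesis using that(1,2) by (intro \<mu>.integrable_const_bound[where B = B, folded \<open>M = \<mu>\<close>]) simp_all
  next
    assume "M = \<nu>"
    then show ?thesis using that(1,2) by (intro \<nu>.integrable_const_bound[where B = B, folded \<open>M = \<nu>\<close>]) simp_all
  qed
  have cmp: "(\<lambda>x. x i) \<in> borel_measurable M" if "i \<in> I" "M = \<mu> \<or> M = \<nu>" for i M
    using that by auto
  have ind: "(\<lambda>x. indicator C (x i) :: real) \<in> borel_measurable M"
    if "i \<in> I" "C \<in> sets borel" "M = \<mu> \<or> M = \<nu>" for i C M
  proof -
    have "(\<lambda>x. x i) \<in> borel_measurable M" using that by auto
    from measurable_compose[OF this borel_measurable_indicator[OF that(2)]] show ?thesis .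
  qed
  \<comment> \<open>Interpolation between the hypothesis and the claim: the coordinates in
    \<open>F\<close> carry indicators, the others still carry frequencies. \<open>F = {}\<close> is
    the hypothesis, and \<open>F = I\<close> gives the measures of boxes.\<close>
  have key: "(\<integral>x. (\<Prod>i\<in>F. indicator (B i) (x i)) *\<^sub>R cis (\<Sum>i\<in>I - F. t i * x i) \<partial>\<mu>)
           = (\<integral>x. (\<Prod>i\<in>F. indicator (B i) (x i)) *\<^sub>R cis (\<Sum>i\<in>I - F. t i * x i) \<partial>\<nu>)"
    if "F \<subseteq> I" "\<And>i. i \<in> F \<Longrightarrow> B i \<in> sets borel" for F B and t :: "'i \<Rightarrow> real"
    using finite_subset[OF that(1) fin] that
  proof (induction F arbitrary: t)
    case empty
    then show ?case using char by simp
  next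
    case (insert k F)
    define R where "R = I - insert k F"
    have IF: "I - F = insert k R" "k \<notin> R" "finite R" "k \<in> I" "R \<subseteq> I" using insert fin by (auto simp: R_def)
    have [measurable]: "(\<lambda>x. x k) \<in> borel_measurable M" if "M = \<mu> \<or> M = \<nu>" for M
      using that IF by auto
    define w where "w x = (\<Prod>i\<in>F. indicator (B i) (x i) :: real)" for x
    have w01: "0 \<le> w x" "w x \<le> 1" for x
      by (auto simp: w_def intro!: prod_nonneg prod_le_1 split: split_indicator)
    have [measurable]: "w \<in> borel_measurable M" if "M = \<mu> \<or> M = \<nu>" for M
      unfolding w_def using that insert.prems by (intro borel_measurable_prod ind) auto
    define th where "th x = (\<Sum>i\<in>R. t i * x i)" for x
    have [measurable]: "th \<in> borel_measurable M" if "M = \<mu> \<or> M = \<nu>" for M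
      unfolding th_def using that IF by (intro borel_measurable_sum borel_measurable_times cmp) auto
    have Bk [measurable]: "B k \<in> sets borel" using insert by auto
    \<comment> \<open>Frequencies are arbitrary in the induction, so those of \<open>R\<close> can
      be scaled by \<open>c\<close> and that of coordinate \<open>k\<close> set to \<open>r\<close>;
      below, \<open>c\<close> is 0, 1 and -1.\<close>
    have IH: "(\<integral>x. w x *\<^sub>R cis (r * x k + c * th x) \<partial>\<mu>) = (\<integral>x. w x *\<^sub>R cis (r * x k + c * th x) \<partial>\<nu>)" for r c
    proof -
      have *: "(\<Sum>i\<in>I - F. ((\<lambda>i. c * t i)(k := r)) i * x i) = r * x k + c * th x" for x
        using IF unfolding th_def by (auto simp: IF sum_distrib_left mult.assoc intro!: sum.cong)
      show ?thesis using insert.IH[of "(\<lambda>i. c * t i)(k := r)"] insert.prems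
        unfolding * w_def[symmetric] by simp
    qed
    define d where "d \<alpha> x = w x * (1 + cos (th x + \<alpha>))" for \<alpha> x
    have d0: "0 \<le> d \<alpha> x" for \<alpha> x
      unfolding d_def using w01(1)[of x] cos_ge_minus_one[of "th x + \<alpha>"]
      by (intro mult_nonneg_nonneg) (assumption, linarith)
    have d2: "norm (d \<alpha> x) \<le> 2" for \<alpha> x 
    proof -
      have "\<bar>1 + cos (th x + \<alpha>)\<bar> \<le> 2"
        using cos_le_one[of "th x + \<alpha>"] cos_ge_minus_one[of "th x + \<alpha>"] by (intro abs_leI) linarith+
      then have "\<bar>w x\<bar> * \<bar>1 + cos (th x + \<alpha>)\<bar> \<le> 1 * 2"
        using w01[of x] by (intro mult_mono) auto
      then show ?thesis by (simp add: d_def abs_mult)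
    qed
    have [measurable]: "d \<alpha> \<in> borel_measurable M" if "M = \<mu> \<or> M = \<nu>" for \<alpha> M
      unfolding d_def using that by measurable
    \<comment> \<open>The law of coordinate \<open>k\<close> under the nonnegative density
      \<open>d \<alpha>\<close>: a finite measure on the line, to which one-dimensional uniqueness
      applies.\<close>
    define P where "P M \<alpha> = distr (density M (\<lambda>x. ennreal (d \<alpha> x))) borel (\<lambda>x. x k)" for M \<alpha>
    have finP: "finite_measure (P M \<alpha>)" if "M = \<mu> \<or> M = \<nu>" for M \<alpha>
    proof -
      have "integrable M (d \<alpha>)" using that d2 by (intro bdd[of _ _ 2]) auto
      then have "(\<integral>\<^sup>+x. ennreal (d \<alpha> x) \<partial>M) < \<infinity>" using d0 by (subst nn_integral_eq_integral) auto
      then have "finite_measure (density M (\<lambda>x. ennreal (d \<alpha> x)))"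
        using that by (intro finite_measureI) (auto simp: emeasure_density cong: nn_integral_cong)
      then show ?thesis unfolding P_def using that by (intro finite_measure.finite_measure_distr) auto
    qed
    have intP: "(\<integral>x. f x \<partial>P M \<alpha>) = (\<integral>x. d \<alpha> x *\<^sub>R f (x k) \<partial>M)" 
      if "M = \<mu> \<or> M = \<nu>" "f \<in> borel_measurable borel" for M \<alpha> and f :: "real \<Rightarrow> complex"
    proof -
      have "(\<integral>x. f x \<partial>P M \<alpha>) = (\<integral>x. f (x k) \<partial>density M (\<lambda>x. ennreal (d \<alpha> x)))"
        unfolding P_def using that by (intro integral_distr) auto
      also have "\<dots> = (\<integral>x. d \<alpha> x *\<^sub>R f (x k) \<partial>M)"
      proof (rule integral_density)
        have "(\<lambda>x. x k) \<in> borel_measurable M" using that by auto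
        from measurable_compose[OF this that(2)] show "(\<lambda>x. f (x k)) \<in> borel_measurable M" .
        show "d \<alpha> \<in> borel_measurable M" using that by auto
      qed (use d0 in auto)
      finally show ?thesis .
    qed
    have P_eq: "P \<mu> \<alpha> = P \<nu> \<alpha>" for \<alpha>
    proof (rule finite_borel_measure_eq_if_char_eq)
      fix r
      \<comment> \<open>The cosine is half the sum of two exponentials, whose phases carry
        \<open>th\<close> with factor 1 or -1; all three terms are instances of
        \<open>IH\<close>.\<close>
      have *: "d \<alpha> x *\<^sub>R cis (r * x k) = w x *\<^sub>R cis (r * x k + 0 * th x)
         + (cis \<alpha> / 2) * (w x *\<^sub>R cis (r * x k + 1 * th x)) 
         + (cis (- \<alpha>) / 2) * (w x *\<^sub>R cis (r * x k + (- 1) * th x))" for x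
      proof -
        have c: "complex_of_real (cos y) = (cis y + cis (- y)) / 2" for y
          by (simp add: complex_eq_iff)
        have e: "cis (r * x k + 1 * th x) = cis (r * x k) * cis (th x)"
          "cis (r * x k + (- 1) * th x) = cis (r * x k) * cis (- th x)"
          "cis (r * x k + 0 * th x) = cis (r * x k)"
          "cis (th x + \<alpha>) = cis (th x) * cis \<alpha>" "cis (- (th x + \<alpha>)) = cis (- th x) * cis (- \<alpha>)"
          by (simp_all add: cis_mult add.commute)
        show ?thesis unfolding d_def scaleR_conv_of_real of_real_mult of_real_add c e
          by (simp add: algebra_simps add_divide_distrib)
      qed
      have "(\<integral>x. d \<alpha> x *\<^sub>R cis (r * x k) \<partial>M) = (\<integral>x. w x *\<^sub>R cis (r * x k + 0 * th x) \<partial>M)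
         + (cis \<alpha> / 2) * (\<integral>x. w x *\<^sub>R cis (r * x k + 1 * th x) \<partial>M) 
         + (cis (- \<alpha>) / 2) * (\<integral>x. w x *\<^sub>R cis (r * x k + (- 1) * th x) \<partial>M)" if M: "M = \<mu> \<or> M = \<nu>" for M
      proof -
        have i: "integrable M (\<lambda>x. w x *\<^sub>R cis (r * x k + c * th x))" for c
        proof (rule bdd[of _ _ 1, OF _ _ M])
          show "(\<lambda>x. w x *\<^sub>R cis (r * x k + c * th x)) \<in> borel_measurable M" using M by measurable
        qed (use w01 in auto)
        have lin: "(\<integral>x. f x + a * g x + b * h x \<partial>M) = (\<integral>x. f x \<partial>M) + a * (\<integral>x. g x \<partial>M) + b * (\<integral>x. h x \<partial>M)"
          if "integrable M f" "integrable M g" "integrable M h" for f g h :: "('i \<Rightarrow> real) \<Rightarrow> complex" and a b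
          using that by simp
        show ?thesis unfolding * by (rule lin[OF i i i])
      qed
      note this[OF disjI1, OF refl] this[OF disjI2, OF refl]
      then show "(\<integral>x. cis (r * x) \<partial>P \<mu> \<alpha>) = (\<integral>x. cis (r * x) \<partial>P \<nu> \<alpha>)"
        by (simp only: IH intP simp_thms cis_borel_measurable borel_measurable_times borel_measurable_const measurable_ident_sets)
    qed (use finP in \<open>auto simp: P_def\<close>)
    define v where "v x = w x * indicator (B k) (x k)" for x
    have v01: "0 \<le> v x" "v x \<le> 1" for x using w01[of x] by (auto simp: v_def split: split_indicator)
    have [measurable]: "v \<in> borel_measurable M" if M: "M = \<mu> \<or> M = \<nu>" for M
    proof -
      note [measurable] = ind[OF IF(4) Bk that]
      show ?thesis unfolding v_def using that by measurable
    qed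
    have E: "(\<integral>x. v x * (1 + cos (th x + \<alpha>)) \<partial>\<mu>) = (\<integral>x. v x * (1 + cos (th x + \<alpha>)) \<partial>\<nu>)" for \<alpha>
    proof -
      have "(\<integral>x. d \<alpha> x *\<^sub>R (indicator (B k) (x k) :: complex) \<partial>\<mu>) = (\<integral>x. d \<alpha> x *\<^sub>R indicator (B k) (x k) \<partial>\<nu>)"
        using P_eq[of \<alpha>] intP[of \<mu> "indicator (B k)" \<alpha>] intP[of \<nu> "indicator (B k)" \<alpha>] by simp
      moreover have "d \<alpha> x *\<^sub>R (indicator (B k) (x k) :: complex) = complex_of_real (v x * (1 + cos (th x + \<alpha>)))" for x
        by (auto simp: d_def v_def scaleR_conv_of_real split: split_indicator)
      ultimately show ?thesis by (simp only: integral_complex_of_real of_real_eq_iff)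
    qed
    have split: "(\<integral>x. v x * (1 + cos (th x + \<alpha>)) \<partial>M) = (\<integral>x. v x \<partial>M) + (\<integral>x. v x * cos (th x + \<alpha>) \<partial>M)" 
      and vi: "integrable M v" and vci: "integrable M (\<lambda>x. v x * cos (th x + \<alpha>))"
      if M: "M = \<mu> \<or> M = \<nu>" for M \<alpha>
    proof -
      show i1: "integrable M v" using M v01 by (intro bdd[of _ _ 1]) auto
      have "(\<lambda>x. v x * cos (th x + \<alpha>)) \<in> borel_measurable M" using M by measurable
      moreover have "norm (v x * cos (th x + \<alpha>)) \<le> 1" for x using v01[of x] abs_cos_le_one[of "th x + \<alpha>"]
        by (auto simp: abs_mult intro!: mult_le_one)
      ultimately show i2: "integrable M (\<lambda>x. v x * cos (th x + \<alpha>))" using M by (intro bdd[of _ _ 1])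
      show "(\<integral>x. v x * (1 + cos (th x + \<alpha>)) \<partial>M) = (\<integral>x. v x \<partial>M) + (\<integral>x. v x * cos (th x + \<alpha>) \<partial>M)"
        using i1 i2 by (simp add: distrib_left)
    qed
    have C: "(\<integral>x. v x * cos (th x + \<alpha>) \<partial>\<mu>) = (\<integral>x. v x * cos (th x + \<alpha>) \<partial>\<nu>)" for \<alpha>
    proof -
      \<comment> \<open>A shift by \<open>pi\<close> reverses the sign of the cosine. Comparing
        \<open>E\<close> at \<open>\<alpha>\<close> and at \<open>\<alpha> + pi\<close> separates
        the cosine integral from the integral of \<open>v\<close>.\<close>
      have "(\<integral>x. v x * cos (th x + (\<alpha> + pi)) \<partial>M) = - (\<integral>x. v x * cos (th x + \<alpha>) \<partial>M)" for M
        by (simp add: add.assoc[symmetric])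
      then show ?thesis using E[of \<alpha>] E[of "\<alpha> + pi"] split[of \<mu>] split[of \<nu>] by simp
    qed
    \<comment> \<open>The sine is the cosine shifted by \<open>- pi / 2\<close>, so the phases 0 and
      \<open>- pi / 2\<close> give real and imaginary part.\<close>
    have S: "(\<integral>x. v x *\<^sub>R cis (th x) \<partial>M) = complex_of_real (\<integral>x. v x * cos (th x + 0) \<partial>M) 
        + \<i> * complex_of_real (\<integral>x. v x * cos (th x + - (pi / 2)) \<partial>M)" if M: "M = \<mu> \<or> M = \<nu>" for M
    proof -
      have *: "v x *\<^sub>R cis (th x) = complex_of_real (v x * cos (th x + 0)) 
          + \<i> * complex_of_real (v x * cos (th x + - (pi / 2)))" for x
      proof -
        have "cos (th x + - (pi / 2)) = sin (th x)" unfolding cos_add by simp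
        then show ?thesis by (simp add: complex_eq_iff)
      qed
      have i: "integrable M (\<lambda>x. complex_of_real (v x * cos (th x + \<alpha>)))" for \<alpha>
        using vci[OF M] by (simp only: integrable_of_real)
      have lin: "(\<integral>x. f x + a * g x \<partial>M) = (\<integral>x. f x \<partial>M) + a * (\<integral>x. g x \<partial>M)"
        if "integrable M f" "integrable M g" for f g :: "('i \<Rightarrow> real) \<Rightarrow> complex" and a
        using that by simp
      show ?thesis unfolding * lin[OF i i] integral_complex_of_real ..
    qed
    have "(\<integral>x. v x *\<^sub>R cis (th x) \<partial>\<mu>) = (\<integral>x. v x *\<^sub>R cis (th x) \<partial>\<nu>)"
      by (simp only: S C simp_thms)
    moreover have "v x = (\<Prod>i\<in>insert k F. indicator (B i) (x i))" for x
      using insert by (simp add: v_def w_def mult.commute)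
    ultimately show ?case unfolding th_def R_def by simp
  qed
  show ?thesis
  proof (rule measure_eqI_PiM_finite[OF fin sets])
    fix A :: "'i \<Rightarrow> real set" assume A: "\<And>i. i \<in> I \<Longrightarrow> A i \<in> sets borel"
    have "measure M (Pi\<^sub>E I A) = (\<integral>x. (\<Prod>i\<in>I. indicator (A i) (x i)) \<partial>M)" if "M = \<mu> \<or> M = \<nu>" for M
    proof -
      have sM: "sets M = sets (\<Pi>\<^sub>M i\<in>I. borel)" using sets that by auto
      then have spM: "space M = (\<Pi>\<^sub>E i\<in>I. UNIV)" by (simp add: sets_eq_imp_space_eq[OF sM] space_PiM)
      have "Pi\<^sub>E I A \<in> sets M" unfolding sM using A fin by (intro sets_PiM_I_finite) auto
      then have "measure M (Pi\<^sub>E I A) = (\<integral>x. indicator (Pi\<^sub>E I A) x \<partial>M)" by (simp add: sets.Int_space_eq2)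
      also have "\<dots> = (\<integral>x. (\<Prod>i\<in>I. indicator (A i) (x i)) \<partial>M)"
        using fin by (intro Bochner_Integration.integral_cong) (auto simp: spM indicator_def PiE_def Pi_def)
      finally show ?thesis .
    qed
    moreover have "complex_of_real (\<integral>x. (\<Prod>i\<in>I. indicator (A i) (x i)) \<partial>\<mu>) = complex_of_real (\<integral>x. (\<Prod>i\<in>I. indicator (A i) (x i)) \<partial>\<nu>)"
      using key[of I A] A by (simp add: scaleR_conv_of_real flip: integral_complex_of_real)
    ultimately show "emeasure \<mu> (Pi\<^sub>E I A) = emeasure \<nu> (Pi\<^sub>E I A)"
      by (simp add: \<mu>.emeasure_eq_measure \<nu>.emeasure_eq_measure)
  next
    show "range (\<lambda>_::nat. \<Pi>\<^sub>E i\<in>I. UNIV) \<subseteq> prod_algebra I (\<lambda>_. borel :: real measure)"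
      using fin by (auto intro!: prod_algebraI_finite)
    show "(\<Union>i::nat. \<Pi>\<^sub>E i\<in>I. UNIV) = space (\<Pi>\<^sub>M i\<in>I. (borel :: real measure))" by (simp add: space_PiM)
  qed simp
qed

section \<open>Gaussian laws through their characteristic functions\<close>

abbreviation std_gaussian :: "'i set \<Rightarrow> ('i \<Rightarrow> real) measure" where
  "std_gaussian I \<equiv> (\<Pi>\<^sub>M i\<in>I. std_normal_distribution)"

text \<open>Prescribing the characteristic function also covers singular \<open>K\<close>, where
  there is no density, and reduces the identification of Gaussian laws to a comparison of quadratic
  forms. Only the values of \<open>K\<close> on \<open>I\<close> enter.\<close>

definition gaussian_law :: "'i set \<Rightarrow> ('i \<Rightarrow> 'i \<Rightarrow> real) \<Rightarrow> ('i \<Rightarrow> real) measure \<Rightarrow> bool" where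
  "gaussian_law I K \<mu> \<longleftrightarrow> prob_space \<mu> \<and> sets \<mu> = sets (euclid I) \<and>
     (\<forall>t. (\<integral>x. cis (\<Sum>i\<in>I. t i * x i) \<partial>\<mu>)
        = complex_of_real (exp (- (\<Sum>i\<in>I. \<Sum>j\<in>I. t i * t j * K i j) / 2)))"

lemma gaussian_law_unique:
  assumes "finite I" "gaussian_law I K \<mu>" "gaussian_law I K' \<nu>"
    and "\<And>i j. i \<in> I \<Longrightarrow> j \<in> I \<Longrightarrow> K i j = K' i j"
  shows "\<mu> = \<nu>"
proof (rule PiM_measure_eq_if_char_eq[OF assms(1)])
  show "finite_measure \<mu>" "finite_measure \<nu>"
    using assms by (auto simp: gaussian_law_def intro: prob_space.finite_measure)
  fix t
  have "(\<Sum>i\<in>I. \<Sum>j\<in>I. t i * t j * K i j) = (\<Sum>i\<in>I. \<Sum>j\<in>I. t i * t j * K' i j)"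
    using assms(4) by (intro sum.cong) auto
  then show "(\<integral>x. cis (\<Sum>i\<in>I. t i * x i) \<partial>\<mu>) = (\<integral>x. cis (\<Sum>i\<in>I. t i * x i) \<partial>\<nu>)"
    using assms(2,3) by (simp add: gaussian_law_def)
qed (use assms in \<open>auto simp: gaussian_law_def euclid_def\<close>)

lemma integral_cis_std_normal:
  "(\<integral>x. cis (t * x) \<partial>std_normal_distribution) = complex_of_real (exp (- t\<^sup>2 / 2))"
  using fun_cong[OF char_std_normal_distribution, of t] by (simp add: char_def cis_conv_exp)

lemma normal_distribution_eq_distr:
  assumes "0 < \<sigma>"
  shows "density lborel (normal_density 0 \<sigma>) = distr std_normal_distribution borel (\<lambda>x. \<sigma> * x)"
proof -
  interpret prob_space std_normal_distribution by (rule prob_space_normal_density) simp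
  have "distributed std_normal_distribution lborel (\<lambda>x. x) std_normal_density"
    by (auto simp: distributed_def distr_id2)
  from normal_density_affine[OF this, of \<sigma> 0] assms
  have "distr std_normal_distribution lborel (\<lambda>x. \<sigma> * x) = density lborel (normal_density 0 \<sigma>)"
    by (simp add: distributed_def)
  moreover have "distr std_normal_distribution lborel (\<lambda>x. \<sigma> * x) = distr std_normal_distribution borel (\<lambda>x. \<sigma> * x)"
    by (intro distr_cong) auto
  ultimately show ?thesis by simp
qed

lemma integral_cis_normal:
  assumes "0 < \<sigma>"
  shows "(\<integral>x. cis (t * x) \<partial>density lborel (normal_density 0 \<sigma>)) = complex_of_real (exp (- \<sigma>\<^sup>2 * t\<^sup>2 / 2))"
proof -
  have "(\<integral>x. cis (t * x) \<partial>density lborel (normal_density 0 \<sigma>))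
      = (\<integral>x. cis ((t * \<sigma>) * x) \<partial>std_normal_distribution)"
    unfolding normal_distribution_eq_distr[OF assms] by (subst integral_distr) (auto simp: mult.assoc)
  also have "\<dots> = complex_of_real (exp (- \<sigma>\<^sup>2 * t\<^sup>2 / 2))"
    unfolding integral_cis_std_normal by (simp add: power_mult_distrib mult.commute)
  finally show ?thesis .
qed

lemma measurable_linear_map:
  assumes "\<And>q. q \<in> Q \<Longrightarrow> sets (N q) = sets borel"
  shows "(\<lambda>z. \<lambda>s\<in>I. \<Sum>q\<in>Q. M s q * z q) \<in> measurable (Pi\<^sub>M Q N) (euclid I)"
  unfolding euclid_def
proof (rule measurable_restrict)
  fix s assume "s \<in> I"
  have "(\<lambda>z. z q) \<in> borel_measurable (Pi\<^sub>M Q N)" if "q \<in> Q" for q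
    using measurable_component_singleton[OF that, of N] assms[OF that]
    by (simp cong: measurable_cong_sets)
  then show "(\<lambda>z. \<Sum>q\<in>Q. M s q * z q) \<in> borel_measurable (Pi\<^sub>M Q N)"
    by (intro borel_measurable_sum borel_measurable_times) auto
qed

text \<open>The frequency \<open>t\<close> pulled back along the linear map is \<open>r\<close>, and
  independence turns the characteristic function into a product over \<open>Q\<close>. Standard
  deviations other than 1 occur for perturbed components and for the weights of a layer.\<close>

lemma gaussian_law_linear_image:
  assumes fin: "finite I" "finite Q" and pos: "\<And>q. q \<in> Q \<Longrightarrow> 0 < sd q"
  shows "gaussian_law I (\<lambda>s t. \<Sum>q\<in>Q. (sd q)\<^sup>2 * M s q * M t q)
    (distr (\<Pi>\<^sub>M q\<in>Q. density lborel (normal_density 0 (sd q))) (euclid I) (\<lambda>z. \<lambda>s\<in>I. \<Sum>q\<in>Q. M s q * z q))"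
    (is "gaussian_law I ?K (distr ?P _ ?f)")
proof -
  \<comment> \<open>The value 1 off \<open>Q\<close> makes every factor a probability measure, as
    the product theory asks for all indices.\<close>
  define N where "N q = density lborel (normal_density 0 (if q \<in> Q then sd q else 1))" for q
  have P: "?P = Pi\<^sub>M Q N" by (intro PiM_cong) (auto simp: N_def)
  have pN: "prob_space (N q)" for q unfolding N_def using pos by (intro prob_space_normal_density) auto
  interpret product_sigma_finite N by (unfold product_sigma_finite_def) (blast intro: prob_space_imp_sigma_finite pN)
  have sN [simp, measurable_cong]: "sets (N q) = sets borel" for q by (simp add: N_def)
  have meas: "?f \<in> measurable ?P (euclid I)" unfolding P by (rule measurable_linear_map) simp
  have pr: "prob_space (distr ?P (euclid I) ?f)"
    using meas pN unfolding P by (intro prob_space.prob_space_distr prob_space_PiM)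
  have "(\<integral>x. cis (\<Sum>i\<in>I. t i * x i) \<partial>distr ?P (euclid I) ?f)
      = complex_of_real (exp (- (\<Sum>i\<in>I. \<Sum>j\<in>I. t i * t j * ?K i j) / 2))" for t
  proof -
    define r where "r q = (\<Sum>s\<in>I. t s * M s q)" for q
    have [measurable]: "(\<lambda>x. \<Sum>i\<in>I. t i * x i) \<in> borel_measurable (euclid I)" unfolding euclid_def by measurable
    have "(\<integral>x. cis (\<Sum>i\<in>I. t i * x i) \<partial>distr ?P (euclid I) ?f)
        = (\<integral>z. cis (\<Sum>i\<in>I. t i * ?f z i) \<partial>?P)"
      using meas by (subst integral_distr) auto
    also have "\<dots> = (\<integral>z. (\<Prod>q\<in>Q. cis (r q * z q)) \<partial>?P)"
    proof (rule Bochner_Integration.integral_cong[OF refl])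
      fix z
      have "(\<Sum>i\<in>I. t i * ?f z i) = (\<Sum>i\<in>I. \<Sum>q\<in>Q. t i * M i q * z q)"
        by (intro sum.cong) (auto simp: sum_distrib_left mult.assoc)
      also have "\<dots> = (\<Sum>q\<in>Q. r q * z q)" unfolding r_def sum_distrib_right by (rule sum.swap)
      finally have *: "(\<Sum>i\<in>I. t i * ?f z i) = (\<Sum>q\<in>Q. r q * z q)" .
      show "cis (\<Sum>i\<in>I. t i * ?f z i) = (\<Prod>q\<in>Q. cis (r q * z q))"
        unfolding * cis_conv_exp exp_sum[OF fin(2), symmetric] by (simp add: sum_distrib_left)
    qed
    also have "\<dots> = (\<Prod>q\<in>Q. \<integral>x. cis (r q * x) \<partial>N q)"
      unfolding P
    proof (rule product_integral_prod[OF fin(2)])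
      fix q assume "q \<in> Q"
      interpret prob_space "N q" by (rule pN)
      show "integrable (N q) (\<lambda>x. cis (r q * x))" by (intro integrable_const_bound[where B=1]) auto
    qed
    also have "\<dots> = (\<Prod>q\<in>Q. complex_of_real (exp (- (sd q)\<^sup>2 * (r q)\<^sup>2 / 2)))"
      by (intro prod.cong) (auto simp: N_def integral_cis_normal pos)
    also have "\<dots> = complex_of_real (exp (\<Sum>q\<in>Q. - (sd q)\<^sup>2 * (r q)\<^sup>2 / 2))"
      by (simp add: exp_sum[OF fin(2)])
    also have "(\<Sum>q\<in>Q. - (sd q)\<^sup>2 * (r q)\<^sup>2 / 2) = - (\<Sum>q\<in>Q. (sd q)\<^sup>2 * (r q)\<^sup>2) / 2"
      by (simp add: sum_negf sum_divide_distrib)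
    also have "(\<Sum>q\<in>Q. (sd q)\<^sup>2 * (r q)\<^sup>2) = (\<Sum>q\<in>Q. \<Sum>i\<in>I. \<Sum>j\<in>I. t i * t j * ((sd q)\<^sup>2 * M i q * M j q))"
      by (intro sum.cong) (auto simp: r_def power2_eq_square sum_product sum_distrib_left mult_ac)
    also have "\<dots> = (\<Sum>i\<in>I. \<Sum>q\<in>Q. \<Sum>j\<in>I. t i * t j * ((sd q)\<^sup>2 * M i q * M j q))"
      by (rule sum.swap)
    also have "\<dots> = (\<Sum>i\<in>I. \<Sum>j\<in>I. t i * t j * ?K i j)"
      by (intro sum.cong refl, subst sum.swap) (simp add: sum_distrib_left)
    finally show ?thesis .
  qed
  with pr show ?thesis by (simp add: gaussian_law_def)
qed

corollary gaussian_law_std: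
  assumes "finite I" "finite Q"
  shows "gaussian_law I (\<lambda>s t. \<Sum>q\<in>Q. M s q * M t q)
    (distr (std_gaussian Q) (euclid I) (\<lambda>z. \<lambda>s\<in>I. \<Sum>q\<in>Q. M s q * z q))"
  using gaussian_law_linear_image[OF assms, of "\<lambda>_. 1" M] by simp

text \<open>A coordinate has the law of \<open>sqrt (K k k)\<close> times a standard normal
  variable, whose fourth moment is 3. The identification runs through characteristic functions and
  so includes a vanishing variance.\<close>

lemma gaussian_law_fourth_moment:
  assumes "finite I" and law: "gaussian_law I K \<mu>" and k: "k \<in> I"
  shows "integrable \<mu> (\<lambda>x. x k ^ 4)" "(\<integral>x. x k ^ 4 \<partial>\<mu>) = 3 * (K k k)\<^sup>2"
proof -
  have sets [measurable_cong]: "sets \<mu> = sets (\<Pi>\<^sub>M i\<in>I. borel)" using law by (simp add: gaussian_law_def euclid_def)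
  interpret prob_space \<mu> using law by (simp add: gaussian_law_def)
  have [measurable]: "(\<lambda>x. x k) \<in> borel_measurable \<mu>" using k by measurable
  have ch: "(\<integral>x. cis (t * x k) \<partial>\<mu>) = complex_of_real (exp (- t\<^sup>2 * K k k / 2))" for t
  proof -
    have 1: "(\<Sum>i\<in>I. (if i = k then t else 0) * x i) = t * x k" for x :: "'a \<Rightarrow> real"
      using assms by (simp add: if_distrib[of "\<lambda>u. u * _"] cong: if_cong)
    have 2: "(\<Sum>i\<in>I. \<Sum>j\<in>I. (if i = k then t else 0) * (if j = k then t else 0) * K i j) = t\<^sup>2 * K k k"
    proof -
      have "(\<Sum>j\<in>I. (if i = k then t else 0) * (if j = k then t else 0) * K i j) = (if i = k then t\<^sup>2 * K k k else 0)" for i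
        using assms by (auto simp: if_distrib[of "\<lambda>u. _ * u"] if_distrib[of "\<lambda>u. u * _"] power2_eq_square cong: if_cong)
      then show ?thesis using assms by simp
    qed
    have "(\<integral>x. cis (\<Sum>i\<in>I. (if i = k then t else 0) * x i) \<partial>\<mu>) = complex_of_real (exp (- (t\<^sup>2 * K k k) / 2))"
      using law[unfolded gaussian_law_def, THEN conjunct2, THEN conjunct2, THEN spec, of "\<lambda>i. if i = k then t else 0"] unfolding 2 .
    then show ?thesis unfolding 1 by simp
  qed
  \<comment> \<open>Nonnegativity of the variance is read off from the characteristic function at
    frequency 1, whose modulus is at most 1.\<close>
  have K0: "0 \<le> K k k"
  proof -
    have "norm (\<integral>x. cis (1 * x k) \<partial>\<mu>) \<le> (\<integral>x. norm (cis (1 * x k)) \<partial>\<mu>)" by (rule integral_norm_bound)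
    then have "exp (- 1\<^sup>2 * K k k / 2) \<le> 1" unfolding ch by (simp add: prob_space)
    then show ?thesis by simp
  qed
  have "distr \<mu> borel (\<lambda>x. x k) = distr std_normal_distribution borel (\<lambda>x. sqrt (K k k) * x)"
  proof (rule finite_borel_measure_eq_if_char_eq)
    show "finite_measure (distr \<mu> borel (\<lambda>x. x k))" by (intro finite_measure_distr) measurable
    show "finite_measure (distr std_normal_distribution borel (\<lambda>x. sqrt (K k k) * x))"
      by (intro finite_measure.finite_measure_distr prob_space.finite_measure[OF prob_space_normal_density]) auto
    fix t
    have "(\<integral>x. cis (t * x) \<partial>distr std_normal_distribution borel (\<lambda>x. sqrt (K k k) * x))
      = (\<integral>x. cis ((t * sqrt (K k k)) * x) \<partial>std_normal_distribution)"
      by (subst integral_distr) (auto simp: mult.assoc)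
    also have "\<dots> = complex_of_real (exp (- t\<^sup>2 * K k k / 2))"
      unfolding integral_cis_std_normal using K0 by (simp add: power_mult_distrib)
    also have "\<dots> = (\<integral>x. cis (t * x) \<partial>distr \<mu> borel (\<lambda>x. x k))"
      unfolding ch[symmetric] by (subst integral_distr) auto
    finally show "(\<integral>x. cis (t * x) \<partial>distr \<mu> borel (\<lambda>x. x k)) 
      = (\<integral>x. cis (t * x) \<partial>distr std_normal_distribution borel (\<lambda>x. sqrt (K k k) * x))" by simp
  qed auto
  note eq = this
  have 4: "(sqrt (K k k) * x) ^ 4 = (K k k)\<^sup>2 * x ^ (2 * 2)" for x
  proof -
    have "(sqrt (K k k)) ^ 4 = ((sqrt (K k k))\<^sup>2)\<^sup>2" by simp
    then show ?thesis using K0 by (simp add: power_mult_distrib)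
  qed
  have i: "integrable std_normal_distribution (\<lambda>x. (sqrt (K k k) * x) ^ 4)"
    unfolding 4 by (intro integrable_mult_right std_normal_distribution_even_moments(2))
  then have "integrable (distr \<mu> borel (\<lambda>x. x k)) (\<lambda>x. x ^ 4)"
    unfolding eq by (subst integrable_distr_eq) auto
  then show "integrable \<mu> (\<lambda>x. x k ^ 4)" by (subst (asm) integrable_distr_eq) auto
  have "(\<integral>x. x k ^ 4 \<partial>\<mu>) = (\<integral>x. x ^ 4 \<partial>distr \<mu> borel (\<lambda>x. x k))" by (subst integral_distr) auto
  also have "\<dots> = (\<integral>x. (sqrt (K k k) * x) ^ 4 \<partial>std_normal_distribution)" unfolding eq by (subst integral_distr) auto
  also have "\<dots> = 3 * (K k k)\<^sup>2"
    unfolding 4 integral_mult_right_zero std_normal_distribution_even_moments(1) by (simp add: fact_numeral)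
  finally show "(\<integral>x. x k ^ 4 \<partial>\<mu>) = 3 * (K k k)\<^sup>2" .
qed

section \<open>Second-order expansion of Gaussian expectations in the covariance\<close>

text \<open>For \<open>-1 < u\<close>, the density of the centered normal law of variance
  \<open>1 + u\<close> with respect to the standard one.\<close>

definition variance_ratio :: "real \<Rightarrow> real \<Rightarrow> real" where
  "variance_ratio u x = exp (x\<^sup>2 * u / (2 * (1 + u))) / sqrt (1 + u)"

lemma variance_ratio_measurable [measurable]: "variance_ratio u \<in> borel_measurable borel"
  unfolding variance_ratio_def by measurable

lemma variance_ratio_nonneg: "-1 < u \<Longrightarrow> 0 \<le> variance_ratio u x"
  by (simp add: variance_ratio_def)

lemma normal_density_eq_ratio:
  assumes "-1 < u"
  shows "normal_density 0 (sqrt (1 + u)) x = std_normal_density x * variance_ratio u x"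
proof -
  have "- x\<^sup>2 / (2 * (1 + u)) = - x\<^sup>2 / 2 + x\<^sup>2 * u / (2 * (1 + u))"
    using assms by (simp add: field_simps)
  then show ?thesis
    using assms by (simp add: normal_density_def variance_ratio_def real_sqrt_mult flip: exp_add)
qed

text \<open>Moves the variances from the measure into a factor of the integrand that is smooth in
  \<open>u\<close>, so that an expansion in \<open>u\<close> asks no smoothness of the function that
  is integrated.\<close>

lemma PiM_normal_eq_density:
  assumes fin: "finite Q" and u: "\<And>q. q \<in> Q \<Longrightarrow> -1 < u q"
  shows "(\<Pi>\<^sub>M q\<in>Q. density lborel (normal_density 0 (sqrt (1 + u q))))
    = density (std_gaussian Q) (\<lambda>z. ennreal (\<Prod>q\<in>Q. variance_ratio (u q) (z q)))"
proof -
  define N where "N q = density lborel (normal_density 0 (sqrt (1 + (if q \<in> Q then u q else 0))))" for q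
  have P: "(\<Pi>\<^sub>M q\<in>Q. density lborel (normal_density 0 (sqrt (1 + u q)))) = Pi\<^sub>M Q N"
    by (intro PiM_cong) (auto simp: N_def)
  have "prob_space (N q)" for q 
    unfolding N_def using u[of q] by (intro prob_space_normal_density) auto
  then interpret N: product_sigma_finite N 
    by (unfold product_sigma_finite_def) (blast intro: prob_space_imp_sigma_finite)
  interpret S: product_sigma_finite "\<lambda>_. std_normal_distribution"
    by (unfold product_sigma_finite_def) (blast intro: prob_space_imp_sigma_finite prob_space_normal_density zero_less_one)
  have Nq: "N q = density std_normal_distribution (\<lambda>x. ennreal (variance_ratio (u q) x))" if "q \<in> Q" for q
    unfolding N_def using that u[OF that]
    by (simp add: density_density_eq normal_density_eq_ratio ennreal_mult variance_ratio_nonneg)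
  show ?thesis unfolding P
  proof (rule N.PiM_eqI[OF fin, symmetric])
    show "sets (density (std_gaussian Q) (\<lambda>z. ennreal (\<Prod>q\<in>Q. variance_ratio (u q) (z q)))) = sets (Pi\<^sub>M Q N)"
      by (auto simp: N_def intro!: sets_PiM_cong)
    fix A assume A: "\<And>q. q \<in> Q \<Longrightarrow> A q \<in> sets (N q)"
    then have Ab: "\<And>q. q \<in> Q \<Longrightarrow> A q \<in> sets borel" by (simp add: N_def)
    have box: "Pi\<^sub>E Q A \<in> sets (std_gaussian Q)" using Ab fin by (intro sets_PiM_I_finite) auto
    have "emeasure (density (std_gaussian Q) (\<lambda>z. ennreal (\<Prod>q\<in>Q. variance_ratio (u q) (z q)))) (Pi\<^sub>E Q A)
      = (\<integral>\<^sup>+z. ennreal (\<Prod>q\<in>Q. variance_ratio (u q) (z q)) * indicator (Pi\<^sub>E Q A) z \<partial>std_gaussian Q)"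
      by (intro emeasure_density box) measurable
    also have "\<dots> = (\<integral>\<^sup>+z. (\<Prod>q\<in>Q. ennreal (variance_ratio (u q) (z q)) * indicator (A q) (z q)) \<partial>std_gaussian Q)"
    proof (rule nn_integral_cong)
      fix z assume "z \<in> space (std_gaussian Q)"
      then have "(indicator (Pi\<^sub>E Q A) z :: ennreal) = (\<Prod>q\<in>Q. indicator (A q) (z q))"
        using fin by (auto simp: indicator_def PiE_def Pi_def space_PiM)
      then show "ennreal (\<Prod>q\<in>Q. variance_ratio (u q) (z q)) * indicator (Pi\<^sub>E Q A) z
          = (\<Prod>q\<in>Q. ennreal (variance_ratio (u q) (z q)) * indicator (A q) (z q))"
        using u by (simp add: prod.distrib prod_ennreal variance_ratio_nonneg)
    qed
    also have "\<dots> = (\<Prod>q\<in>Q. \<integral>\<^sup>+x. ennreal (variance_ratio (u q) x) * indicator (A q) x \<partial>std_normal_distribution)"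
    proof (rule S.product_nn_integral_prod[OF fin])
      fix q assume "q \<in> Q"
      note [measurable] = Ab[OF this]
      show "(\<lambda>x. ennreal (variance_ratio (u q) x) * indicator (A q) x) \<in> borel_measurable std_normal_distribution"
        by measurable
    qed
    also have "\<dots> = (\<Prod>q\<in>Q. emeasure (N q) (A q))"
    proof (rule prod.cong[OF refl])
      fix q assume q: "q \<in> Q"
      show "(\<integral>\<^sup>+x. ennreal (variance_ratio (u q) x) * indicator (A q) x \<partial>std_normal_distribution) = emeasure (N q) (A q)"
        unfolding Nq[OF q] using Ab[OF q] by (subst emeasure_density) auto
    qed
    finally show "emeasure (density (std_gaussian Q) (\<lambda>z. ennreal (\<Prod>q\<in>Q. variance_ratio (u q) (z q)))) (Pi\<^sub>E Q A)
      = (\<Prod>q\<in>Q. emeasure (N q) (A q))" .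
  qed
qed

text \<open>Second-order Taylor formula on the segment from 0 to \<open>u\<close>. The logarithm
  \<open>L\<close> of the product is explicit, so the second derivative is \<open>exp (L t)\<close>
  times \<open>(L1 t)\<^sup>2 + L2 t\<close>; here \<open>L1\<close> is of order \<eta> and
  \<open>L2\<close> of order \<eta> squared. The bound \<eta> \<le> 1/2 keeps all variances between
  1/2 and 3/2 and hence the exponential growth in \<open>s\<close> far below
  \<open>exp (s / 2)\<close>, the decay of the Gaussian density.\<close>

lemma variance_ratio_taylor:
  fixes u z :: "'q \<Rightarrow> real"
  assumes fin: "finite Q" and \<eta>: "\<eta> \<le> 1 / 2" and u: "\<And>q. q \<in> Q \<Longrightarrow> \<bar>u q\<bar> \<le> \<eta>"
  defines "s \<equiv> \<Sum>q\<in>Q. (z q)\<^sup>2" and "k \<equiv> real (card Q)"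
  shows "\<bar>(\<Prod>q\<in>Q. variance_ratio (u q) (z q)) - 1 - (\<Sum>q\<in>Q. u q * (((z q)\<^sup>2 - 1) / 2))\<bar>
    \<le> \<eta>\<^sup>2 * ((2 * k + 8 * s + (k + 2 * s)\<^sup>2) * exp (k + s / 6))"
proof -
  have k: "0 \<le> k" and s: "0 \<le> s" by (auto simp: k_def s_def intro: sum_nonneg)
  define L where "L t = (\<Sum>q\<in>Q. - ln (1 + t * u q) / 2 + (z q)\<^sup>2 * (1 - 1 / (1 + t * u q)) / 2)" for t
  define L1 where "L1 t = (\<Sum>q\<in>Q. - u q / (2 * (1 + t * u q)) + (z q)\<^sup>2 * (u q / (1 + t * u q)\<^sup>2) / 2)" for t
  define L2 where "L2 t = (\<Sum>q\<in>Q. (u q)\<^sup>2 / (2 * (1 + t * u q)\<^sup>2) - (z q)\<^sup>2 * ((u q)\<^sup>2 / (1 + t * u q) ^ 3))" for t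
  have tu: "\<bar>t * u q\<bar> \<le> 1 / 2" "1 / 2 \<le> 1 + t * u q" if "0 \<le> t" "t \<le> 1" "q \<in> Q" for t q
  proof -
    have "\<bar>t\<bar> * \<bar>u q\<bar> \<le> 1 * (1 / 2)" using that u[OF that(3)] \<eta> by (intro mult_mono) auto
    then show *: "\<bar>t * u q\<bar> \<le> 1 / 2" by (simp add: abs_mult)
    then show "1 / 2 \<le> 1 + t * u q" by (simp add: abs_le_iff)
  qed
  have dL: "(L has_real_derivative L1 t) (at t)" if "0 \<le> t" "t \<le> 1" for t
    unfolding L_def L1_def
  proof (intro DERIV_sum)
    fix q assume "q \<in> Q"
    define w where "w = 1 + t * u q"
    have w: "1 / 2 \<le> w" using tu[OF that \<open>q \<in> Q\<close>] by (simp add: w_def)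
    have 1: "((\<lambda>t. 1 + t * u q) has_real_derivative u q) (at t)" by (auto intro!: derivative_eq_intros)
    have 2: "((\<lambda>t. inverse (1 + t * u q)) has_real_derivative - (inverse w * u q * inverse w)) (at t)"
      using DERIV_inverse'[OF 1] w by (simp add: w_def)
    have lnd: "((\<lambda>t. ln (1 + t * u q)) has_real_derivative inverse w * u q) (at t)"
    proof -
      have "0 < 1 + t * u q" using w unfolding w_def by linarith
      from DERIV_chain2[OF DERIV_ln[OF this] 1] show ?thesis unfolding w_def .
    qed
    have 3: "((\<lambda>t. - (1 / 2) * ln (1 + t * u q) + (z q)\<^sup>2 / 2 * (1 - inverse (1 + t * u q))) has_real_derivative
      - (1 / 2) * (inverse w * u q) + (z q)\<^sup>2 / 2 * (inverse w * u q * inverse w)) (at t)"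
      using DERIV_add[OF DERIV_cmult[OF lnd, of "- (1 / 2)"] DERIV_cmult[OF DERIV_diff[OF DERIV_const[of 1] 2], of "(z q)\<^sup>2 / 2"]]
      unfolding diff_0 minus_minus .
    have 4: "(\<lambda>t. - (1 / 2) * ln (1 + t * u q) + (z q)\<^sup>2 / 2 * (1 - inverse (1 + t * u q)))
      = (\<lambda>t. - ln (1 + t * u q) / 2 + (z q)\<^sup>2 * (1 - 1 / (1 + t * u q)) / 2)"
      by (intro ext) (simp add: inverse_eq_divide)
    have 5: "- (1 / 2) * (inverse w * u q) + (z q)\<^sup>2 / 2 * (inverse w * u q * inverse w)
      = - u q / (2 * w) + (z q)\<^sup>2 * (u q / w\<^sup>2) / 2"
      by (simp add: inverse_eq_divide power2_eq_square)
    show "((\<lambda>t. - ln (1 + t * u q) / 2 + (z q)\<^sup>2 * (1 - 1 / (1 + t * u q)) / 2) has_real_derivative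
      - u q / (2 * (1 + t * u q)) + (z q)\<^sup>2 * (u q / (1 + t * u q)\<^sup>2) / 2) (at t)"
      using 3 unfolding 4 5 unfolding w_def .
  qed
  have dL1: "(L1 has_real_derivative L2 t) (at t)" if "0 \<le> t" "t \<le> 1" for t
    unfolding L1_def L2_def
  proof (intro DERIV_sum)
    fix q assume "q \<in> Q"
    define w where "w = 1 + t * u q"
    have w: "1 / 2 \<le> w" using tu[OF that \<open>q \<in> Q\<close>] by (simp add: w_def)
    have 1: "((\<lambda>t. 1 + t * u q) has_real_derivative u q) (at t)" by (auto intro!: derivative_eq_intros)
    have 2: "((\<lambda>t. inverse (1 + t * u q)) has_real_derivative - (inverse w * u q * inverse w)) (at t)"
      using DERIV_inverse'[OF 1] w by (simp add: w_def)
    have 3: "((\<lambda>t. - u q / 2 * inverse (1 + t * u q) + (z q)\<^sup>2 * u q / 2 * (inverse (1 + t * u q))\<^sup>2) has_real_derivative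
      - u q / 2 * (- (inverse w * u q * inverse w)) + (z q)\<^sup>2 * u q / 2 * (2 * inverse w * (- (inverse w * u q * inverse w)))) (at t)"
      using w by (auto intro!: derivative_eq_intros 2 simp: w_def[symmetric])
    have 4: "(\<lambda>t. - u q / 2 * inverse (1 + t * u q) + (z q)\<^sup>2 * u q / 2 * (inverse (1 + t * u q))\<^sup>2)
      = (\<lambda>t. - u q / (2 * (1 + t * u q)) + (z q)\<^sup>2 * (u q / (1 + t * u q)\<^sup>2) / 2)"
      by (simp add: field_simps fun_eq_iff)
    have 5: "- u q / 2 * (- (inverse w * u q * inverse w)) + (z q)\<^sup>2 * u q / 2 * (2 * inverse w * (- (inverse w * u q * inverse w)))
      = (u q)\<^sup>2 / (2 * w\<^sup>2) - (z q)\<^sup>2 * ((u q)\<^sup>2 / w ^ 3)"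
      using w by (simp add: field_simps power2_eq_square power3_eq_cube)
    show "((\<lambda>t. - u q / (2 * (1 + t * u q)) + (z q)\<^sup>2 * (u q / (1 + t * u q)\<^sup>2) / 2) has_real_derivative
      (u q)\<^sup>2 / (2 * (1 + t * u q)\<^sup>2) - (z q)\<^sup>2 * ((u q)\<^sup>2 / (1 + t * u q) ^ 3)) (at t)"
      using 3 unfolding 4 5 unfolding w_def .
  qed
  \<comment> \<open>The derivatives of order 0, 1 and 2 of \<open>exp (L t)\<close>, in the form
    that the Maclaurin formula wants.\<close>
  define G where "G m t = (if m = 0 then exp (L t) else if m = 1 then exp (L t) * L1 t
     else exp (L t) * (L1 t)\<^sup>2 + exp (L t) * L2 t)" for m :: nat and t
  have "\<exists>t. 0 < t \<and> t < 1 \<and> G 0 1 = (\<Sum>m<2. G m 0 / fact m * 1 ^ m) + G 2 t / fact 2 * 1 ^ 2"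
  proof (rule Maclaurin)
    show "\<forall>m t. m < 2 \<and> 0 \<le> t \<and> t \<le> 1 \<longrightarrow> (G m has_real_derivative G (Suc m) t) (at t)"
    proof (intro allI impI)
      fix m :: nat and t :: real assume *: "m < 2 \<and> 0 \<le> t \<and> t \<le> 1"
      then have d: "(L has_real_derivative L1 t) (at t)" "(L1 has_real_derivative L2 t) (at t)" using dL dL1 by auto
      consider "m = 0" | "m = 1" using * by linarith
      then show "(G m has_real_derivative G (Suc m) t) (at t)"
      proof cases
        case 1
        then show ?thesis unfolding G_def by (auto intro!: derivative_eq_intros d)
      next
        case 2
        then show ?thesis unfolding G_def 
          by (auto intro!: derivative_eq_intros d simp: power2_eq_square algebra_simps)
      qed
    qed
  qed auto
  then obtain t where t: "0 < t" "t < 1" and eq: "G 0 1 = G 0 0 + G 1 0 + G 2 t / 2"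
    by (auto simp: numeral_2_eq_2)
  have L0: "L 0 = 0" by (simp add: L_def)
  have G1: "G 0 1 = (\<Prod>q\<in>Q. variance_ratio (u q) (z q))"
  proof -
    have "exp (- ln (1 + 1 * u q) / 2 + (z q)\<^sup>2 * (1 - 1 / (1 + 1 * u q)) / 2) = variance_ratio (u q) (z q)" if "q \<in> Q" for q
    proof -
      have p: "0 < 1 + u q" using tu[of 1 q] that by simp
      have "- ln (1 + u q) / 2 = - ln (sqrt (1 + u q))" using p by (simp add: ln_sqrt)
      then have A: "exp (- ln (1 + u q) / 2) = 1 / sqrt (1 + u q)" using p by (simp add: exp_minus inverse_eq_divide)
      have B: "(z q)\<^sup>2 * (1 - 1 / (1 + u q)) / 2 = (z q)\<^sup>2 * u q / (2 * (1 + u q))"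
        using p by (simp add: field_simps)
      show ?thesis unfolding mult_1 exp_add variance_ratio_def A B by simp
    qed
    then show ?thesis by (simp add: G_def L_def exp_sum[OF fin] cong: prod.cong)
  qed
  have G0: "G 0 0 = 1" "G 1 0 = (\<Sum>q\<in>Q. u q * (((z q)\<^sup>2 - 1) / 2))"
    by (auto simp: G_def L0 L1_def field_simps intro!: sum.cong)
  have bL: "L t \<le> k + s / 6"
  proof -
    have "L t \<le> (\<Sum>q\<in>Q. 1 + (z q)\<^sup>2 / 6)" unfolding L_def
    proof (rule sum_mono)
      fix q assume q: "q \<in> Q"
      define w where "w = 1 + t * u q"
      have w: "1 / 2 \<le> w" "w \<le> 3 / 2" using tu[of t q] t q by (auto simp: w_def abs_le_iff)
      have "ln (1 / w) \<le> 1 / w - 1" using w by (intro ln_le_minus_one) auto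
      also have "\<dots> \<le> 1" using w by (simp add: field_simps)
      finally have 1: "- ln w / 2 \<le> 1" using w by (simp add: ln_div)
      define r where "r = (z q)\<^sup>2 * (1 - 1 / w)"
      \<comment> \<open>Extremal at \<open>w = 3 / 2\<close>, the greatest variance allowed; half of
        1/3 is the 1/6 in the claim.\<close>
      have "1 - 1 / w \<le> 1 / 3" using w by (simp add: field_simps)
      then have "r \<le> (z q)\<^sup>2 * (1 / 3)" unfolding r_def by (intro mult_left_mono) auto
      with 1 show "- ln (1 + t * u q) / 2 + (z q)\<^sup>2 * (1 - 1 / (1 + t * u q)) / 2 \<le> 1 + (z q)\<^sup>2 / 6"
        unfolding w_def[symmetric] r_def[symmetric] by linarith
    qed
    also have "\<dots> = k + s / 6" by (simp add: k_def s_def sum.distrib sum_divide_distrib)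
    finally show ?thesis .
  qed
  have inv: "1 / (1 + t * u q) \<le> 2" "0 \<le> 1 / (1 + t * u q)" if "q \<in> Q" for q
    using tu[of t q] t that by (auto simp: field_simps)
  have bL1: "\<bar>L1 t\<bar> \<le> \<eta> * (k + 2 * s)"
  proof -
    have "\<bar>L1 t\<bar> \<le> (\<Sum>q\<in>Q. \<eta> * (1 + 2 * (z q)\<^sup>2))" unfolding L1_def
    proof (rule order_trans[OF sum_abs], rule sum_mono)
      fix q assume q: "q \<in> Q"
      define w where "w = 1 / (1 + t * u q)"
      have w: "0 \<le> w" "w \<le> 2" using inv[OF q] by (auto simp: w_def)
      have "- u q / (2 * (1 + t * u q)) + (z q)\<^sup>2 * (u q / (1 + t * u q)\<^sup>2) / 2
        = u q * (- (w / 2) + (z q)\<^sup>2 * (w\<^sup>2 / 2))"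
        by (simp add: w_def field_simps power_divide)
      moreover have "\<bar>- (w / 2) + (z q)\<^sup>2 * (w\<^sup>2 / 2)\<bar> \<le> 1 + 2 * (z q)\<^sup>2"
      proof -
        have "w\<^sup>2 \<le> 2\<^sup>2" using w by (intro power_mono)
        then have "(z q)\<^sup>2 * (w\<^sup>2 / 2) \<le> (z q)\<^sup>2 * 2" by (intro mult_left_mono) auto
        moreover have "0 \<le> (z q)\<^sup>2 * (w\<^sup>2 / 2)" "0 \<le> (z q)\<^sup>2" by simp_all
        ultimately show ?thesis using w unfolding abs_le_iff by linarith
      qed
      ultimately show "\<bar>- u q / (2 * (1 + t * u q)) + (z q)\<^sup>2 * (u q / (1 + t * u q)\<^sup>2) / 2\<bar> \<le> \<eta> * (1 + 2 * (z q)\<^sup>2)"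
        using u[OF q] by (auto simp: abs_mult intro!: mult_mono)
    qed
    also have "\<dots> = \<eta> * (k + 2 * s)" by (simp add: k_def s_def sum.distrib flip: sum_distrib_left)
    finally show ?thesis .
  qed
  have bL2: "\<bar>L2 t\<bar> \<le> \<eta>\<^sup>2 * (2 * k + 8 * s)"
  proof -
    have "\<bar>L2 t\<bar> \<le> (\<Sum>q\<in>Q. \<eta>\<^sup>2 * (2 + 8 * (z q)\<^sup>2))" unfolding L2_def
    proof (rule order_trans[OF sum_abs], rule sum_mono)
      fix q assume q: "q \<in> Q"
      define w where "w = 1 / (1 + t * u q)"
      have w: "0 \<le> w" "w \<le> 2" using inv[OF q] by (auto simp: w_def)
      have "(u q)\<^sup>2 / (2 * (1 + t * u q)\<^sup>2) - (z q)\<^sup>2 * ((u q)\<^sup>2 / (1 + t * u q) ^ 3)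
        = (u q)\<^sup>2 * (w\<^sup>2 / 2 - (z q)\<^sup>2 * w ^ 3)"
        by (simp add: w_def field_simps power_divide)
      moreover have "\<bar>w\<^sup>2 / 2 - (z q)\<^sup>2 * w ^ 3\<bar> \<le> 2 + 8 * (z q)\<^sup>2"
      proof -
        have "w\<^sup>2 \<le> 2\<^sup>2" "w ^ 3 \<le> 2 ^ 3" using w by (intro power_mono; simp)+
        then have "(z q)\<^sup>2 * w ^ 3 \<le> (z q)\<^sup>2 * 8" "w\<^sup>2 / 2 \<le> 2" by (auto intro!: mult_left_mono)
        moreover have "0 \<le> (z q)\<^sup>2 * w ^ 3" "0 \<le> w\<^sup>2" "0 \<le> (z q)\<^sup>2" using w by auto
        ultimately show ?thesis unfolding abs_le_iff by linarith
      qed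
      moreover have "(u q)\<^sup>2 \<le> \<eta>\<^sup>2" using u[OF q] by (simp add: abs_le_square_iff[symmetric])
      ultimately show "\<bar>(u q)\<^sup>2 / (2 * (1 + t * u q)\<^sup>2) - (z q)\<^sup>2 * ((u q)\<^sup>2 / (1 + t * u q) ^ 3)\<bar> \<le> \<eta>\<^sup>2 * (2 + 8 * (z q)\<^sup>2)"
        by (auto simp: abs_mult intro!: mult_mono)
    qed
    also have "\<dots> = \<eta>\<^sup>2 * (2 * k + 8 * s)" by (simp add: k_def s_def sum.distrib flip: sum_distrib_left)
    finally show ?thesis .
  qed
  have "(\<Prod>q\<in>Q. variance_ratio (u q) (z q)) - 1 - (\<Sum>q\<in>Q. u q * (((z q)\<^sup>2 - 1) / 2)) = G 2 t / 2"
    using eq G1 G0 by simp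
  also have "\<bar>G 2 t / 2\<bar> \<le> \<bar>G 2 t\<bar>" by simp
  also have "\<bar>G 2 t\<bar> = exp (L t) * \<bar>(L1 t)\<^sup>2 + L2 t\<bar>" by (simp add: G_def abs_mult flip: distrib_left)
  also have "\<dots> \<le> exp (k + s / 6) * (\<eta>\<^sup>2 * (2 * k + 8 * s + (k + 2 * s)\<^sup>2))"
  proof (intro mult_mono)
    have "(L1 t)\<^sup>2 \<le> (\<eta> * (k + 2 * s))\<^sup>2" using power_mono[OF bL1 abs_ge_zero, of 2] by simp
    then have "\<bar>(L1 t)\<^sup>2\<bar> \<le> \<eta>\<^sup>2 * (k + 2 * s)\<^sup>2" by (simp add: power_mult_distrib)
    with bL2 show "\<bar>(L1 t)\<^sup>2 + L2 t\<bar> \<le> \<eta>\<^sup>2 * (2 * k + 8 * s + (k + 2 * s)\<^sup>2)"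
      unfolding distrib_left[of "\<eta>\<^sup>2" _ "(k + 2 * s)\<^sup>2"] by linarith
  qed (use bL in auto)
  finally show ?thesis by (simp add: mult_ac)
qed

lemma prob_space_std_gaussian: "prob_space (std_gaussian Q)"
  by (intro prob_space_PiM prob_space_normal_density) simp

lemma std_gaussian_sets: "sets (std_gaussian Q) = sets (euclid Q)"
  unfolding euclid_def by (intro sets_PiM_cong) auto

text \<open>Each factor \<open>exp (x\<^sup>2 / 4)\<close> times the standard density is a multiple
  of the normal density of variance 2. The rate 1/4 leaves room above the 1/6 of the Taylor
  remainder for polynomial factors.\<close>

lemma std_gaussian_integrable_exp:
  assumes "finite Q"
  shows "integrable (std_gaussian Q) (\<lambda>z. exp ((\<Sum>q\<in>Q. (z q)\<^sup>2) / 4))"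
proof -
  interpret product_sigma_finite "\<lambda>_. std_normal_distribution"
    by (unfold product_sigma_finite_def) (blast intro: prob_space_imp_sigma_finite prob_space_normal_density zero_less_one)
  have *: "std_normal_density x * exp (x\<^sup>2 / 4) = sqrt 2 * normal_density 0 (sqrt 2) x" for x :: real
  proof -
    have "- x\<^sup>2 / 2 + x\<^sup>2 / 4 = - x\<^sup>2 / (2 * (sqrt 2)\<^sup>2)" by simp
    then have e: "exp (- x\<^sup>2 / 2) * exp (x\<^sup>2 / 4) = exp (- x\<^sup>2 / (2 * (sqrt 2)\<^sup>2))" by (simp only: exp_add[symmetric])
    have "std_normal_density x * exp (x\<^sup>2 / 4) = 1 / sqrt (2 * pi) * (exp (- x\<^sup>2 / 2) * exp (x\<^sup>2 / 4))"
      by (simp add: normal_density_def)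
    also have "\<dots> = sqrt 2 * normal_density 0 (sqrt 2) x"
      unfolding e by (simp add: normal_density_def real_sqrt_mult field_simps)
    finally show ?thesis .
  qed
  have "integrable std_normal_distribution (\<lambda>x. exp (x\<^sup>2 / 4))"
    by (subst integrable_density) (auto simp: *)
  then have "integrable (std_gaussian Q) (\<lambda>z. \<Prod>q\<in>Q. exp ((z q)\<^sup>2 / 4))"
    using assms by (intro product_integrable_prod) auto
  then show ?thesis by (simp add: exp_sum[OF assms] sum_divide_distrib)
qed

lemma abs_integral_le:
  fixes f h :: "'a \<Rightarrow> real"
  assumes h: "integrable M h" and f: "f \<in> borel_measurable M" and le: "\<And>x. x \<in> space M \<Longrightarrow> \<bar>f x\<bar> \<le> h x"
  shows "integrable M f" "\<bar>\<integral>x. f x \<partial>M\<bar> \<le> (\<integral>x. h x \<partial>M)"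
proof -
  show i: "integrable M f"
    by (rule Bochner_Integration.integrable_bound[OF h f AE_I2]) (use le in \<open>auto intro: order_trans[OF _ abs_ge_self]\<close>)
  have "\<bar>\<integral>x. f x \<partial>M\<bar> \<le> (\<integral>x. \<bar>f x\<bar> \<partial>M)" by (rule integral_abs_bound)
  also have "\<dots> \<le> (\<integral>x. h x \<partial>M)" using i h le by (intro integral_mono) auto
  finally show "\<bar>\<integral>x. f x \<partial>M\<bar> \<le> (\<integral>x. h x \<partial>M)" .
qed

text \<open>The room between 1/6 and 1/4 is 1/12. A fourth power has to fit into it, so
  \<open>1 + s\<close> is compared with an exponential of rate 1/48, a quarter of 1/12.\<close>

lemma power4_le_exp:
  fixes s :: real
  assumes "0 \<le> s"
  shows "(1 + s) ^ 4 \<le> 48 ^ 4 * exp (s / 12)"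
proof -
  have "1 + s \<le> 48 * exp (s / 48)" using exp_ge_add_one_self[of "s / 48"] assms by linarith
  then have "(1 + s) ^ 4 \<le> (48 * exp (s / 48)) ^ 4" using assms by (intro power_mono) auto
  also have "\<dots> = 48 ^ 4 * exp (s / 12)" unfolding power_mult_distrib exp_of_nat_mult[symmetric] by simp
  finally show ?thesis .
qed

text \<open>The bracket and \<open>exp (card Q)\<close> come from the Taylor remainder,
  \<open>48 ^ 4\<close> from absorbing a polynomial in \<open>s\<close> into an exponential, the
  integral from the majorant \<open>exp (s / 4)\<close>.\<close>

definition expansion_const :: "'q set \<Rightarrow> real" where
  "expansion_const Q = 48 ^ 4 * (2 * real (card Q) + 8 + (real (card Q) + 2)\<^sup>2) * exp (real (card Q))
     * (\<integral>z. exp ((\<Sum>q\<in>Q. (z q)\<^sup>2) / 4) \<partial>std_gaussian Q)"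

lemma expansion_const_nonneg: "0 \<le> expansion_const Q"
  unfolding expansion_const_def by (intro mult_nonneg_nonneg add_nonneg_nonneg integral_nonneg) auto

text \<open>All integrands lie below a multiple of \<open>exp (s / 4)\<close>: \<open>F\<close> has
  degree two in \<open>s\<close>, the coefficient or the Taylor remainder adds at most degree two,
  and the remainder also contributes the rate 1/6. The sum of squares \<open>s\<close> makes degree
  two in \<open>s\<close> the quartic growth of the test functions.\<close>

lemma variance_ratio_expansion:
  fixes F :: "('q \<Rightarrow> real) \<Rightarrow> real"
  assumes fin: "finite Q" and F [measurable]: "F \<in> borel_measurable (std_gaussian Q)"
    and bnd: "\<And>z. z \<in> space (std_gaussian Q) \<Longrightarrow> \<bar>F z\<bar> \<le> b * (1 + (\<Sum>q\<in>Q. (z q)\<^sup>2))\<^sup>2"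
    and b: "0 \<le> b"
  shows "integrable (std_gaussian Q) F"
    and "q \<in> Q \<Longrightarrow> \<bar>\<integral>z. F z * (((z q)\<^sup>2 - 1) / 2) \<partial>std_gaussian Q\<bar> \<le> b * expansion_const Q"
    and "\<lbrakk>0 \<le> \<eta>; \<eta> \<le> 1 / 2; \<And>q. q \<in> Q \<Longrightarrow> \<bar>u q\<bar> \<le> \<eta>\<rbrakk> \<Longrightarrow>
      \<bar>(\<integral>z. F z * (\<Prod>q\<in>Q. variance_ratio (u q) (z q)) \<partial>std_gaussian Q) - (\<integral>z. F z \<partial>std_gaussian Q)
        - (\<Sum>q\<in>Q. u q * (\<integral>z. F z * (((z q)\<^sup>2 - 1) / 2) \<partial>std_gaussian Q))\<bar> \<le> \<eta>\<^sup>2 * b * expansion_const Q"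
proof -
  let ?S = "std_gaussian Q"
  define k where "k = real (card Q)"
  define s where "s z = (\<Sum>q\<in>Q. (z q)\<^sup>2)" for z :: "'q \<Rightarrow> real"
  define D where "D = 48 ^ 4 * (2 * k + 8 + (k + 2)\<^sup>2) * exp k"
  have k0: "0 \<le> k" by (simp add: k_def)
  have s0: "0 \<le> s z" for z by (simp add: s_def sum_nonneg)
  have D1: "48 ^ 4 \<le> D"
  proof -
    have "48 ^ 4 * 1 * 1 \<le> D" unfolding D_def using k0 by (intro mult_mono) auto
    then show ?thesis by simp
  qed
  have eint: "integrable ?S (\<lambda>z. exp (s z / 4))" unfolding s_def by (rule std_gaussian_integrable_exp[OF fin])
  have EC: "expansion_const Q = D * (\<integral>z. exp (s z / 4) \<partial>?S)"
    by (simp add: expansion_const_def D_def k_def s_def)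
  have p4: "(1 + s z) ^ 4 \<le> D * exp (s z / 4)" for z
  proof -
    have "(1 + s z) ^ 4 \<le> 48 ^ 4 * exp (s z / 12)" by (rule power4_le_exp[OF s0])
    also have "\<dots> \<le> D * exp (s z / 4)" using D1 s0[of z] by (intro mult_mono) auto
    finally show ?thesis .
  qed
  have meas [measurable]: "(\<lambda>z. z q) \<in> borel_measurable ?S" if "q \<in> Q" for q using that by measurable
  have bound: "integrable ?S G \<and> \<bar>\<integral>z. G z \<partial>?S\<bar> \<le> a * expansion_const Q"
    if G: "G \<in> borel_measurable ?S" and "\<And>z. z \<in> space ?S \<Longrightarrow> \<bar>G z\<bar> \<le> a * (D * exp (s z / 4))" for G a
  proof -
    have i: "integrable ?S (\<lambda>z. a * (D * exp (s z / 4)))" using eint by simp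
    have I: "integrable ?S G" by (rule abs_integral_le(1)[OF i G that(2)])
    have "\<bar>\<integral>z. G z \<partial>?S\<bar> \<le> (\<integral>z. a * (D * exp (s z / 4)) \<partial>?S)"
      by (rule abs_integral_le(2)[OF i G that(2)])
    with I show ?thesis by (simp add: EC mult.assoc)
  qed
  have pw: "(1 + s z)\<^sup>2 \<le> (1 + s z) ^ 4" for z using s0[of z] by (intro power_increasing) auto
  show intF: "integrable ?S F"
  proof (rule bound[THEN conjunct1, OF F])
    fix z assume "z \<in> space ?S"
    from bnd[OF this] have "\<bar>F z\<bar> \<le> b * (1 + s z)\<^sup>2" by (simp add: s_def)
    also have "\<dots> \<le> b * (D * exp (s z / 4))" using b order_trans[OF pw p4] by (intro mult_left_mono)
    finally show "\<bar>F z\<bar> \<le> b * (D * exp (s z / 4))" .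
  qed
  have lin: "integrable ?S (\<lambda>z. F z * (((z q)\<^sup>2 - 1) / 2)) \<and> \<bar>\<integral>z. F z * (((z q)\<^sup>2 - 1) / 2) \<partial>?S\<bar> \<le> b * expansion_const Q" if q: "q \<in> Q" for q
  proof (rule bound)
    show "(\<lambda>z. F z * (((z q)\<^sup>2 - 1) / 2)) \<in> borel_measurable ?S" using q by measurable
    fix z assume z: "z \<in> space ?S"
    have "(z q)\<^sup>2 \<le> s z" unfolding s_def using fin q by (intro member_le_sum) auto
    moreover have "(1 + s z)\<^sup>2 = 1 + 2 * s z + (s z)\<^sup>2" by (simp add: power2_sum)
    moreover have "\<bar>(x - 1) / 2\<bar> \<le> y" if "x \<le> t" "y = 1 + 2 * t + r" "0 \<le> x" "0 \<le> t" "0 \<le> r" for x y t r :: real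
      using that by (simp add: abs_le_iff)
    ultimately have "\<bar>((z q)\<^sup>2 - 1) / 2\<bar> \<le> (1 + s z)\<^sup>2" using s0 zero_le_power2 by blast
    then have "\<bar>F z * (((z q)\<^sup>2 - 1) / 2)\<bar> \<le> (b * (1 + s z)\<^sup>2) * (1 + s z)\<^sup>2"
      unfolding abs_mult using bnd[OF z] b by (intro mult_mono) (auto simp: s_def)
    also have "\<dots> = b * (1 + s z) ^ 4" by (simp add: power2_eq_square power4_eq_xxxx)
    also have "\<dots> \<le> b * (D * exp (s z / 4))" using b p4 by (intro mult_left_mono)
    finally show "\<bar>F z * (((z q)\<^sup>2 - 1) / 2)\<bar> \<le> b * (D * exp (s z / 4))" .
  qed
  then show "q \<in> Q \<Longrightarrow> \<bar>\<integral>z. F z * (((z q)\<^sup>2 - 1) / 2) \<partial>?S\<bar> \<le> b * expansion_const Q" by blast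
  assume \<eta>: "0 \<le> \<eta>" "\<eta> \<le> 1 / 2" and u: "\<And>q. q \<in> Q \<Longrightarrow> \<bar>u q\<bar> \<le> \<eta>"
  define \<rho> where "\<rho> z = (\<Prod>q\<in>Q. variance_ratio (u q) (z q))" for z
  \<comment> \<open>The part of the integrand that the linear expansion misses; the pointwise Taylor
    estimate bounds it with the factor \<eta> squared.\<close>
  define G where "G z = F z * (\<rho> z - 1 - (\<Sum>q\<in>Q. u q * (((z q)\<^sup>2 - 1) / 2)))" for z
  have [measurable]: "\<rho> \<in> borel_measurable ?S" unfolding \<rho>_def by measurable
  have GG: "integrable ?S G \<and> \<bar>\<integral>z. G z \<partial>?S\<bar> \<le> (\<eta>\<^sup>2 * b) * expansion_const Q"
  proof (rule bound)
    show "G \<in> borel_measurable ?S" unfolding G_def by measurable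
    fix z assume z: "z \<in> space ?S"
    have "\<bar>G z\<bar> \<le> (b * (1 + s z)\<^sup>2) * (\<eta>\<^sup>2 * ((2 * k + 8 * s z + (k + 2 * s z)\<^sup>2) * exp (k + s z / 6)))"
      unfolding G_def \<rho>_def abs_mult using bnd[OF z] variance_ratio_taylor[OF fin \<eta>(2) u, where z = z] b
      by (intro mult_mono) (auto simp: s_def k_def)
    also have "\<dots> = (\<eta>\<^sup>2 * b) * ((1 + s z)\<^sup>2 * (2 * k + 8 * s z + (k + 2 * s z)\<^sup>2) * exp (k + s z / 6))"
      by (simp add: mult_ac)
    also have "\<dots> \<le> (\<eta>\<^sup>2 * b) * (D * exp (s z / 4))"
    proof (intro mult_left_mono)
      have "2 * k + 8 * s z + (k + 2 * s z)\<^sup>2 \<le> (2 * k + 8 + (k + 2)\<^sup>2) * (1 + s z)\<^sup>2"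
      proof -
        have "1 \<le> 1 + s z" using s0[of z] by simp
        then have o: "1 + s z \<le> (1 + s z)\<^sup>2" by (intro self_le_power) auto
        have "k + 2 * s z \<le> (k + 2) * (1 + s z)" using k0 s0[of z] by (simp add: algebra_simps)
        then have "(k + 2 * s z)\<^sup>2 \<le> ((k + 2) * (1 + s z))\<^sup>2" using k0 s0[of z] by (intro power_mono) auto
        moreover have "2 * k + 8 * s z \<le> (2 * k + 8) * (1 + s z)" using k0 s0[of z] by (simp add: algebra_simps)
        moreover have "(2 * k + 8) * (1 + s z) \<le> (2 * k + 8) * (1 + s z)\<^sup>2" using o k0 by (intro mult_left_mono) auto
        ultimately show ?thesis unfolding power_mult_distrib distrib_right[of "2 * k + 8"] by linarith
      qed
      then have "(1 + s z)\<^sup>2 * (2 * k + 8 * s z + (k + 2 * s z)\<^sup>2) * exp (k + s z / 6)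
        \<le> (1 + s z)\<^sup>2 * ((2 * k + 8 + (k + 2)\<^sup>2) * (1 + s z)\<^sup>2) * exp (k + s z / 6)"
        by (intro mult_right_mono mult_left_mono) auto
      also have "\<dots> = (2 * k + 8 + (k + 2)\<^sup>2) * exp k * ((1 + s z) ^ 4 * exp (s z / 6))"
        by (simp add: exp_add power2_eq_square power4_eq_xxxx mult_ac)
      also have "\<dots> \<le> (2 * k + 8 + (k + 2)\<^sup>2) * exp k * (48 ^ 4 * exp (s z / 12) * exp (s z / 6))"
        using power4_le_exp[OF s0[of z]] k0 by (intro mult_left_mono mult_right_mono) auto
      also have "\<dots> = D * exp (s z / 12 + s z / 6)" unfolding exp_add by (simp add: D_def mult_ac)
      also have "s z / 12 + s z / 6 = s z / 4" by simp
      finally show "(1 + s z)\<^sup>2 * (2 * k + 8 * s z + (k + 2 * s z)\<^sup>2) * exp (k + s z / 6) \<le> D * exp (s z / 4)" .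
    qed (use b in auto)
    finally show "\<bar>G z\<bar> \<le> (\<eta>\<^sup>2 * b) * (D * exp (s z / 4))" .
  qed
  have eq: "F z * \<rho> z = G z + F z + (\<Sum>q\<in>Q. u q * (F z * (((z q)\<^sup>2 - 1) / 2)))" for z
  proof -
    have "(\<Sum>q\<in>Q. u q * (F z * (((z q)\<^sup>2 - 1) / 2))) = F z * (\<Sum>q\<in>Q. u q * (((z q)\<^sup>2 - 1) / 2))"
      by (simp add: sum_distrib_left mult_ac)
    then show ?thesis by (simp add: G_def algebra_simps)
  qed
  have gen: "(\<integral>z. G z + F z + (\<Sum>q\<in>Q. u q * K q z) \<partial>?S) = (\<integral>z. G z \<partial>?S) + (\<integral>z. F z \<partial>?S) + (\<Sum>q\<in>Q. u q * (\<integral>z. K q z \<partial>?S))"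
    if "\<And>q. q \<in> Q \<Longrightarrow> integrable ?S (K q)" for K
    using GG intF that by simp
  have "(\<integral>z. F z * \<rho> z \<partial>?S) = (\<integral>z. G z \<partial>?S) + (\<integral>z. F z \<partial>?S) + (\<Sum>q\<in>Q. u q * (\<integral>z. F z * (((z q)\<^sup>2 - 1) / 2) \<partial>?S))"
    unfolding eq by (rule gen) (use lin in blast)
  then show "\<bar>(\<integral>z. F z * (\<Prod>q\<in>Q. variance_ratio (u q) (z q)) \<partial>std_gaussian Q) - (\<integral>z. F z \<partial>std_gaussian Q)
        - (\<Sum>q\<in>Q. u q * (\<integral>z. F z * (((z q)\<^sup>2 - 1) / 2) \<partial>std_gaussian Q))\<bar> \<le> \<eta>\<^sup>2 * b * expansion_const Q"
    using GG by (simp add: \<rho>_def[symmetric] mult.assoc)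
qed

section \<open>From variances of independent components to covariances of independent rows\<close>

abbreviation block_cov :: "('s \<Rightarrow> 's \<Rightarrow> real) \<Rightarrow> 'r \<times> 's \<Rightarrow> 'r \<times> 's \<Rightarrow> real" where
  "block_cov N x y \<equiv> (if fst x = fst y then N (snd x) (snd y) else 0)"

lemma gaussian_law_std_gaussian:
  assumes "finite X"
  shows "gaussian_law X (\<lambda>x y. if x = y then 1 else 0) (std_gaussian X)"
proof -
  have "distr (std_gaussian X) (euclid X) (\<lambda>z. \<lambda>s\<in>X. \<Sum>q\<in>X. (if s = q then 1 else 0) * z q) = distr (std_gaussian X) (std_gaussian X) (\<lambda>z. z)"
    using assms by (intro distr_cong)
      (auto simp: std_gaussian_sets space_PiM PiE_def extensional_def fun_eq_iff if_distrib[of "\<lambda>u. u * _"] cong: if_cong)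
  moreover have "(\<Sum>q\<in>X. (if x = q then 1 else 0) * (if y = q then 1 else 0)) = (if x = y then 1 else (0::real))" if "x \<in> X" for x y
    using assms that by (auto simp: if_distrib[of "\<lambda>u. u * _"] cong: if_cong)
  ultimately show ?thesis
    using gaussian_law_std[OF assms assms, of "\<lambda>s q. if s = q then 1 else 0"] 
    by (simp add: gaussian_law_def distr_id cong: sum.cong)
qed

text \<open>Splitting \<open>N = 1 + E\<close> along the vectors \<open>e\<^sub>s \<plusminus> e\<^sub>t\<close>: a symmetric perturbation \<open>E\<close> only changes
  the variances of independent one-dimensional Gaussian components.\<close>

definition bsign :: "bool \<Rightarrow> real" where "bsign b = (if b then 1 else - 1)"

fun split_vec :: "'s \<times> 's \<times> bool \<Rightarrow> 's \<Rightarrow> real" where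
  "split_vec (s, t, b) j = (if j = s then 1 else 0) + bsign b * (if j = t then 1 else 0)"

text \<open>Summed over both signs, the constant coefficient keeps only the diagonal parts of the
  rank-one matrices of the vectors, which add up to a multiple of the identity. The coefficient that
  carries the sign keeps only the mixed parts, which add up to the symmetric matrix
  \<open>E\<close>.\<close>

lemma sum_split_vec:
  assumes fin: "finite J" and j: "j \<in> J" "j' \<in> J" and sym: "\<And>s t. s \<in> J \<Longrightarrow> t \<in> J \<Longrightarrow> E s t = E t s"
  shows "(\<Sum>(s, t, b)\<in>J \<times> J \<times> UNIV. (c + bsign b * E s t / 4) * split_vec (s, t, b) j * split_vec (s, t, b) j')
    = (if j = j' then 4 * c * real (card J) else 0) + E j j'"
proof -
  define \<delta> where "\<delta> a b = (if a = b then 1 else 0 :: real)" for a b :: 'a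
  have pick: "(\<Sum>t\<in>J. \<delta> a t * f t) = f a" if "a \<in> J" for a f
    using fin that by (simp add: \<delta>_def if_distrib[of "\<lambda>u. u * _"] cong: if_cong)
  have "(\<Sum>(s, t, b)\<in>J \<times> J \<times> UNIV. (c + bsign b * E s t / 4) * split_vec (s, t, b) j * split_vec (s, t, b) j')
    = (\<Sum>s\<in>J. \<Sum>t\<in>J. \<Sum>b\<in>UNIV. (c + bsign b * E s t / 4) * split_vec (s, t, b) j * split_vec (s, t, b) j')"
    by (simp add: sum.cartesian_product[symmetric])
  also have "\<dots> = (\<Sum>s\<in>J. \<Sum>t\<in>J. 2 * c * (\<delta> j s * \<delta> j' s) + 2 * c * (\<delta> j t * \<delta> j' t) + \<delta> j s * \<delta> j' t * (E s t / 2) + \<delta> j' s * \<delta> j t * (E s t / 2))"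
    by (intro sum.cong refl) (simp add: UNIV_bool bsign_def \<delta>_def[symmetric] algebra_simps diff_divide_distrib add_divide_distrib)
  also have "\<dots> = 2 * c * (\<Sum>s\<in>J. \<Sum>t\<in>J. \<delta> j s * \<delta> j' s) + 2 * c * (\<Sum>s\<in>J. \<Sum>t\<in>J. \<delta> j t * \<delta> j' t)
     + (\<Sum>s\<in>J. \<Sum>t\<in>J. \<delta> j s * (\<delta> j' t * (E s t / 2))) + (\<Sum>s\<in>J. \<Sum>t\<in>J. \<delta> j' s * (\<delta> j t * (E s t / 2)))"
    by (simp only: sum.distrib sum_distrib_left mult.assoc)
  also have "(\<Sum>s\<in>J. \<Sum>t\<in>J. \<delta> j s * \<delta> j' s) = real (card J) * \<delta> j' j"
    using j by (simp add: sum_distrib_left[symmetric] pick)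
  also have "(\<Sum>s\<in>J. \<Sum>t\<in>J. \<delta> j t * \<delta> j' t) = real (card J) * \<delta> j' j"
    using j by (simp add: pick)
  also have "(\<Sum>s\<in>J. \<Sum>t\<in>J. \<delta> j s * (\<delta> j' t * (E s t / 2))) = E j j' / 2"
    unfolding sum_distrib_left[symmetric] pick[OF j(1)] pick[OF j(2)] ..
  also have "(\<Sum>s\<in>J. \<Sum>t\<in>J. \<delta> j' s * (\<delta> j t * (E s t / 2))) = E j' j / 2"
    unfolding sum_distrib_left[symmetric] pick[OF j(1)] pick[OF j(2)] ..
  finally show ?thesis using sym[OF j] by (simp add: \<delta>_def)
qed

lemma sum_block:
  assumes "finite R" "i \<in> R"
  shows "(\<Sum>(i', p)\<in>R \<times> P. (f p :: real) * (if i = i' then g p else 0) * (if k = i' then h p else 0))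
    = (if i = k then \<Sum>p\<in>P. f p * g p * h p else 0)"
proof -
  have "(\<Sum>(i', p)\<in>R \<times> P. f p * (if i = i' then g p else 0) * (if k = i' then h p else 0))
    = (\<Sum>i'\<in>R. \<Sum>p\<in>P. f p * (if i = i' then g p else 0) * (if k = i' then h p else 0))"
    by (simp add: sum.cartesian_product)
  also have "\<dots> = (\<Sum>i'\<in>R. if i = i' then (if i = k then \<Sum>p\<in>P. f p * g p * h p else 0) else 0)"
    by (intro sum.cong) auto
  also have "\<dots> = (if i = k then \<Sum>p\<in>P. f p * g p * h p else 0)" using assms by simp
  finally show ?thesis .
qed

text \<open>\<open>\<Gamma>\<close> is the image of independent normal variables under a fixed
  linear map; only their variances depend on \<open>N\<close>. Hence the coefficients
  \<open>d\<close> come from \<open>H\<close> and precede \<open>N\<close> in the quantifiers, which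
  later allows averaging over a random \<open>N\<close>. The smallness condition keeps the variances
  within 1/2 of 1.\<close>

lemma gaussian_expansion_small:
  fixes R :: "'r set" and J :: "'s set"
  assumes fin: "finite R" "finite J"
  defines "X \<equiv> R \<times> J" and "Q \<equiv> R \<times> (J \<times> J \<times> (UNIV :: bool set))" and "n \<equiv> real (card J)"
  shows "\<exists>b\<ge>0. \<forall>H\<in>borel_measurable (euclid X). (\<forall>z\<in>space (euclid X). \<bar>H z\<bar> \<le> 1 + (\<Sum>x\<in>X. z x ^ 4)) \<longrightarrow>
    (\<exists>d. (\<forall>s\<in>J. \<forall>t\<in>J. \<bar>d s t\<bar> \<le> b) \<and>
      (\<forall>N \<Gamma>. gaussian_law X (block_cov N) \<Gamma> \<longrightarrow> (\<forall>s\<in>J. \<forall>t\<in>J. N s t = N t s) \<longrightarrow>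
        n * sqrt (\<Sum>s\<in>J. \<Sum>t\<in>J. (N s t - (if s = t then 1 else 0))\<^sup>2) \<le> 1 / 2 \<longrightarrow>
        \<bar>(\<integral>z. H z \<partial>\<Gamma>) - (\<integral>z. H z \<partial>std_gaussian X) - (\<Sum>s\<in>J. \<Sum>t\<in>J. d s t * (N s t - (if s = t then 1 else 0)))\<bar>
          \<le> b * (\<Sum>s\<in>J. \<Sum>t\<in>J. (N s t - (if s = t then 1 else 0))\<^sup>2)))"
proof -
  \<comment> \<open>The normalisation \<open>1 / (4 * n)\<close> is the \<open>c\<close> of
    \<open>sum_split_vec\<close> with \<open>4 * c * card J = 1\<close>, so that unit variances give
    the identity covariance.\<close>
  define M where "M x q = (if fst x = fst q then sqrt (1 / (4 * n)) * split_vec (snd q) (snd x) else 0)" 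
    for x :: "'r \<times> 's" and q :: "'r \<times> 's \<times> 's \<times> bool"
  define A where "A z = (\<lambda>x\<in>X. \<Sum>q\<in>Q. M x q * z q)" for z
  \<comment> \<open>By Cauchy-Schwarz, \<open>w\<close> bounds the squared norm of the linear map;
    \<open>b\<close> is then the growth constant of \<open>H\<close> composed with it.\<close>
  define w where "w = (\<Sum>x\<in>X. \<Sum>q\<in>Q. (M x q)\<^sup>2)"
  define b where "b = 1 + real (card X) * w\<^sup>2"
  define B where "B = b * expansion_const Q"
  have finX: "finite X" and finQ: "finite Q" using fin by (auto simp: X_def Q_def)
  have b0: "0 \<le> b" by (simp add: b_def)
  have B0: "0 \<le> B" using b0 expansion_const_nonneg[of Q] by (simp add: B_def)
  have n0: "0 \<le> n" by (simp add: n_def)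
  have Ameas [measurable]: "A \<in> measurable (std_gaussian Q) (euclid X)"
    unfolding A_def by (rule measurable_linear_map) simp
  show ?thesis
  proof (intro exI[of _ "real (card R) * 2 * n * B + n\<^sup>2 * B"] conjI ballI impI)
    show "0 \<le> real (card R) * 2 * n * B + n\<^sup>2 * B" using n0 B0 by simp
    fix H assume H [measurable]: "H \<in> borel_measurable (euclid X)" 
      and Hb: "\<forall>z\<in>space (euclid X). \<bar>H z\<bar> \<le> 1 + (\<Sum>x\<in>X. z x ^ 4)"
    define F where "F z = H (A z)" for z
    have Fm: "F \<in> borel_measurable (std_gaussian Q)" unfolding F_def by measurable
    have Fb: "\<bar>F z\<bar> \<le> b * (1 + (\<Sum>q\<in>Q. (z q)\<^sup>2))\<^sup>2" if z: "z \<in> space (std_gaussian Q)" for z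
    proof -
      define s where "s = (\<Sum>q\<in>Q. (z q)\<^sup>2)"
      have s0: "0 \<le> s" by (simp add: s_def sum_nonneg)
      have w0: "0 \<le> w" by (simp add: w_def sum_nonneg)
      have "A z \<in> space (euclid X)" using measurable_space[OF Ameas z] .
      with Hb have "\<bar>F z\<bar> \<le> 1 + (\<Sum>x\<in>X. A z x ^ 4)" by (simp add: F_def)
      also have "(\<Sum>x\<in>X. A z x ^ 4) \<le> (\<Sum>x\<in>X. (w * s)\<^sup>2)"
      proof (rule sum_mono)
        fix x assume x: "x \<in> X"
        have "(A z x)\<^sup>2 \<le> (\<Sum>q\<in>Q. (M x q)\<^sup>2) * s"
          using x Cauchy_Schwarz_ineq_sum[of "M x" z Q] by (simp add: A_def s_def)
        also have "\<dots> \<le> w * s" unfolding w_def using finX x s0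
          by (intro mult_right_mono member_le_sum) (auto intro: sum_nonneg)
        finally have "((A z x)\<^sup>2)\<^sup>2 \<le> (w * s)\<^sup>2" by (intro power_mono) auto
        then show "A z x ^ 4 \<le> (w * s)\<^sup>2" by simp
      qed
      also have "1 + (\<Sum>x\<in>X. (w * s)\<^sup>2) = 1 + real (card X) * w\<^sup>2 * s\<^sup>2" by (simp add: power_mult_distrib)
      also have "\<dots> \<le> (1 + s)\<^sup>2 + real (card X) * w\<^sup>2 * (1 + s)\<^sup>2"
        using s0 by (intro add_mono mult_left_mono power_mono) auto
      also have "\<dots> = b * (1 + s)\<^sup>2" by (simp add: b_def distrib_right)
      finally show ?thesis by (simp add: s_def)
    qed
    note VE = variance_ratio_expansion[OF finQ Fm Fb b0]
    define c where "c q = (\<integral>z. F z * (((z q)\<^sup>2 - 1) / 2) \<partial>std_gaussian Q)" for q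
    define d where "d s t = (\<Sum>i\<in>R. \<Sum>\<beta>\<in>UNIV. bsign \<beta> * n * c (i, s, t, \<beta>))" for s t
    have cB: "\<bar>c q\<bar> \<le> B" if "q \<in> Q" for q using VE(2)[OF _ that] by (simp add: c_def B_def)
    have key: "\<bar>(\<integral>z. H z \<partial>\<Gamma>) - (\<integral>z. F z \<partial>std_gaussian Q) - (\<Sum>s\<in>J. \<Sum>t\<in>J. d s t * E s t)\<bar> \<le> n\<^sup>2 * B * (\<Sum>s\<in>J. \<Sum>t\<in>J. (E s t)\<^sup>2)"
      if law: "gaussian_law X (block_cov N) \<Gamma>" and sym: "\<forall>s\<in>J. \<forall>t\<in>J. N s t = N t s"
        and E: "E = (\<lambda>s t. N s t - (if s = t then 1 else 0))" and small: "n * sqrt (\<Sum>s\<in>J. \<Sum>t\<in>J. (E s t)\<^sup>2) \<le> 1 / 2"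
      for N \<Gamma> E
    proof -
      define \<eta> where "\<eta> = n * sqrt (\<Sum>s\<in>J. \<Sum>t\<in>J. (E s t)\<^sup>2)"
      \<comment> \<open>Chosen so that \<open>(1 + u q) / (4 * n)\<close> is
        \<open>1 / (4 * n)\<close> plus or minus a quarter of \<open>E s t\<close>, as the splitting
        demands.\<close>
      define u where "u q = (case q of (i, s, t, \<beta>) \<Rightarrow> bsign \<beta> * n * E s t)" for q :: "'r \<times> 's \<times> 's \<times> bool"
      have S0: "0 \<le> (\<Sum>s\<in>J. \<Sum>t\<in>J. (E s t)\<^sup>2)" by (intro sum_nonneg) auto
      have \<eta>0: "0 \<le> \<eta>" using S0 n0 by (simp add: \<eta>_def)
      have \<eta>2: "\<eta>\<^sup>2 = n\<^sup>2 * (\<Sum>s\<in>J. \<Sum>t\<in>J. (E s t)\<^sup>2)" using S0 by (simp add: \<eta>_def power_mult_distrib)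
      have u\<eta>: "\<bar>u q\<bar> \<le> \<eta>" if qQ: "q \<in> Q" for q
      proof -
        obtain i s t \<beta> where q: "q = (i, s, t, \<beta>)" "s \<in> J" "t \<in> J" using qQ by (auto simp: Q_def)
        have "(E s t)\<^sup>2 \<le> (\<Sum>t\<in>J. (E s t)\<^sup>2)" using fin q by (intro member_le_sum) auto
        also have "\<dots> \<le> (\<Sum>s\<in>J. \<Sum>t\<in>J. (E s t)\<^sup>2)" 
          using fin q by (intro member_le_sum[of s J "\<lambda>s. \<Sum>t\<in>J. (E s t)\<^sup>2"]) (auto intro: sum_nonneg)
        finally have "\<bar>E s t\<bar> \<le> sqrt (\<Sum>s\<in>J. \<Sum>t\<in>J. (E s t)\<^sup>2)" by (rule real_le_rsqrt[of "\<bar>E s t\<bar>", simplified])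
        then have "n * \<bar>E s t\<bar> \<le> \<eta>" unfolding \<eta>_def using n0 by (intro mult_left_mono)
        then show ?thesis using n0 by (simp add: u_def q bsign_def abs_mult)
      qed
      have um: "-1 < u q" if "q \<in> Q" for q using u\<eta>[OF that] small unfolding \<eta>_def[symmetric] by linarith
      have law2: "gaussian_law X (\<lambda>s t. \<Sum>q\<in>Q. (sqrt (1 + u q))\<^sup>2 * M s q * M t q)
          (distr (\<Pi>\<^sub>M q\<in>Q. density lborel (normal_density 0 (sqrt (1 + u q)))) (euclid X) A)"
        unfolding A_def using um by (intro gaussian_law_linear_image finX finQ) force
      have "\<Gamma> = distr (\<Pi>\<^sub>M q\<in>Q. density lborel (normal_density 0 (sqrt (1 + u q)))) (euclid X) A"
      proof (rule gaussian_law_unique[OF finX law law2])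
        fix x y assume "x \<in> X" "y \<in> X"
        then obtain i j k l where x: "x = (i, j)" "y = (k, l)" "i \<in> R" "j \<in> J" "k \<in> R" "l \<in> J" by (auto simp: X_def)
        have np: "0 < n" using x fin by (auto simp: n_def card_gt_0_iff)
        have "(\<Sum>q\<in>Q. (sqrt (1 + u q))\<^sup>2 * M x q * M y q) 
          = (\<Sum>(i', p)\<in>Q. (1 + u (i, p)) * (if i = i' then sqrt (1 / (4 * n)) * split_vec p j else 0) * (if k = i' then sqrt (1 / (4 * n)) * split_vec p l else 0))"
        proof (intro sum.cong refl, clarify)
          fix i' s t \<beta> assume q: "(i', s, t, \<beta>) \<in> Q"
          have "(sqrt (1 + u (i', s, t, \<beta>)))\<^sup>2 = 1 + u (i, s, t, \<beta>)" using um[OF q] by (simp add: u_def)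
          then show "(sqrt (1 + u (i', s, t, \<beta>)))\<^sup>2 * M x (i', s, t, \<beta>) * M y (i', s, t, \<beta>)
            = (1 + u (i, s, t, \<beta>)) * (if i = i' then sqrt (1 / (4 * n)) * split_vec (s, t, \<beta>) j else 0) * (if k = i' then sqrt (1 / (4 * n)) * split_vec (s, t, \<beta>) l else 0)"
            by (simp add: M_def x del: split_vec.simps)
        qed
        also have "\<dots> = (if i = k then \<Sum>p\<in>J \<times> J \<times> UNIV. (1 + u (i, p)) * (sqrt (1 / (4 * n)) * split_vec p j) * (sqrt (1 / (4 * n)) * split_vec p l) else 0)"
          unfolding Q_def using fin x by (intro sum_block) auto
        also have "(\<Sum>p\<in>J \<times> J \<times> UNIV. (1 + u (i, p)) * (sqrt (1 / (4 * n)) * split_vec p j) * (sqrt (1 / (4 * n)) * split_vec p l))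
          = (\<Sum>(s, t, \<beta>)\<in>J \<times> J \<times> UNIV. (1 / (4 * n) + bsign \<beta> * E s t / 4) * split_vec (s, t, \<beta>) j * split_vec (s, t, \<beta>) l)"
        proof (intro sum.cong refl, clarify)
          fix s t \<beta>
          have r: "sqrt (1 / (4 * n)) * sqrt (1 / (4 * n)) = 1 / (4 * n)" using np by simp
          have "(1 + u (i, s, t, \<beta>)) * (sqrt (1 / (4 * n)) * split_vec (s, t, \<beta>) j) * (sqrt (1 / (4 * n)) * split_vec (s, t, \<beta>) l)
            = (1 + u (i, s, t, \<beta>)) * (sqrt (1 / (4 * n)) * sqrt (1 / (4 * n))) * split_vec (s, t, \<beta>) j * split_vec (s, t, \<beta>) l"
            by (simp only: mult_ac)
          also have "(1 + u (i, s, t, \<beta>)) * (sqrt (1 / (4 * n)) * sqrt (1 / (4 * n))) = 1 / (4 * n) + bsign \<beta> * E s t / 4"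
            unfolding r using np by (simp add: u_def field_simps)
          finally show "(1 + u (i, s, t, \<beta>)) * (sqrt (1 / (4 * n)) * split_vec (s, t, \<beta>) j) * (sqrt (1 / (4 * n)) * split_vec (s, t, \<beta>) l)
            = (1 / (4 * n) + bsign \<beta> * E s t / 4) * split_vec (s, t, \<beta>) j * split_vec (s, t, \<beta>) l" .
        qed
        also have "\<dots> = (if j = l then 4 * (1 / (4 * n)) * real (card J) else 0) + E j l"
          using sym by (intro sum_split_vec fin x) (auto simp: E)
        also have "\<dots> = N j l" using np by (simp add: E n_def)
        finally show "block_cov N x y = (\<Sum>q\<in>Q. (sqrt (1 + u q))\<^sup>2 * M x q * M y q)" by (simp add: x)
      qed
      also have "\<dots> = distr (density (std_gaussian Q) (\<lambda>z. ennreal (\<Prod>q\<in>Q. variance_ratio (u q) (z q)))) (euclid X) A"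
        by (subst PiM_normal_eq_density[OF finQ um]) auto
      finally have "(\<integral>z. H z \<partial>\<Gamma>) = (\<integral>z. F z \<partial>density (std_gaussian Q) (\<lambda>z. ennreal (\<Prod>q\<in>Q. variance_ratio (u q) (z q))))"
        unfolding F_def by (simp add: integral_distr)
      also have "\<dots> = (\<integral>z. (\<Prod>q\<in>Q. variance_ratio (u q) (z q)) *\<^sub>R F z \<partial>std_gaussian Q)"
      proof (rule integral_density[OF Fm])
        show "(\<lambda>z. \<Prod>q\<in>Q. variance_ratio (u q) (z q)) \<in> borel_measurable (std_gaussian Q)" by measurable
      qed (use um in \<open>auto intro!: prod_nonneg variance_ratio_nonneg\<close>)
      finally have 1: "(\<integral>z. H z \<partial>\<Gamma>) = (\<integral>z. F z * (\<Prod>q\<in>Q. variance_ratio (u q) (z q)) \<partial>std_gaussian Q)"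
        by (simp add: mult.commute)
      have "(\<Sum>q\<in>Q. u q * c q) = (\<Sum>i\<in>R. \<Sum>s\<in>J. \<Sum>t\<in>J. \<Sum>\<beta>\<in>UNIV. bsign \<beta> * n * c (i, s, t, \<beta>) * E s t)"
        unfolding Q_def u_def by (simp add: sum.cartesian_product' mult_ac)
      also have "\<dots> = (\<Sum>s\<in>J. \<Sum>i\<in>R. \<Sum>t\<in>J. \<Sum>\<beta>\<in>UNIV. bsign \<beta> * n * c (i, s, t, \<beta>) * E s t)" by (rule sum.swap)
      also have "\<dots> = (\<Sum>s\<in>J. \<Sum>t\<in>J. d s t * E s t)"
        unfolding d_def by (intro sum.cong refl, subst sum.swap) (simp add: sum_distrib_right)
      finally have 2: "(\<Sum>q\<in>Q. u q * c q) = (\<Sum>s\<in>J. \<Sum>t\<in>J. d s t * E s t)" .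
      have "\<bar>(\<integral>z. F z * (\<Prod>q\<in>Q. variance_ratio (u q) (z q)) \<partial>std_gaussian Q) - (\<integral>z. F z \<partial>std_gaussian Q) - (\<Sum>q\<in>Q. u q * c q)\<bar>
        \<le> \<eta>\<^sup>2 * b * expansion_const Q"
        unfolding c_def using u\<eta> \<eta>0 small unfolding \<eta>_def[symmetric] by (intro VE(3)) auto
      then show ?thesis unfolding 1 2 \<eta>2 B_def by (simp add: mult_ac)
    qed
    \<comment> \<open>The covariance 1 is the case \<open>E = 0\<close> of \<open>key\<close>, where
      the error bound is 0.\<close>
    have F0: "(\<integral>z. H z \<partial>std_gaussian X) = (\<integral>z. F z \<partial>std_gaussian Q)"
    proof -
      define I where "I s t = (if s = t then 1 else 0 :: real)" for s t :: 's
      have "gaussian_law X (block_cov I) (std_gaussian X)"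
      proof -
        have "block_cov I = (\<lambda>x y :: 'r \<times> 's. if x = y then 1 else 0)" by (auto simp: I_def fun_eq_iff prod_eq_iff)
        then show ?thesis using gaussian_law_std_gaussian[OF finX] by simp
      qed
      from key[OF this, of "\<lambda>s t. I s t - (if s = t then 1 else 0)"] show ?thesis by (simp add: I_def)
    qed
    show "\<exists>d. (\<forall>s\<in>J. \<forall>t\<in>J. \<bar>d s t\<bar> \<le> real (card R) * 2 * n * B + n\<^sup>2 * B) \<and>
      (\<forall>N \<Gamma>. gaussian_law X (block_cov N) \<Gamma> \<longrightarrow> (\<forall>s\<in>J. \<forall>t\<in>J. N s t = N t s) \<longrightarrow>
        n * sqrt (\<Sum>s\<in>J. \<Sum>t\<in>J. (N s t - (if s = t then 1 else 0))\<^sup>2) \<le> 1 / 2 \<longrightarrow>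
        \<bar>(\<integral>z. H z \<partial>\<Gamma>) - (\<integral>z. H z \<partial>std_gaussian X) - (\<Sum>s\<in>J. \<Sum>t\<in>J. d s t * (N s t - (if s = t then 1 else 0)))\<bar>
          \<le> (real (card R) * 2 * n * B + n\<^sup>2 * B) * (\<Sum>s\<in>J. \<Sum>t\<in>J. (N s t - (if s = t then 1 else 0))\<^sup>2))"
    proof (intro exI[of _ d] conjI ballI allI impI)
      fix s t assume st: "s \<in> J" "t \<in> J"
      have "\<bar>d s t\<bar> \<le> (\<Sum>i\<in>R. \<bar>\<Sum>\<beta>\<in>UNIV. bsign \<beta> * n * c (i, s, t, \<beta>)\<bar>)" unfolding d_def by (rule sum_abs)
      also have "\<dots> \<le> (\<Sum>i\<in>R. \<Sum>\<beta>\<in>(UNIV :: bool set). n * B)"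
      proof (intro sum_mono order_trans[OF sum_abs])
        fix i \<beta> assume "i \<in> R"
        then have "\<bar>c (i, s, t, \<beta>)\<bar> \<le> B" using st by (intro cB) (auto simp: Q_def)
        then show "\<bar>bsign \<beta> * n * c (i, s, t, \<beta>)\<bar> \<le> n * B" using n0 by (auto simp: bsign_def abs_mult intro: mult_left_mono)
      qed
      also have "\<dots> = real (card R) * 2 * n * B" by (simp add: UNIV_bool)
      also have "\<dots> \<le> real (card R) * 2 * n * B + n\<^sup>2 * B" using B0 by simp
      finally show "\<bar>d s t\<bar> \<le> real (card R) * 2 * n * B + n\<^sup>2 * B" .
    next
      fix N \<Gamma> assume *: "gaussian_law X (block_cov N) \<Gamma>" "\<forall>s\<in>J. \<forall>t\<in>J. N s t = N t s"
        "n * sqrt (\<Sum>s\<in>J. \<Sum>t\<in>J. (N s t - (if s = t then 1 else 0))\<^sup>2) \<le> 1 / 2"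
      have S0: "0 \<le> (\<Sum>s\<in>J. \<Sum>t\<in>J. (N s t - (if s = t then 1 else 0))\<^sup>2)" by (intro sum_nonneg) auto
      have "\<bar>(\<integral>z. H z \<partial>\<Gamma>) - (\<integral>z. H z \<partial>std_gaussian X) - (\<Sum>s\<in>J. \<Sum>t\<in>J. d s t * (N s t - (if s = t then 1 else 0)))\<bar>
          \<le> n\<^sup>2 * B * (\<Sum>s\<in>J. \<Sum>t\<in>J. (N s t - (if s = t then 1 else 0))\<^sup>2)"
        unfolding F0 by (rule key[OF *(1,2) refl *(3)])
      also have "\<dots> \<le> (real (card R) * 2 * n * B + n\<^sup>2 * B) * (\<Sum>s\<in>J. \<Sum>t\<in>J. (N s t - (if s = t then 1 else 0))\<^sup>2)"
        using S0 n0 B0 by (intro mult_right_mono) auto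
      finally show "\<bar>(\<integral>z. H z \<partial>\<Gamma>) - (\<integral>z. H z \<partial>std_gaussian X) - (\<Sum>s\<in>J. \<Sum>t\<in>J. d s t * (N s t - (if s = t then 1 else 0)))\<bar>
          \<le> (real (card R) * 2 * n * B + n\<^sup>2 * B) * (\<Sum>s\<in>J. \<Sum>t\<in>J. (N s t - (if s = t then 1 else 0))\<^sup>2)" .
    qed
  qed
qed

text \<open>The smallness condition is removed at the price of the constant. Where it fails,
  \<open>1 \<le> 4 * n\<^sup>2 * S\<close>. Each of the three terms is at most a constant plus a
  multiple of \<open>S\<close>, the two integrals by fourth moments and the linear term because
  \<bar>x\<bar> is at most \<open>1 + x\<^sup>2\<close>; so their sum is at most a multiple of
  \<open>S\<close>.\<close>

theorem gaussian_expansion: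
  fixes R :: "'r set" and J :: "'s set"
  assumes fin: "finite R" "finite J"
  shows "\<exists>C\<ge>0. \<forall>H\<in>borel_measurable (euclid (R \<times> J)). (\<forall>z\<in>space (euclid (R \<times> J)). \<bar>H z\<bar> \<le> 1 + (\<Sum>x\<in>R \<times> J. z x ^ 4)) \<longrightarrow>
    (\<exists>d. (\<forall>s\<in>J. \<forall>t\<in>J. \<bar>d s t\<bar> \<le> C) \<and>
      (\<forall>N \<Gamma>. gaussian_law (R \<times> J) (block_cov N) \<Gamma> \<longrightarrow> (\<forall>s\<in>J. \<forall>t\<in>J. N s t = N t s) \<longrightarrow>
        \<bar>(\<integral>z. H z \<partial>\<Gamma>) - (\<integral>z. H z \<partial>std_gaussian (R \<times> J)) - (\<Sum>s\<in>J. \<Sum>t\<in>J. d s t * (N s t - (if s = t then 1 else 0)))\<bar>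
          \<le> C * (\<Sum>s\<in>J. \<Sum>t\<in>J. (N s t - (if s = t then 1 else 0))\<^sup>2)))"
proof -
  define X where "X = R \<times> J"
  define n where "n = real (card J)"
  define r where "r = real (card R)"
  have finX: "finite X" using fin by (simp add: X_def)
  have n0: "0 \<le> n" and r0: "0 \<le> r" by (auto simp: n_def r_def)
  obtain b where b0: "0 \<le> b" and b: "\<forall>H\<in>borel_measurable (euclid X). (\<forall>z\<in>space (euclid X). \<bar>H z\<bar> \<le> 1 + (\<Sum>x\<in>X. z x ^ 4)) \<longrightarrow>
    (\<exists>d. (\<forall>s\<in>J. \<forall>t\<in>J. \<bar>d s t\<bar> \<le> b) \<and>
      (\<forall>N \<Gamma>. gaussian_law X (block_cov N) \<Gamma> \<longrightarrow> (\<forall>s\<in>J. \<forall>t\<in>J. N s t = N t s) \<longrightarrow>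
        n * sqrt (\<Sum>s\<in>J. \<Sum>t\<in>J. (N s t - (if s = t then 1 else 0))\<^sup>2) \<le> 1 / 2 \<longrightarrow>
        \<bar>(\<integral>z. H z \<partial>\<Gamma>) - (\<integral>z. H z \<partial>std_gaussian X) - (\<Sum>s\<in>J. \<Sum>t\<in>J. d s t * (N s t - (if s = t then 1 else 0)))\<bar>
          \<le> b * (\<Sum>s\<in>J. \<Sum>t\<in>J. (N s t - (if s = t then 1 else 0))\<^sup>2)))"
    using gaussian_expansion_small[OF fin] unfolding X_def[symmetric] n_def[symmetric] by (elim exE conjE) (rule that)
  \<comment> \<open>Collects what is constant in \<open>S\<close> in the crude bounds for a large
    perturbation; there the factor 1 is replaced by \<open>4 * n\<^sup>2 * S\<close>.\<close>
  define a where "a = (1 + 6 * r * n) + (1 + 3 * r * n) + b * n\<^sup>2"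
  define C where "C = b + (a * (4 * n\<^sup>2) + 6 * r + b)"
  have a0: "0 \<le> a" using n0 r0 b0 by (simp add: a_def)
  have Cb: "b \<le> C" using a0 r0 b0 n0 by (simp add: C_def)
  have mom: "\<bar>\<integral>z. H z \<partial>\<Gamma>\<bar> \<le> 1 + (\<Sum>x\<in>X. 3 * (K x x)\<^sup>2)"
    if H: "H \<in> borel_measurable (euclid X)" "\<forall>z\<in>space (euclid X). \<bar>H z\<bar> \<le> 1 + (\<Sum>x\<in>X. z x ^ 4)"
      and law: "gaussian_law X K \<Gamma>" for H \<Gamma> K
  proof -
    interpret prob_space \<Gamma> using law by (simp add: gaussian_law_def)
    have s: "sets \<Gamma> = sets (euclid X)" using law by (simp add: gaussian_law_def)
    note m4 = gaussian_law_fourth_moment[OF finX law]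
    have i: "integrable \<Gamma> (\<lambda>z. 1 + (\<Sum>x\<in>X. z x ^ 4))" using m4(1) by simp
    have "\<bar>\<integral>z. H z \<partial>\<Gamma>\<bar> \<le> (\<integral>z. 1 + (\<Sum>x\<in>X. z x ^ 4) \<partial>\<Gamma>)"
      using H s sets_eq_imp_space_eq[OF s] by (intro abs_integral_le(2)[OF i]) (auto cong: measurable_cong_sets)
    also have "\<dots> = 1 + (\<Sum>x\<in>X. 3 * (K x x)\<^sup>2)" using m4 by (simp add: prob_space)
    finally show ?thesis .
  qed
  show ?thesis unfolding X_def[symmetric]
  proof (intro exI[of _ C] conjI ballI impI)
    show "0 \<le> C" using Cb b0 by simp
    fix H assume H: "H \<in> borel_measurable (euclid X)" "\<forall>z\<in>space (euclid X). \<bar>H z\<bar> \<le> 1 + (\<Sum>x\<in>X. z x ^ 4)"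
    obtain d where d: "\<And>s t. s \<in> J \<Longrightarrow> t \<in> J \<Longrightarrow> \<bar>d s t\<bar> \<le> b"
      and small: "\<And>N \<Gamma>. gaussian_law X (block_cov N) \<Gamma> \<Longrightarrow> (\<forall>s\<in>J. \<forall>t\<in>J. N s t = N t s) \<Longrightarrow>
        n * sqrt (\<Sum>s\<in>J. \<Sum>t\<in>J. (N s t - (if s = t then 1 else 0))\<^sup>2) \<le> 1 / 2 \<Longrightarrow>
        \<bar>(\<integral>z. H z \<partial>\<Gamma>) - (\<integral>z. H z \<partial>std_gaussian X) - (\<Sum>s\<in>J. \<Sum>t\<in>J. d s t * (N s t - (if s = t then 1 else 0)))\<bar>
          \<le> b * (\<Sum>s\<in>J. \<Sum>t\<in>J. (N s t - (if s = t then 1 else 0))\<^sup>2)"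
      using b[THEN bspec, OF H(1), THEN mp, OF H(2)] by blast
    have std: "\<bar>\<integral>z. H z \<partial>std_gaussian X\<bar> \<le> 1 + 3 * r * n"
      using mom[OF H gaussian_law_std_gaussian[OF finX]] by (simp add: X_def card_cartesian_product r_def n_def)
    show "\<exists>d. (\<forall>s\<in>J. \<forall>t\<in>J. \<bar>d s t\<bar> \<le> C) \<and>
      (\<forall>N \<Gamma>. gaussian_law X (block_cov N) \<Gamma> \<longrightarrow> (\<forall>s\<in>J. \<forall>t\<in>J. N s t = N t s) \<longrightarrow>
        \<bar>(\<integral>z. H z \<partial>\<Gamma>) - (\<integral>z. H z \<partial>std_gaussian X) - (\<Sum>s\<in>J. \<Sum>t\<in>J. d s t * (N s t - (if s = t then 1 else 0)))\<bar>
          \<le> C * (\<Sum>s\<in>J. \<Sum>t\<in>J. (N s t - (if s = t then 1 else 0))\<^sup>2))"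
    proof (intro exI[of _ d] conjI ballI allI impI)
      show "\<bar>d s t\<bar> \<le> C" if "s \<in> J" "t \<in> J" for s t using d[OF that] Cb by simp
      fix N \<Gamma> assume law: "gaussian_law X (block_cov N) \<Gamma>" and sym: "\<forall>s\<in>J. \<forall>t\<in>J. N s t = N t s"
      define E where "E s t = N s t - (if s = t then 1 else 0)" for s t
      define S where "S = (\<Sum>s\<in>J. \<Sum>t\<in>J. (E s t)\<^sup>2)"
      have S0: "0 \<le> S" by (auto simp: S_def intro!: sum_nonneg)
      have "\<bar>(\<integral>z. H z \<partial>\<Gamma>) - (\<integral>z. H z \<partial>std_gaussian X) - (\<Sum>s\<in>J. \<Sum>t\<in>J. d s t * E s t)\<bar> \<le> C * S"
      proof (cases "n * sqrt S \<le> 1 / 2")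
        case True
        then have "\<bar>(\<integral>z. H z \<partial>\<Gamma>) - (\<integral>z. H z \<partial>std_gaussian X) - (\<Sum>s\<in>J. \<Sum>t\<in>J. d s t * E s t)\<bar> \<le> b * S"
          using small[OF law sym] unfolding E_def S_def by simp
        also have "\<dots> \<le> C * S" using Cb S0 by (intro mult_right_mono)
        finally show ?thesis .
      next
        case False
        then have "(1 / 2)\<^sup>2 \<le> (n * sqrt S)\<^sup>2" by (intro power_mono) auto
        moreover have "(n * sqrt S)\<^sup>2 = n\<^sup>2 * S" using S0 by (simp add: power_mult_distrib)
        ultimately have big: "1 \<le> 4 * n\<^sup>2 * S" by (simp add: power_divide)
        have "\<bar>\<integral>z. H z \<partial>\<Gamma>\<bar> \<le> 1 + (\<Sum>x\<in>X. 3 * (block_cov N x x)\<^sup>2)" by (rule mom[OF H law])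
        also have "(\<Sum>x\<in>X. 3 * (block_cov N x x)\<^sup>2) = 3 * r * (\<Sum>s\<in>J. (N s s)\<^sup>2)"
          by (simp add: X_def sum.cartesian_product' r_def sum_distrib_left mult_ac)
        also have "(\<Sum>s\<in>J. (N s s)\<^sup>2) \<le> (\<Sum>s\<in>J. 2 + 2 * (\<Sum>t\<in>J. (E s t)\<^sup>2))"
        proof (rule sum_mono)
          fix s assume s: "s \<in> J"
          \<comment> \<open>This square is exactly the difference of the two sides of the next
            inequality.\<close>
          have "0 \<le> (N s s - 2)\<^sup>2" by simp
          then have "(N s s)\<^sup>2 \<le> 2 + 2 * (E s s)\<^sup>2" by (simp add: E_def power2_eq_square algebra_simps)
          also have "(E s s)\<^sup>2 \<le> (\<Sum>t\<in>J. (E s t)\<^sup>2)" using fin s by (intro member_le_sum) auto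
          finally show "(N s s)\<^sup>2 \<le> 2 + 2 * (\<Sum>t\<in>J. (E s t)\<^sup>2)" by simp
        qed
        also have "\<dots> = 2 * n + 2 * S" by (simp add: n_def S_def sum.distrib sum_distrib_left)
        finally have 1: "\<bar>\<integral>z. H z \<partial>\<Gamma>\<bar> \<le> 1 + 3 * r * (2 * n + 2 * S)"
          using r0 by (simp add: mult_left_mono)
        have "\<bar>\<Sum>s\<in>J. \<Sum>t\<in>J. d s t * E s t\<bar> \<le> (\<Sum>s\<in>J. \<Sum>t\<in>J. b * (1 + (E s t)\<^sup>2))"
        proof (intro order_trans[OF sum_abs] sum_mono)
          fix s t assume st: "s \<in> J" "t \<in> J"
          have "0 \<le> (\<bar>E s t\<bar> - 1)\<^sup>2 + \<bar>E s t\<bar>\<^sup>2" by simp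
          then have "2 * \<bar>E s t\<bar> \<le> 1 + 2 * \<bar>E s t\<bar>\<^sup>2" by (simp add: power2_eq_square algebra_simps)
          then have "\<bar>E s t\<bar> \<le> 1 + (E s t)\<^sup>2" by simp
          then show "\<bar>d s t * E s t\<bar> \<le> b * (1 + (E s t)\<^sup>2)"
            unfolding abs_mult using d[OF st] b0 by (intro mult_mono) auto
        qed
        also have "\<dots> = b * (n\<^sup>2 + S)"
          by (simp add: n_def S_def sum.distrib power2_eq_square flip: sum_distrib_left)
        finally have 2: "\<bar>\<Sum>s\<in>J. \<Sum>t\<in>J. d s t * E s t\<bar> \<le> b * (n\<^sup>2 + S)" .
        have "\<bar>(\<integral>z. H z \<partial>\<Gamma>) - (\<integral>z. H z \<partial>std_gaussian X) - (\<Sum>s\<in>J. \<Sum>t\<in>J. d s t * E s t)\<bar>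
          \<le> (1 + 3 * r * (2 * n + 2 * S)) + (1 + 3 * r * n) + b * (n\<^sup>2 + S)"
          using 1 2 std by linarith
        also have "\<dots> = a * 1 + (6 * r + b) * S" by (simp add: a_def algebra_simps)
        also have "\<dots> \<le> a * (4 * n\<^sup>2 * S) + (6 * r + b) * S"
          using mult_left_mono[OF big a0] by simp
        also have "\<dots> = (C - b) * S" by (simp add: C_def algebra_simps)
        also have "\<dots> \<le> C * S" using b0 S0 by (intro mult_right_mono) auto
        finally show ?thesis .
      qed
      then show "\<bar>(\<integral>z. H z \<partial>\<Gamma>) - (\<integral>z. H z \<partial>std_gaussian X) - (\<Sum>s\<in>J. \<Sum>t\<in>J. d s t * (N s t - (if s = t then 1 else 0)))\<bar>
          \<le> C * (\<Sum>s\<in>J. \<Sum>t\<in>J. (N s t - (if s = t then 1 else 0))\<^sup>2)"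
        unfolding E_def S_def .
    qed
  qed
qed

section \<open>Factorization of positive semidefinite matrices\<close>

lemma quadratic_form_gram:
  fixes x :: "'i \<Rightarrow> real"
  shows "(\<Sum>s\<in>I. \<Sum>t\<in>I. x s * x t * (\<Sum>q\<in>Q. M s q * M t q)) = (\<Sum>q\<in>Q. (\<Sum>s\<in>I. x s * M s q)\<^sup>2)"
proof -
  have "(\<Sum>s\<in>I. \<Sum>t\<in>I. x s * x t * (\<Sum>q\<in>Q. M s q * M t q)) = (\<Sum>s\<in>I. \<Sum>q\<in>Q. \<Sum>t\<in>I. (x s * M s q) * (x t * M t q))"
    by (intro sum.cong refl, subst sum.swap) (simp add: sum_distrib_left mult_ac)
  also have "\<dots> = (\<Sum>q\<in>Q. \<Sum>s\<in>I. \<Sum>t\<in>I. (x s * M s q) * (x t * M t q))" by (rule sum.swap)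
  finally show ?thesis by (simp add: power2_eq_square sum_product)
qed

text \<open>A Cholesky factorization in which the zero columns are dropped, so that the factor has a left
  inverse even if \<open>K\<close> is singular.\<close>

lemma psd_factorization:
  fixes K :: "'i \<Rightarrow> 'i \<Rightarrow> real"
  assumes "finite I" and "\<And>s t. s \<in> I \<Longrightarrow> t \<in> I \<Longrightarrow> K s t = K t s"
    and "\<And>x. 0 \<le> (\<Sum>s\<in>I. \<Sum>t\<in>I. x s * x t * K s t)"
  shows "\<exists>J A B. J \<subseteq> I \<and> (\<forall>s\<in>I. \<forall>t\<in>I. (\<Sum>j\<in>J. A s j * A t j) = K s t)
    \<and> (\<forall>i\<in>J. \<forall>j\<in>J. (\<Sum>s\<in>I. B i s * A s j) = (if i = j then 1 else 0))"
  using assms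
proof (induction I arbitrary: K)
  case empty
  show ?case by (intro exI[of _ "{}"]) auto
next
  case (insert k I)
  have [simp]: "k \<notin> I" "finite I" by fact+
  have ne: "s \<noteq> k" "k \<noteq> s" if "s \<in> I" for s using that \<open>k \<notin> I\<close> by metis+
  have sym: "K s k = K k s" if "s \<in> I" for s using insert.prems(1) that by auto
  have expand: "(\<Sum>s\<in>insert k I. \<Sum>t\<in>insert k I. x s * x t * K s t)
      = (x k)\<^sup>2 * K k k + 2 * x k * (\<Sum>s\<in>I. x s * K s k) + (\<Sum>s\<in>I. \<Sum>t\<in>I. x s * x t * K s t)" for x
  proof -
    have "(\<Sum>t\<in>I. x k * x t * K k t) = x k * (\<Sum>s\<in>I. x s * K s k)"
      unfolding sum_distrib_left by (intro sum.cong) (auto simp: sym)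
    moreover have "(\<Sum>s\<in>I. x s * x k * K s k) = x k * (\<Sum>s\<in>I. x s * K s k)"
      unfolding sum_distrib_left by (intro sum.cong) auto
    ultimately show ?thesis by (simp add: sum.distrib power2_eq_square)
  qed
  have restr: "(\<Sum>s\<in>I. (x(k := c)) s * f s) = (\<Sum>s\<in>I. x s * f s)"
    "(\<Sum>s\<in>I. \<Sum>t\<in>I. (x(k := c)) s * (x(k := c)) t * g s t) = (\<Sum>s\<in>I. \<Sum>t\<in>I. x s * x t * g s t)"
    for x c f and g :: "'i \<Rightarrow> 'i \<Rightarrow> real"
    by (intro sum.cong refl; simp add: ne)+
  have psd: "0 \<le> c\<^sup>2 * K k k + 2 * c * (\<Sum>s\<in>I. x s * K s k) + (\<Sum>s\<in>I. \<Sum>t\<in>I. x s * x t * K s t)" for x c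
    using insert.prems(2)[of "x(k := c)"] unfolding expand restr by simp
  have kk: "0 \<le> K k k" using psd[of 1 "\<lambda>_. 0"] by simp
  show ?case
  proof (cases "K k k = 0")
    case True
    \<comment> \<open>A zero on the diagonal of a positive semidefinite matrix forces its row and
      column to vanish; \<open>k\<close> then gets no column in the factor.\<close>
    have z: "K s k = 0" if s: "s \<in> I" for s
    proof (rule ccontr)
      assume nz: "K s k \<noteq> 0"
      define x where "x = (\<lambda>u. if u = s then 1 else 0 :: real)"
      have 1: "(\<Sum>u\<in>I. x u * K u k) = K s k" using s by (simp add: x_def if_distrib[of "\<lambda>u. u * _"] cong: if_cong)
      have 2: "(\<Sum>u\<in>I. \<Sum>t\<in>I. x u * x t * K u t) = K s s"
      proof -
        have "(\<Sum>t\<in>I. x u * x t * K u t) = (if u = s then K s s else 0)" for u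
          using s by (simp add: x_def if_distrib[of "\<lambda>u. u * _"] if_distrib[of "\<lambda>u. _ * u"] cong: if_cong)
        then show ?thesis using s by simp
      qed
      \<comment> \<open>With this multiple of the \<open>k\<close>-th unit vector added to the
        \<open>s\<close>-th one, the form would be \<open>K s s - (K s s + 1) = -1\<close>.\<close>
      from psd[of "- (K s s + 1) / (2 * K s k)" x] show False unfolding 1 2 True using nz by (simp add: field_simps)
    qed
    have "0 \<le> (\<Sum>s\<in>I. \<Sum>t\<in>I. x s * x t * K s t)" for x using psd[of 0 x] by simp
    then have "\<exists>J A B. J \<subseteq> I \<and> (\<forall>s\<in>I. \<forall>t\<in>I. (\<Sum>j\<in>J. A s j * A t j) = K s t)
      \<and> (\<forall>i\<in>J. \<forall>j\<in>J. (\<Sum>s\<in>I. B i s * A s j) = (if i = j then 1 else 0))"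
      by (intro insert.IH) (use insert.prems(1) in auto)
    then obtain J A B where JJ: "J \<subseteq> I \<and> (\<forall>s\<in>I. \<forall>t\<in>I. (\<Sum>j\<in>J. A s j * A t j) = K s t)
      \<and> (\<forall>i\<in>J. \<forall>j\<in>J. (\<Sum>s\<in>I. B i s * A s j) = (if i = j then 1 else 0))"
      by (elim exE)
    then have J: "J \<subseteq> I" "\<And>s t. s \<in> I \<Longrightarrow> t \<in> I \<Longrightarrow> (\<Sum>j\<in>J. A s j * A t j) = K s t"
      "\<And>i j. i \<in> J \<Longrightarrow> j \<in> J \<Longrightarrow> (\<Sum>s\<in>I. B i s * A s j) = (if i = j then 1 else 0)"
      by blast+
    define A' where "A' s j = (if s = k then 0 else A s j)" for s j
    define B' where "B' i s = (if s = k then 0 else B i s)" for i s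
    have "(\<Sum>j\<in>J. A' s j * A' t j) = K s t" if "s \<in> insert k I" "t \<in> insert k I" for s t
      using that J(2) True z sym by (auto simp: A'_def ne)
    moreover have "(\<Sum>s\<in>insert k I. B' i s * A' s j) = (if i = j then 1 else 0)" if "i \<in> J" "j \<in> J" for i j
    proof -
      have "(\<Sum>s\<in>I. B' i s * A' s j) = (\<Sum>s\<in>I. B i s * A s j)" by (intro sum.cong) (auto simp: A'_def B'_def ne)
      then show ?thesis using J(3)[OF that] by (simp add: B'_def)
    qed
    ultimately show ?thesis using J(1) by (intro exI[of _ J] exI[of _ A'] exI[of _ B']) auto
  next
    case False
    with kk have pos: "0 < K k k" by simp
    define r where "r = sqrt (K k k)"
    have r: "0 < r" "r * r = K k k" using pos by (auto simp: r_def)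
    \<comment> \<open>The Schur complement of the entry \<open>K k k\<close>. Its form is that of
      \<open>K\<close> with the coordinate at \<open>k\<close> set to the minimising value, hence
      nonnegative.\<close>
    define L where "L s t = K s t - K s k * K t k / K k k" for s t
    have "0 \<le> (\<Sum>s\<in>I. \<Sum>t\<in>I. x s * x t * L s t)" for x
    proof -
      define m where "m = (\<Sum>s\<in>I. x s * K s k)"
      have "(\<Sum>s\<in>I. \<Sum>t\<in>I. x s * x t * L s t)
        = (\<Sum>s\<in>I. \<Sum>t\<in>I. x s * x t * K s t) - (\<Sum>s\<in>I. \<Sum>t\<in>I. (x s * K s k) * (x t * K t k)) / K k k"
        by (simp add: L_def right_diff_distrib sum_subtractf sum_divide_distrib mult_ac)
      also have "(\<Sum>s\<in>I. \<Sum>t\<in>I. (x s * K s k) * (x t * K t k)) = m * m" by (simp add: m_def sum_product)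
      finally have "(\<Sum>s\<in>I. \<Sum>t\<in>I. x s * x t * L s t) = (- m / K k k)\<^sup>2 * K k k + 2 * (- m / K k k) * m + (\<Sum>s\<in>I. \<Sum>t\<in>I. x s * x t * K s t)"
        using pos by (simp add: power2_eq_square field_simps)
      then show ?thesis using psd[of "- m / K k k" x] by (simp add: m_def)
    qed
    moreover have "L s t = L t s" if "s \<in> I" "t \<in> I" for s t using insert.prems(1) that by (auto simp: L_def)
    ultimately have "\<exists>J A B. J \<subseteq> I \<and> (\<forall>s\<in>I. \<forall>t\<in>I. (\<Sum>j\<in>J. A s j * A t j) = L s t)
      \<and> (\<forall>i\<in>J. \<forall>j\<in>J. (\<Sum>s\<in>I. B i s * A s j) = (if i = j then 1 else 0))"
      by (intro insert.IH)
    then obtain J A B where JJ: "J \<subseteq> I \<and> (\<forall>s\<in>I. \<forall>t\<in>I. (\<Sum>j\<in>J. A s j * A t j) = L s t)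
      \<and> (\<forall>i\<in>J. \<forall>j\<in>J. (\<Sum>s\<in>I. B i s * A s j) = (if i = j then 1 else 0))"
      by (elim exE)
    then have J: "J \<subseteq> I" "\<And>s t. s \<in> I \<Longrightarrow> t \<in> I \<Longrightarrow> (\<Sum>j\<in>J. A s j * A t j) = L s t"
      "\<And>i j. i \<in> J \<Longrightarrow> j \<in> J \<Longrightarrow> (\<Sum>s\<in>I. B i s * A s j) = (if i = j then 1 else 0)"
      by blast+
    have kJ: "k \<notin> J" "finite J" using J(1) finite_subset[OF J(1)] by auto
    have neJ: "j \<noteq> k" "k \<noteq> j" if "j \<in> J" for j using kJ that by auto
    define A' where "A' s j = (if s = k then (if j = k then r else 0) else if j = k then K s k / r else A s j)" for s j
    \<comment> \<open>The left inverse of a bordered matrix: for a row \<open>i\<close> in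
      \<open>J\<close>, the entry at \<open>s = k\<close> cancels what the new column
      \<open>K s k / r\<close> contributes.\<close>
    define B' where "B' i s = (if i = k then (if s = k then 1 / r else 0) 
      else if s = k then - (\<Sum>u\<in>I. B i u * (K u k / r)) / r else B i s)" for i s
    have "(\<Sum>j\<in>insert k J. A' s j * A' t j) = K s t" if st: "s \<in> insert k I" "t \<in> insert k I" for s t
    proof -
      have sum: "(\<Sum>j\<in>J. A' s j * A' t j) = (if s = k \<or> t = k then 0 else \<Sum>j\<in>J. A s j * A t j)"
        by (auto simp: A'_def neJ intro!: sum.neutral sum.cong)
      have split: "(\<Sum>j\<in>insert k J. A' s j * A' t j) = A' s k * A' t k + (if s = k \<or> t = k then 0 else \<Sum>j\<in>J. A s j * A t j)"
        unfolding sum.insert[OF kJ(2,1)] sum ..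
      consider "s = k" "t = k" | "s = k" "t \<in> I" | "s \<in> I" "t = k" | "s \<in> I" "t \<in> I" using st by blast
      then show ?thesis
      proof cases
        case 1
        then show ?thesis unfolding split by (simp add: A'_def r(2))
      next
        case 2
        then show ?thesis unfolding split using r(1) sym[OF 2(2)] by (simp add: A'_def ne)
      next
        case 3
        then show ?thesis unfolding split using r(1) by (simp add: A'_def ne)
      next
        case 4
        have "A' s k * A' t k = K s k * K t k / K k k" using 4 by (simp add: A'_def ne r(2))
        then show ?thesis unfolding split using 4 J(2)[OF 4] by (simp add: ne L_def)
      qed
    qed
    moreover have "(\<Sum>s\<in>insert k I. B' i s * A' s j) = (if i = j then 1 else 0)" if "i \<in> insert k J" "j \<in> insert k J" for i j
    proof -
      have sum: "(\<Sum>s\<in>I. B' i s * A' s j) = (if i = k then 0 else if j = k then \<Sum>u\<in>I. B i u * (K u k / r) else \<Sum>s\<in>I. B i s * A s j)"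
        by (auto simp: A'_def B'_def ne intro!: sum.neutral sum.cong)
      show ?thesis using that J(3) kJ r pos unfolding sum.insert[OF \<open>finite I\<close> \<open>k \<notin> I\<close>] sum
        by (auto simp: A'_def B'_def neJ)
    qed
    ultimately show ?thesis using J(1) by (intro exI[of _ "insert k J"] exI[of _ A'] exI[of _ B']) auto
  qed
qed

text \<open>\<open>w\<close> is row \<open>s\<close> of \<open>1 - A B\<close>. Since
  \<open>B A = 1\<close>, it annihilates the columns of \<open>A\<close>, so the form of
  \<open>K\<close> vanishes at \<open>w\<close>; the assumption on \<open>y\<close> then makes the
  pairing of \<open>w\<close> with \<open>y\<close> zero, which is the claim.\<close>

lemma range_of_factor:
  fixes K :: "'i \<Rightarrow> 'i \<Rightarrow> real"
  assumes fin: "finite I" and AA: "\<And>s t. s \<in> I \<Longrightarrow> t \<in> I \<Longrightarrow> (\<Sum>j\<in>J. A s j * A t j) = K s t"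
    and BA: "\<And>i j. i \<in> J \<Longrightarrow> j \<in> J \<Longrightarrow> (\<Sum>s\<in>I. B i s * A s j) = (if i = j then 1 else 0)" and finJ: "finite J"
    and y: "\<And>w. (\<Sum>s\<in>I. \<Sum>t\<in>I. w s * w t * K s t) = 0 \<Longrightarrow> (\<Sum>s\<in>I. w s * y s) = 0"
    and s: "s \<in> I"
  shows "(\<Sum>j\<in>J. A s j * (\<Sum>u\<in>I. B j u * y u)) = y s"
proof -
  define w where "w u = (if u = s then 1 else 0) - (\<Sum>j\<in>J. A s j * B j u)" for u
  have wf: "(\<Sum>u\<in>I. w u * f u) = f s - (\<Sum>j\<in>J. A s j * (\<Sum>u\<in>I. B j u * f u))" for f
  proof -
    have "(\<Sum>u\<in>I. w u * f u) = (\<Sum>u\<in>I. (if u = s then 1 else 0) * f u) - (\<Sum>u\<in>I. \<Sum>j\<in>J. A s j * (B j u * f u))"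
      by (simp add: w_def left_diff_distrib sum_subtractf sum_distrib_right mult.assoc)
    also have "(\<Sum>u\<in>I. (if u = s then 1 else 0) * f u) = f s"
      using fin s by (simp add: if_distrib[of "\<lambda>u. u * _"] cong: if_cong)
    also have "(\<Sum>u\<in>I. \<Sum>j\<in>J. A s j * (B j u * f u)) = (\<Sum>j\<in>J. A s j * (\<Sum>u\<in>I. B j u * f u))"
      by (subst sum.swap) (simp add: sum_distrib_left)
    finally show ?thesis .
  qed
  have "(\<Sum>u\<in>I. w u * A u j) = 0" if "j \<in> J" for j
  proof -
    have "(\<Sum>i\<in>J. A s i * (\<Sum>u\<in>I. B i u * A u j)) = (\<Sum>i\<in>J. A s i * (if i = j then 1 else 0))"
      using BA that by (intro sum.cong) auto
    then show ?thesis using that finJ by (simp add: wf if_distrib[of "\<lambda>u. _ * u"] cong: if_cong)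
  qed
  then have "(\<Sum>u\<in>I. \<Sum>t\<in>I. w u * w t * (\<Sum>j\<in>J. A u j * A t j)) = 0"
    unfolding quadratic_form_gram by simp
  moreover have "(\<Sum>u\<in>I. \<Sum>t\<in>I. w u * w t * (\<Sum>j\<in>J. A u j * A t j)) = (\<Sum>u\<in>I. \<Sum>t\<in>I. w u * w t * K u t)"
    using AA by (intro sum.cong) auto
  ultimately show ?thesis using y[of w] by (simp add: wf)
qed

section \<open>Couplings and posteriors\<close>

text \<open>Inside \<open>Y\<close> the measure \<open>\<nu>\<close> is dominated by
  \<open>\<mu>\<close> and so has a Radon-Nikodym density there. It is at most 1 almost everywhere,
  since the set where it exceeds 1 would otherwise carry too much mass.\<close>

lemma density_bounded_ratio:
  assumes "finite_measure \<mu>" and sets: "sets \<nu> = sets \<mu>" and Y: "Y \<in> sets \<mu>" and "finite_measure \<nu>"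
    and le: "\<And>X. X \<in> sets \<mu> \<Longrightarrow> X \<subseteq> Y \<Longrightarrow> emeasure \<nu> X \<le> emeasure \<mu> X"
  obtains f where "f \<in> borel_measurable \<mu>" "\<And>x. 0 \<le> f x" "\<And>x. f x \<le> (1::real)"
    "density \<mu> (\<lambda>x. ennreal (f x) * indicator Y x) = density \<nu> (indicator Y)"
proof -
  interpret \<mu>: finite_measure \<mu> by fact
  interpret \<nu>: finite_measure \<nu> by fact
  note [measurable_cong] = sets
  have [measurable]: "Y \<in> sets \<mu>" "Y \<in> sets \<nu>" using Y sets by auto
  define \<nu>' where "\<nu>' = density \<nu> (indicator Y)"
  have s': "sets \<nu>' = sets \<mu>" using sets by (simp add: \<nu>'_def)
  have e': "emeasure \<nu>' X = emeasure \<nu> (Y \<inter> X)" if "X \<in> sets \<mu>" for X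
  proof -
    have "emeasure \<nu>' X = (\<integral>\<^sup>+x. indicator Y x * indicator X x \<partial>\<nu>)"
      unfolding \<nu>'_def using that sets by (intro emeasure_density) auto
    also have "\<dots> = (\<integral>\<^sup>+x. indicator (Y \<inter> X) x \<partial>\<nu>)" by (intro nn_integral_cong) (auto split: split_indicator)
    also have "\<dots> = emeasure \<nu> (Y \<inter> X)" using that sets by (intro nn_integral_indicator) auto
    finally show ?thesis .
  qed
  have ac: "absolutely_continuous \<mu> \<nu>'"
    unfolding absolutely_continuous_def
  proof
    fix X assume X: "X \<in> null_sets \<mu>"
    then have "emeasure \<nu>' X \<le> emeasure \<mu> (Y \<inter> X)" using le[of "Y \<inter> X"] by (auto simp: e' null_sets_def)
    also have "\<dots> \<le> emeasure \<mu> X" using X by (intro emeasure_mono) auto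
    finally show "X \<in> null_sets \<nu>'" using X s' by (auto simp: null_sets_def)
  qed
  define h where "h = RN_deriv \<mu> \<nu>'"
  have h [measurable]: "h \<in> borel_measurable \<mu>" by (simp add: h_def)
  have hd: "density \<mu> h = \<nu>'" unfolding h_def by (rule \<mu>.density_RN_deriv[OF ac s'])
  have h1: "AE x in \<mu>. h x \<le> 1"
  proof (rule ccontr)
    assume "\<not> (AE x in \<mu>. h x \<le> 1)"
    define Z where "Z = {x \<in> space \<mu>. 1 < h x}"
    have [measurable]: "Z \<in> sets \<mu>" unfolding Z_def by measurable
    have "emeasure \<mu> Z \<noteq> 0"
      using \<open>\<not> (AE x in \<mu>. h x \<le> 1)\<close> by (subst (asm) AE_iff_measurable[of Z]) (auto simp: Z_def not_le)
    then have pos: "0 < emeasure \<mu> Z" by (simp add: zero_less_iff_neq_zero)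
    have "emeasure \<nu>' Z \<le> emeasure \<mu> Z"
    proof -
      have "emeasure \<nu>' Z \<le> emeasure \<mu> (Y \<inter> Z)" using le[of "Y \<inter> Z"] by (simp add: e')
      also have "\<dots> \<le> emeasure \<mu> Z" by (intro emeasure_mono) auto
      finally show ?thesis .
    qed
    moreover have "emeasure \<nu>' Z = (\<integral>\<^sup>+x. h x * indicator Z x \<partial>\<mu>)"
      unfolding hd[symmetric] by (simp add: emeasure_density)
    moreover have "emeasure \<mu> Z < (\<integral>\<^sup>+x. h x * indicator Z x \<partial>\<mu>)"
    proof -
      have "(\<integral>\<^sup>+x. indicator Z x \<partial>\<mu>) < (\<integral>\<^sup>+x. h x * indicator Z x \<partial>\<mu>)"
      proof (rule nn_integral_less)
        show "(\<integral>\<^sup>+x. indicator Z x \<partial>\<mu>) \<noteq> \<infinity>" by (simp add: \<mu>.emeasure_eq_measure)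
        show "AE x in \<mu>. indicator Z x \<le> h x * indicator Z x"
          by (auto simp: Z_def split: split_indicator)
        show "\<not> (AE x in \<mu>. h x * indicator Z x \<le> indicator Z x)"
        proof
          assume "AE x in \<mu>. h x * indicator Z x \<le> indicator Z x"
          then have "AE x in \<mu>. x \<notin> Z" by eventually_elim (auto simp: Z_def split: split_indicator_asm)
          then show False using \<open>emeasure \<mu> Z \<noteq> 0\<close> by (simp add: AE_iff_null null_sets_def Z_def)
        qed
      qed auto
      then show ?thesis by simp
    qed
    ultimately show False by simp
  qed
  \<comment> \<open>Truncation at 1 changes the density on a null set only and gives the bound at
    every point, so that its values can serve as probabilities.\<close>
  define f where "f x = enn2real (min 1 (h x))" for x
  have fh: "ennreal (f x) = min 1 (h x)" for x
    unfolding f_def by (intro ennreal_enn2real) (simp add: min_less_iff_disj)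
  show ?thesis
  proof
    show "f \<in> borel_measurable \<mu>" unfolding f_def by measurable
    show "0 \<le> f x" for x by (simp add: f_def)
    show "f x \<le> 1" for x
      using fh[of x] by (simp flip: ennreal_le_1)
    have "density \<mu> (\<lambda>x. ennreal (f x) * indicator Y x) = density \<mu> (\<lambda>x. h x * indicator Y x)"
      unfolding fh using h1 by (intro density_cong) (auto simp: min_absorb2)
    also have "\<dots> = density (density \<mu> h) (indicator Y)" by (subst density_density_eq) auto
    also have "\<dots> = density \<nu> (indicator Y)"
      unfolding hd \<nu>'_def by (subst density_density_eq) (auto simp: indicator_inter_arith[symmetric])
    finally show "density \<mu> (\<lambda>x. ennreal (f x) * indicator Y x) = density \<nu> (indicator Y)" .
  qed
qed

text \<open>\<open>p\<close> and \<open>q\<close> are the densities with respect to \<open>\<mu>\<close> and \<open>\<nu>\<close> of their common part, on which the coupling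
  is diagonal.\<close>

lemma common_part:
  assumes "finite_measure \<mu>" "finite_measure \<nu>" and sets: "sets \<nu> = sets \<mu>"
  obtains p q Y where "p \<in> borel_measurable \<mu>" "q \<in> borel_measurable \<mu>" "Y \<in> sets \<mu>"
    "\<And>x. 0 \<le> p x" "\<And>x. p x \<le> (1::real)" "\<And>x. 0 \<le> q x" "\<And>x. q x \<le> (1::real)"
    "\<And>x. x \<in> space \<mu> - Y \<Longrightarrow> p x = 1" "\<And>x. x \<in> Y \<Longrightarrow> q x = 1"
    "density \<mu> p = density \<nu> q"
proof -
  note [measurable_cong] = sets
  \<comment> \<open>Hahn decomposition: \<open>\<nu>\<close> lies below \<open>\<mu>\<close> inside
    \<open>Y\<close> and above it outside. The minimum of both therefore has density
    \<open>f\<close> or 1 with respect to \<open>\<mu>\<close>, and 1 or \<open>g\<close> with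
    respect to \<open>\<nu>\<close>.\<close>
  obtain Y where Y: "Y \<in> sets \<mu>" and Y1: "\<forall>X\<in>sets \<mu>. X \<subseteq> Y \<longrightarrow> emeasure \<nu> X \<le> emeasure \<mu> X"
    and Y2: "\<forall>X\<in>sets \<mu>. X \<inter> Y = {} \<longrightarrow> emeasure \<mu> X \<le> emeasure \<nu> X"
    using finite_unsigned_Hahn_decomposition[OF assms] by blast
  have spe: "space \<nu> = space \<mu>" using sets by (rule sets_eq_imp_space_eq)
  define Z where "Z = space \<mu> - Y"
  have [measurable]: "Y \<in> sets \<mu>" "Z \<in> sets \<mu>" "Y \<in> sets \<nu>" "Z \<in> sets \<nu>" using Y sets spe by (auto simp: Z_def)
  obtain f where f [measurable]: "f \<in> borel_measurable \<mu>" and f01: "\<And>x. 0 \<le> f x" "\<And>x. f x \<le> (1::real)"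
    and fd: "density \<mu> (\<lambda>x. ennreal (f x) * indicator Y x) = density \<nu> (indicator Y)"
  proof (rule density_bounded_ratio[OF assms(1) sets Y assms(2)])
    fix X assume "X \<in> sets \<mu>" "X \<subseteq> Y"
    then show "emeasure \<nu> X \<le> emeasure \<mu> X" using Y1 by blast
  qed (rule that)
  obtain g where g [measurable]: "g \<in> borel_measurable \<nu>" and g01: "\<And>x. 0 \<le> g x" "\<And>x. g x \<le> (1::real)"
    and gd: "density \<nu> (\<lambda>x. ennreal (g x) * indicator Z x) = density \<mu> (indicator Z)"
  proof (rule density_bounded_ratio[OF assms(2) sets[symmetric] \<open>Z \<in> sets \<nu>\<close> assms(1)])
    fix X assume "X \<in> sets \<nu>" "X \<subseteq> Z"
    then show "emeasure \<mu> X \<le> emeasure \<nu> X" using Y2 sets by (auto simp: Z_def)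
  qed (rule that)
  have g' [measurable]: "g \<in> borel_measurable \<mu>" using g by (simp cong: measurable_cong_sets)
  define p where "p x = (if x \<in> Y then f x else 1)" for x
  define q where "q x = (if x \<in> Y then 1 else g x)" for x
  have p [measurable]: "p \<in> borel_measurable \<mu>" unfolding p_def by measurable
  have q [measurable]: "q \<in> borel_measurable \<mu>" unfolding q_def by measurable
  have q': "q \<in> borel_measurable \<nu>" using q sets by (simp cong: measurable_cong_sets)
  show ?thesis
  proof (rule that[of p q Y])
    show "density \<mu> p = density \<nu> q"
    proof (rule measure_eqI)
      fix A assume "A \<in> sets (density \<mu> (\<lambda>x. ennreal (p x)))"
      then have A [measurable]: "A \<in> sets \<mu>" "A \<in> sets \<nu>" using sets by auto
      have "emeasure (density \<mu> p) A = (\<integral>\<^sup>+x. ennreal (p x) * indicator A x \<partial>\<mu>)" by (simp add: emeasure_density)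
      also have "\<dots> = (\<integral>\<^sup>+x. ennreal (f x) * indicator Y x * indicator A x + indicator Z x * indicator A x \<partial>\<mu>)"
        by (intro nn_integral_cong) (auto simp: p_def Z_def split: split_indicator)
      also have "\<dots> = (\<integral>\<^sup>+x. ennreal (f x) * indicator Y x * indicator A x \<partial>\<mu>) + (\<integral>\<^sup>+x. indicator Z x * indicator A x \<partial>\<mu>)"
        by (intro nn_integral_add) auto
      also have "(\<integral>\<^sup>+x. ennreal (f x) * indicator Y x * indicator A x \<partial>\<mu>) = emeasure (density \<nu> (indicator Y)) A"
        unfolding fd[symmetric] by (simp add: emeasure_density)
      also have "(\<integral>\<^sup>+x. indicator Z x * indicator A x \<partial>\<mu>) = emeasure (density \<nu> (\<lambda>x. ennreal (g x) * indicator Z x)) A"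
        unfolding gd by (simp add: emeasure_density)
      also have "emeasure (density \<nu> (indicator Y)) A + emeasure (density \<nu> (\<lambda>x. ennreal (g x) * indicator Z x)) A
        = (\<integral>\<^sup>+x. indicator Y x * indicator A x \<partial>\<nu>) + (\<integral>\<^sup>+x. ennreal (g x) * indicator Z x * indicator A x \<partial>\<nu>)"
        by (simp add: emeasure_density)
      also have "\<dots> = (\<integral>\<^sup>+x. indicator Y x * indicator A x + ennreal (g x) * indicator Z x * indicator A x \<partial>\<nu>)"
        by (intro nn_integral_add[symmetric]) auto
      also have "\<dots> = (\<integral>\<^sup>+x. ennreal (q x) * indicator A x \<partial>\<nu>)"
        by (intro nn_integral_cong) (auto simp: q_def Z_def spe split: split_indicator)
      also have "\<dots> = emeasure (density \<nu> q) A" using q' by (simp add: emeasure_density)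
      finally show "emeasure (density \<mu> p) A = emeasure (density \<nu> q) A" .
    qed (use sets in simp)
  qed (use p q Y f01 g01 in \<open>auto simp: p_def q_def\<close>)
qed

section \<open>A coupling bound for the Wasserstein distance\<close>

lemma L2_set_measurable [measurable]: "(\<lambda>u. L2_set u I) \<in> borel_measurable (euclid I)"
  unfolding L2_set_def euclid_def by measurable

lemma L2_set_diff_measurable:
  "(\<lambda>(u, v). L2_set (\<lambda>i. u i - v i) I) \<in> borel_measurable (euclid I \<Otimes>\<^sub>M euclid I)"
  unfolding L2_set_def euclid_def by measurable

lemma L2_set_diff_le: "L2_set (\<lambda>i. u i - v i) I \<le> L2_set u I + L2_set v I"
proof -
  have "L2_set (\<lambda>i. u i + (- v i)) I \<le> L2_set u I + L2_set (\<lambda>i. - v i) I" by (rule L2_set_triangle_ineq)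
  then show ?thesis by (simp add: L2_set_def)
qed

definition uniform01 :: "real measure" where "uniform01 = density lborel (indicator {0<..<1})"

lemma nn_integral_uniform01_if:
  assumes "0 \<le> a" "a \<le> 1"
  shows "(\<integral>\<^sup>+u. (if u < a then c else d) \<partial>uniform01) = ennreal a * c + ennreal (1 - a) * (d :: ennreal)"
proof -
  have "(\<integral>\<^sup>+u. (if u < a then c else d) \<partial>uniform01)
      = (\<integral>\<^sup>+u. indicator {0<..<1} u * (if u < a then c else d) \<partial>lborel)"
    unfolding uniform01_def by (subst nn_integral_density) auto
  also have "\<dots> = (\<integral>\<^sup>+u. c * indicator {0<..<a} u + d * indicator {a..<1} u \<partial>lborel)"
  proof (rule nn_integral_cong_AE)
    have "AE u in lborel. u \<noteq> (0::real)" by (rule AE_lborel_singleton)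
    then show "AE u in lborel. indicator {0<..<1} u * (if u < a then c else d) = c * indicator {0<..<a} u + d * indicator {a..<1} u"
      by eventually_elim (use assms in \<open>auto split: split_indicator\<close>)
  qed
  also have "\<dots> = c * ennreal a + d * ennreal (1 - a)"
    using assms by (subst nn_integral_add) (auto simp: nn_integral_cmult)
  finally show ?thesis by (simp add: mult.commute)
qed

lemma prob_space_uniform01: "prob_space uniform01"
  by (rule prob_spaceI) (simp add: uniform01_def emeasure_density)

text \<open>The coupling keeps a point \<open>x\<close> of \<open>\<mu>\<close> with probability
  \<open>p x\<close> and otherwise replaces it by an independent point of the normalised excess of
  \<open>\<nu>\<close>. A replacement costs at most the sum of both norms, so the total cost is at
  most the sum of the first moments of the two excesses. Each of these is a difference of integrals
  of the norm over one set of the Hahn decomposition and thus at most \<open>D\<close>; hence the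
  factor 2.\<close>

lemma wasserstein1_le:
  fixes \<mu> \<nu> :: "('i \<Rightarrow> real) measure"
  assumes "prob_space \<mu>" "prob_space \<nu>" and sets: "sets \<mu> = sets (euclid I)" "sets \<nu> = sets (euclid I)"
    and int: "integrable \<mu> (\<lambda>u. L2_set u I)" "integrable \<nu> (\<lambda>u. L2_set u I)"
    and D: "\<And>A. A \<in> sets (euclid I) \<Longrightarrow> 
      \<bar>(\<integral>u. indicator A u * L2_set u I \<partial>\<mu>) - (\<integral>u. indicator A u * L2_set u I \<partial>\<nu>)\<bar> \<le> D"
  shows "wasserstein1 I \<mu> \<nu> \<le> ennreal (2 * D)"
proof -
  interpret \<mu>: prob_space \<mu> by fact
  interpret \<nu>: prob_space \<nu> by fact
  note [measurable_cong] = sets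
  have s: "sets \<nu> = sets \<mu>" using sets by simp
  have sp: "space \<mu> = space (euclid I)" "space \<nu> = space (euclid I)" using sets by (auto dest: sets_eq_imp_space_eq)
  have D0: "0 \<le> D" using D[of "{}"] by simp
  let ?N = "\<lambda>u. L2_set u I"
  let ?W = "euclid I \<Otimes>\<^sub>M euclid I"
  obtain p q Y where p: "p \<in> borel_measurable \<mu>" and q: "q \<in> borel_measurable \<mu>" and Y: "Y \<in> sets \<mu>"
    and p01: "\<And>x. 0 \<le> p x" "\<And>x. p x \<le> (1::real)" and q01: "\<And>x. 0 \<le> q x" "\<And>x. q x \<le> (1::real)"
    and pY: "\<And>x. x \<in> space \<mu> - Y \<Longrightarrow> p x = 1" and qY: "\<And>x. x \<in> Y \<Longrightarrow> q x = 1"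
    and pq: "density \<mu> p = density \<nu> q"
    by (rule common_part[OF \<mu>.finite_measure_axioms \<nu>.finite_measure_axioms s]) (rule that)
  have [measurable]: "p \<in> borel_measurable (euclid I)" "q \<in> borel_measurable (euclid I)" "Y \<in> sets (euclid I)"
    using p q Y sets by (simp_all cong: measurable_cong_sets)
  have pq_int: "(\<integral>\<^sup>+x. ennreal (p x) * f x \<partial>\<mu>) = (\<integral>\<^sup>+x. ennreal (q x) * f x \<partial>\<nu>)"
    if [measurable]: "f \<in> borel_measurable (euclid I)" for f
    using arg_cong[OF pq, of "\<lambda>M. \<integral>\<^sup>+x. f x \<partial>M"] by (simp add: nn_integral_density)
  define cost1 where "cost1 = (\<integral>\<^sup>+x. ennreal (1 - p x) * ennreal (?N x) \<partial>\<mu>)"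
  define cost2 where "cost2 = (\<integral>\<^sup>+x. ennreal (1 - q x) * ennreal (?N x) \<partial>\<nu>)"
  \<comment> \<open>Both excesses at once: the second case is the first with the measures exchanged
    and \<open>Y\<close> replaced by its complement.\<close>
  have costs: "(\<integral>\<^sup>+x. ennreal (1 - r x) * ennreal (?N x) \<partial>\<alpha>) \<le> ennreal D"
    if ab: "\<alpha> = \<mu> \<and> \<beta> = \<nu> \<and> r = p \<and> r' = q \<and> Z = Y \<or> \<alpha> = \<nu> \<and> \<beta> = \<mu> \<and> r = q \<and> r' = p \<and> Z = space (euclid I) - Y"
    for \<alpha> \<beta> r r' Z
  proof -
    have [measurable]: "Z \<in> sets (euclid I)" "r \<in> borel_measurable (euclid I)" "r' \<in> borel_measurable (euclid I)" using ab by auto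
    have [measurable_cong]: "sets \<alpha> = sets (euclid I)" "sets \<beta> = sets (euclid I)" using ab sets by auto
    have r01: "0 \<le> r x" "r x \<le> 1" for x using ab p01 q01 by auto
    have i: "integrable \<alpha> ?N" "integrable \<beta> ?N" using ab int by auto
    have rZ: "r x = 1" if "x \<in> space (euclid I)" "x \<notin> Z" for x using ab that pY qY sp by auto
    have r'Z: "r' x = 1" if "x \<in> space (euclid I)" "x \<in> Z" for x using ab that pY qY sp by auto
    have spa: "space \<alpha> = space (euclid I)" "space \<beta> = space (euclid I)" using ab sp by auto
    have iA: "integrable M (\<lambda>x. indicator Z x * ?N x)" if M: "M = \<alpha> \<or> M = \<beta>" for M
      by (rule Bochner_Integration.integrable_bound[of M ?N]) (use M i in \<open>auto split: split_indicator\<close>)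
    have irN: "integrable \<alpha> (\<lambda>x. r x * (indicator Z x * ?N x))"
      by (rule Bochner_Integration.integrable_bound[OF i(1)]) (use r01 in \<open>auto split: split_indicator simp: abs_mult mult_left_le_one_le\<close>)
    have eq: "(\<integral>\<^sup>+x. ennreal (r x) * ennreal (indicator Z x * ?N x) \<partial>\<alpha>) = (\<integral>\<^sup>+x. ennreal (indicator Z x * ?N x) \<partial>\<beta>)"
    proof -
      have "(\<integral>\<^sup>+x. ennreal (r x) * ennreal (indicator Z x * ?N x) \<partial>\<alpha>) = (\<integral>\<^sup>+x. ennreal (r' x) * ennreal (indicator Z x * ?N x) \<partial>\<beta>)"
        using ab pq_int[of "\<lambda>x. ennreal (indicator Z x * ?N x)"] by auto
      also have "\<dots> = (\<integral>\<^sup>+x. ennreal (indicator Z x * ?N x) \<partial>\<beta>)"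
        using r'Z by (intro nn_integral_cong) (auto simp: spa split: split_indicator)
      finally show ?thesis .
    qed
    have eqI: "(\<integral>x. r x * (indicator Z x * ?N x) \<partial>\<alpha>) = (\<integral>x. indicator Z x * ?N x \<partial>\<beta>)"
    proof -
      have "ennreal (\<integral>x. r x * (indicator Z x * ?N x) \<partial>\<alpha>) = ennreal (\<integral>x. indicator Z x * ?N x \<partial>\<beta>)"
        using eq r01 irN iA by (simp add: nn_integral_eq_integral ennreal_mult[symmetric])
      then show ?thesis using r01 by (subst (asm) ennreal_inj) (auto intro!: Bochner_Integration.integral_nonneg)
    qed
    have "(\<integral>\<^sup>+x. ennreal (1 - r x) * ennreal (?N x) \<partial>\<alpha>) = (\<integral>\<^sup>+x. ennreal (indicator Z x * ?N x - r x * (indicator Z x * ?N x)) \<partial>\<alpha>)"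
      using rZ r01 by (intro nn_integral_cong) (auto simp: spa ennreal_mult[symmetric] left_diff_distrib split: split_indicator)
    also have "\<dots> = ennreal (\<integral>x. indicator Z x * ?N x - r x * (indicator Z x * ?N x) \<partial>\<alpha>)"
      using iA irN r01 by (intro nn_integral_eq_integral) (auto simp: mult_left_le_one_le)
    also have "(\<integral>x. indicator Z x * ?N x - r x * (indicator Z x * ?N x) \<partial>\<alpha>) = (\<integral>x. indicator Z x * ?N x \<partial>\<alpha>) - (\<integral>x. indicator Z x * ?N x \<partial>\<beta>)"
      using iA irN by (simp add: eqI)
    also have "\<dots> \<le> D"
      using D[of Z] ab by (auto simp: abs_le_iff)
    finally show ?thesis by (simp add: ennreal_leI)
  qed
  have c1: "cost1 \<le> ennreal D" unfolding cost1_def by (rule costs) blast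
  have c2: "cost2 \<le> ennreal D" unfolding cost2_def by (rule costs) blast
  \<comment> \<open>The mass of the excess, equal on both sides because two probability measures
    share one common part.\<close>
  define m where "m = (\<integral>x. 1 - p x \<partial>\<mu>)"
  have ip: "integrable \<mu> (\<lambda>x. 1 - p x)" "integrable \<mu> p" using p01 by (auto intro!: \<mu>.integrable_const_bound[where B = 1])
  have iq: "integrable \<nu> (\<lambda>x. 1 - q x)" "integrable \<nu> q" using q01 by (auto intro!: \<nu>.integrable_const_bound[where B = 1])
  have mq: "m = (\<integral>x. 1 - q x \<partial>\<nu>)"
  proof -
    have "ennreal (\<integral>x. p x \<partial>\<mu>) = ennreal (\<integral>x. q x \<partial>\<nu>)"
      using pq_int[of "\<lambda>_. 1"] ip iq p01 q01 by (simp add: nn_integral_eq_integral)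
    then have "(\<integral>x. p x \<partial>\<mu>) = (\<integral>x. q x \<partial>\<nu>)" using p01 q01 by (subst (asm) ennreal_inj) (auto intro!: Bochner_Integration.integral_nonneg)
    then show ?thesis using ip iq by (simp add: m_def \<mu>.prob_space \<nu>.prob_space)
  qed
  have m0: "0 \<le> m" unfolding m_def using p01 by (intro Bochner_Integration.integral_nonneg) auto
  have nm: "(\<integral>\<^sup>+x. ennreal (1 - p x) \<partial>\<mu>) = ennreal m" "(\<integral>\<^sup>+x. ennreal (1 - q x) \<partial>\<nu>) = ennreal m"
    using ip iq p01 q01 by (auto simp: m_def mq[unfolded m_def] nn_integral_eq_integral)
  show ?thesis
  \<comment> \<open>Without excess there is nothing to normalise: the measures agree and the
    diagonal coupling costs nothing.\<close>
  proof (cases "m = 0")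
    case True
    have "\<mu> = \<nu>"
    proof (rule measure_eqI)
      fix A assume "A \<in> sets \<mu>"
      then have [measurable]: "A \<in> sets (euclid I)" using sets by simp
      have one: "AE x in \<alpha>. ennreal (r x) = 1"
        if "(\<integral>\<^sup>+x. ennreal (1 - r x) \<partial>\<alpha>) = 0" "r \<in> borel_measurable \<alpha>" "\<And>x. r x \<le> 1" for \<alpha> and r :: "('i \<Rightarrow> real) \<Rightarrow> real"
      proof -
        have "(\<lambda>x. ennreal (1 - r x)) \<in> borel_measurable \<alpha>" using that(2) by measurable
        from nn_integral_0_iff_AE[OF this] that(1) have "AE x in \<alpha>. ennreal (1 - r x) = 0" by simp
        then show ?thesis
        proof eventually_elim
          case (elim x)
          then have "r x = 1" using that(3)[of x] by (simp add: ennreal_eq_0_iff)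
          then show ?case by simp
        qed
      qed
      have 1: "AE x in \<mu>. ennreal (p x) = 1" using nm(1) True p01 p by (intro one) auto
      have 2: "AE x in \<nu>. ennreal (q x) = 1" using nm(2) True q01 by (intro one) auto
      have "emeasure \<mu> A = (\<integral>\<^sup>+x. indicator A x \<partial>\<mu>)" by simp
      also have "\<dots> = (\<integral>\<^sup>+x. ennreal (p x) * indicator A x \<partial>\<mu>)" using 1 by (intro nn_integral_cong_AE) (auto elim!: eventually_mono)
      also have "\<dots> = (\<integral>\<^sup>+x. ennreal (q x) * indicator A x \<partial>\<nu>)" by (rule pq_int) measurable
      also have "\<dots> = (\<integral>\<^sup>+x. indicator A x \<partial>\<nu>)" using 2 by (intro nn_integral_cong_AE) (auto elim!: eventually_mono)
      also have "\<dots> = emeasure \<nu> A" by simp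
      finally show "emeasure \<mu> A = emeasure \<nu> A" .
    qed (use s in simp)
    define \<pi> where "\<pi> = distr \<mu> ?W (\<lambda>u. (u, u))"
    have "\<pi> \<in> couplings I \<mu> \<nu>"
      unfolding couplings_def \<pi>_def \<open>\<mu> = \<nu>\<close>[symmetric]
      by (auto simp: distr_distr comp_def intro!: \<mu>.prob_space_distr) (auto simp: distr_id2 sets)
    then have "wasserstein1 I \<mu> \<nu> \<le> (\<integral>\<^sup>+ (u, v). ennreal (L2_set (\<lambda>i. u i - v i) I) \<partial>\<pi>)"
      unfolding wasserstein1_def by (rule INF_lower)
    also have "\<dots> = 0"
      unfolding \<pi>_def using L2_set_diff_measurable[of I]
      by (subst nn_integral_distr) (auto simp: split_beta' L2_set_def)
    finally show ?thesis by simp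
  next
    case False
    with m0 have m: "0 < m" by simp
    define \<rho> where "\<rho> = density \<nu> (\<lambda>x. ennreal ((1 - q x) / m))"
    have [measurable_cong]: "sets \<rho> = sets (euclid I)" by (simp add: \<rho>_def sets)
    have dm: "ennreal ((1 - q x) / m) = ennreal (1 / m) * ennreal (1 - q x)" for x
      using m q01 by (simp add: ennreal_mult[symmetric])
    have \<rho>int: "ennreal m * (\<integral>\<^sup>+x. f x \<partial>\<rho>) = (\<integral>\<^sup>+x. ennreal (1 - q x) * f x \<partial>\<nu>)" if [measurable]: "f \<in> borel_measurable (euclid I)" for f
    proof -
      have "ennreal m * (\<integral>\<^sup>+x. f x \<partial>\<rho>) = ennreal m * (ennreal (1 / m) * (\<integral>\<^sup>+x. ennreal (1 - q x) * f x \<partial>\<nu>))"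
        unfolding \<rho>_def dm by (subst nn_integral_density) (auto simp: mult.assoc nn_integral_cmult)
      then show ?thesis using m by (simp add: mult.assoc[symmetric] ennreal_mult[symmetric])
    qed
    have "prob_space \<rho>"
    proof (rule prob_spaceI)
      have "ennreal m * emeasure \<rho> (space \<rho>) = ennreal m * 1" using \<rho>int[of "\<lambda>_. 1"] nm by simp
      then have "ennreal (1 / m) * ennreal m * emeasure \<rho> (space \<rho>) = ennreal (1 / m) * ennreal m * 1"
        by (simp only: mult.assoc)
      moreover have "ennreal (1 / m) * ennreal m = 1" using m by (simp add: ennreal_mult[symmetric])
      ultimately show "emeasure \<rho> (space \<rho>) = 1" by simp
    qed
    then interpret \<rho>: prob_space \<rho> .
    interpret U: prob_space uniform01 by (rule prob_space_uniform01)
    interpret MR: pair_prob_space \<mu> \<rho> ..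
    interpret P: pair_prob_space "\<mu> \<Otimes>\<^sub>M \<rho>" uniform01 ..
    have [measurable_cong]: "sets uniform01 = sets borel" by (simp add: uniform01_def)
    \<comment> \<open>The uniform variable decides between keeping \<open>x\<close> and moving to
      \<open>y\<close>, so the coupling is the image of a product measure under a measurable
      map.\<close>
    define T where "T z = (case z of ((x, y), u) \<Rightarrow> (x, if u < p x then x else y))" for z :: "(('i \<Rightarrow> real) \<times> ('i \<Rightarrow> real)) \<times> real"
    have T [measurable]: "T \<in> measurable ((\<mu> \<Otimes>\<^sub>M \<rho>) \<Otimes>\<^sub>M uniform01) ?W"
      unfolding T_def split_beta' by measurable
    define \<pi> where "\<pi> = distr ((\<mu> \<Otimes>\<^sub>M \<rho>) \<Otimes>\<^sub>M uniform01) ?W T"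
    have int\<pi>: "(\<integral>\<^sup>+w. f w \<partial>\<pi>) = (\<integral>\<^sup>+x. \<integral>\<^sup>+y. ennreal (p x) * f (x, x) + ennreal (1 - p x) * f (x, y) \<partial>\<rho> \<partial>\<mu>)"
      if [measurable]: "f \<in> borel_measurable ?W" for f
    proof -
      have "(\<integral>\<^sup>+w. f w \<partial>\<pi>) = (\<integral>\<^sup>+z. f (T z) \<partial>((\<mu> \<Otimes>\<^sub>M \<rho>) \<Otimes>\<^sub>M uniform01))"
        unfolding \<pi>_def by (rule nn_integral_distr) measurable
      also have "\<dots> = (\<integral>\<^sup>+xy. \<integral>\<^sup>+u. f (T (xy, u)) \<partial>uniform01 \<partial>(\<mu> \<Otimes>\<^sub>M \<rho>))"
        by (rule U.nn_integral_fst[symmetric]) measurable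
      also have "\<dots> = (\<integral>\<^sup>+xy. (case xy of (x, y) \<Rightarrow> ennreal (p x) * f (x, x) + ennreal (1 - p x) * f (x, y)) \<partial>(\<mu> \<Otimes>\<^sub>M \<rho>))"
      proof (intro nn_integral_cong, clarify)
        fix x y
        have "f (T ((x, y), u)) = (if u < p x then f (x, x) else f (x, y))" for u by (simp add: T_def)
        then show "(\<integral>\<^sup>+u. f (T ((x, y), u)) \<partial>uniform01) = ennreal (p x) * f (x, x) + ennreal (1 - p x) * f (x, y)"
          by (simp add: nn_integral_uniform01_if p01)
      qed
      also have "\<dots> = (\<integral>\<^sup>+x. \<integral>\<^sup>+y. (case (x, y) of (x, y) \<Rightarrow> ennreal (p x) * f (x, x) + ennreal (1 - p x) * f (x, y)) \<partial>\<rho> \<partial>\<mu>)"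
        by (rule \<rho>.nn_integral_fst[symmetric]) measurable
      finally show ?thesis by simp
    qed
    have "\<pi> \<in> couplings I \<mu> \<nu>"
      unfolding couplings_def mem_Collect_eq
    proof (intro conjI)
      show "prob_space \<pi>" unfolding \<pi>_def by (rule P.prob_space_distr) measurable
      show "sets \<pi> = sets ?W" by (simp add: \<pi>_def)
      then have [measurable_cong]: "sets \<pi> = sets ?W" .
      show "distr \<pi> (euclid I) fst = \<mu>"
      proof (rule measure_eqI)
        fix A assume "A \<in> sets (distr \<pi> (euclid I) fst)"
        then have [measurable]: "A \<in> sets (euclid I)" by simp
        have "emeasure (distr \<pi> (euclid I) fst) A = (\<integral>\<^sup>+w. indicator A w \<partial>distr \<pi> (euclid I) fst)" by simp
        also have "\<dots> = (\<integral>\<^sup>+w. indicator A (fst w) \<partial>\<pi>)" by (rule nn_integral_distr) measurable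
        also have "\<dots> = (\<integral>\<^sup>+x. \<integral>\<^sup>+y. ennreal (p x) * indicator A x + ennreal (1 - p x) * indicator A x \<partial>\<rho> \<partial>\<mu>)"
          by (subst int\<pi>) auto
        also have "\<dots> = (\<integral>\<^sup>+x. indicator A x \<partial>\<mu>)"
          using p01 by (intro nn_integral_cong) (auto simp: \<rho>.emeasure_space_1 distrib_right[symmetric] ennreal_plus[symmetric] simp del: ennreal_plus)
        finally show "emeasure (distr \<pi> (euclid I) fst) A = emeasure \<mu> A" by simp
      qed (simp add: sets)
      show "distr \<pi> (euclid I) snd = \<nu>"
      proof (rule measure_eqI)
        fix A assume "A \<in> sets (distr \<pi> (euclid I) snd)"
        then have [measurable]: "A \<in> sets (euclid I)" by simp
        have "emeasure (distr \<pi> (euclid I) snd) A = (\<integral>\<^sup>+w. indicator A w \<partial>distr \<pi> (euclid I) snd)" by simp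
        also have "\<dots> = (\<integral>\<^sup>+w. indicator A (snd w) \<partial>\<pi>)" by (rule nn_integral_distr) measurable
        also have "\<dots> = (\<integral>\<^sup>+x. \<integral>\<^sup>+y. ennreal (p x) * indicator A x + ennreal (1 - p x) * indicator A y \<partial>\<rho> \<partial>\<mu>)"
          by (subst int\<pi>) auto
        also have "\<dots> = (\<integral>\<^sup>+x. ennreal (p x) * indicator A x + ennreal (1 - p x) * emeasure \<rho> A \<partial>\<mu>)"
          by (intro nn_integral_cong) (simp add: nn_integral_add nn_integral_cmult \<rho>.emeasure_space_1)
        also have "\<dots> = (\<integral>\<^sup>+x. ennreal (p x) * indicator A x \<partial>\<mu>) + ennreal m * emeasure \<rho> A"
          by (simp add: nn_integral_add nn_integral_multc nm)
        also have "ennreal m * emeasure \<rho> A = (\<integral>\<^sup>+x. ennreal (1 - q x) * indicator A x \<partial>\<nu>)"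
          using \<rho>int[of "indicator A"] by simp
        also have "(\<integral>\<^sup>+x. ennreal (p x) * indicator A x \<partial>\<mu>) = (\<integral>\<^sup>+x. ennreal (q x) * indicator A x \<partial>\<nu>)"
          by (rule pq_int) measurable
        also have "\<dots> + (\<integral>\<^sup>+x. ennreal (1 - q x) * indicator A x \<partial>\<nu>) = (\<integral>\<^sup>+x. ennreal (q x) * indicator A x + ennreal (1 - q x) * indicator A x \<partial>\<nu>)"
          by (rule nn_integral_add[symmetric]) measurable
        also have "\<dots> = (\<integral>\<^sup>+x. indicator A x \<partial>\<nu>)"
          using q01 by (intro nn_integral_cong) (auto simp: distrib_right[symmetric] ennreal_plus[symmetric] simp del: ennreal_plus)
        finally show "emeasure (distr \<pi> (euclid I) snd) A = emeasure \<nu> A" by simp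
      qed (simp add: sets)
    qed
    then have "wasserstein1 I \<mu> \<nu> \<le> (\<integral>\<^sup>+ (u, v). ennreal (L2_set (\<lambda>i. u i - v i) I) \<partial>\<pi>)"
      unfolding wasserstein1_def by (rule INF_lower)
    also have "\<dots> = (\<integral>\<^sup>+x. \<integral>\<^sup>+y. ennreal (p x) * ennreal (L2_set (\<lambda>i. x i - x i) I) + ennreal (1 - p x) * ennreal (L2_set (\<lambda>i. x i - y i) I) \<partial>\<rho> \<partial>\<mu>)"
      using L2_set_diff_measurable[of I] by (subst int\<pi>) (auto simp: split_beta')
    also have "\<dots> \<le> (\<integral>\<^sup>+x. \<integral>\<^sup>+y. ennreal (1 - p x) * ennreal (?N x) + ennreal (1 - p x) * ennreal (?N y) \<partial>\<rho> \<partial>\<mu>)"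
    proof (intro nn_integral_mono)
      fix x y
      have "L2_set (\<lambda>i. x i - x i) I = 0" by (simp add: L2_set_def)
      moreover have "ennreal (L2_set (\<lambda>i. x i - y i) I) \<le> ennreal (?N x) + ennreal (?N y)"
        using L2_set_diff_le[of x y I] by (simp add: ennreal_leI flip: ennreal_plus)
      then have "ennreal (1 - p x) * ennreal (L2_set (\<lambda>i. x i - y i) I) \<le> ennreal (1 - p x) * (ennreal (?N x) + ennreal (?N y))"
        by (rule mult_left_mono) simp
      ultimately show "ennreal (p x) * ennreal (L2_set (\<lambda>i. x i - x i) I) + ennreal (1 - p x) * ennreal (L2_set (\<lambda>i. x i - y i) I)
        \<le> ennreal (1 - p x) * ennreal (?N x) + ennreal (1 - p x) * ennreal (?N y)" by (simp add: distrib_left)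
    qed
    also have "\<dots> = (\<integral>\<^sup>+x. ennreal (1 - p x) * ennreal (?N x) + ennreal (1 - p x) * (\<integral>\<^sup>+y. ennreal (?N y) \<partial>\<rho>) \<partial>\<mu>)"
      by (intro nn_integral_cong) (simp add: nn_integral_add nn_integral_cmult \<rho>.emeasure_space_1)
    also have "\<dots> = cost1 + ennreal m * (\<integral>\<^sup>+y. ennreal (?N y) \<partial>\<rho>)"
      by (simp add: nn_integral_add nn_integral_multc nm cost1_def)
    also have "ennreal m * (\<integral>\<^sup>+y. ennreal (?N y) \<partial>\<rho>) = cost2"
      unfolding cost2_def by (rule \<rho>int) measurable
    also have "cost1 + cost2 \<le> ennreal D + ennreal D" using c1 c2 by (rule add_mono)
    also have "\<dots> = ennreal (2 * D)" using D0 by (simp flip: ennreal_plus)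
    finally show ?thesis .
  qed
qed

section \<open>Posteriors under a bounded likelihood\<close>

lemma posterior_laws:
  assumes "prob_space \<mu>" and g: "g \<in> borel_measurable \<mu>" "\<forall>u\<in>space \<mu>. 0 \<le> g u \<and> g u \<le> B"
    and Z: "0 < (\<integral>u. g u \<partial>\<mu>)"
  shows "prob_space (posterior g \<mu>)" "sets (posterior g \<mu>) = sets \<mu>"
    and "h \<in> borel_measurable \<mu> \<Longrightarrow> (\<integral>u. h u \<partial>posterior g \<mu>) = (\<integral>u. g u * h u \<partial>\<mu>) / (\<integral>u. g u \<partial>\<mu>)"
    and "integrable \<mu> h \<Longrightarrow> integrable (posterior g \<mu>) (h :: _ \<Rightarrow> real)"
    and "integrable \<mu> h \<Longrightarrow> integrable \<mu> (\<lambda>u. g u * h u)"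
proof -
  interpret prob_space \<mu> by fact
  let ?Z = "\<integral>u. g u \<partial>\<mu>"
  note [measurable] = g(1)
  have gB: "AE u in \<mu>. norm (g u) \<le> B" using g by (intro AE_I2) auto
  have ig: "integrable \<mu> g" by (rule integrable_const_bound[OF gB g(1)])
  have n: "AE u in \<mu>. 0 \<le> g u / ?Z" using g Z by (intro AE_I2) auto
  have m: "(\<lambda>u. g u / ?Z) \<in> borel_measurable \<mu>" by measurable
  show "sets (posterior g \<mu>) = sets \<mu>" by (simp add: posterior_def)
  show "prob_space (posterior g \<mu>)"
  proof (rule prob_spaceI)
    have "emeasure (posterior g \<mu>) (space (posterior g \<mu>)) = (\<integral>\<^sup>+u. ennreal (g u / ?Z) \<partial>\<mu>)"
      unfolding posterior_def by (subst emeasure_density) (auto intro!: nn_integral_cong)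
    also have "\<dots> = ennreal (\<integral>u. g u / ?Z \<partial>\<mu>)" using ig n by (intro nn_integral_eq_integral) auto
    also have "\<dots> = 1" using Z by simp
    finally show "emeasure (posterior g \<mu>) (space (posterior g \<mu>)) = 1" .
  qed
  show "(\<integral>u. h u \<partial>posterior g \<mu>) = (\<integral>u. g u * h u \<partial>\<mu>) / ?Z" if "h \<in> borel_measurable \<mu>"
    unfolding posterior_def by (subst integral_density[OF that m n]) simp
  show igh: "integrable \<mu> (\<lambda>u. g u * h u)" if "integrable \<mu> h" for h :: "'a \<Rightarrow> real"
  proof (rule Bochner_Integration.integrable_bound)
    show "integrable \<mu> (\<lambda>u. B * h u)" using that by simp
    show "(\<lambda>u. g u * h u) \<in> borel_measurable \<mu>" using that by measurable
    show "AE u in \<mu>. norm (g u * h u) \<le> norm (B * h u)"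
      using g by (intro AE_I2) (auto simp: abs_mult intro!: mult_right_mono intro: order_trans[OF _ abs_ge_self])
  qed
  show "integrable (posterior g \<mu>) h" if "integrable \<mu> h"
  proof -
    have "integrable \<mu> (\<lambda>u. (g u / ?Z) *\<^sub>R h u)" using igh[OF that] by simp
    then show ?thesis unfolding posterior_def using that by (subst integrable_density[OF _ m n]) auto
  qed
qed

text \<open>A posterior integral is a quotient: the numerator integrates \<open>g\<close> times the
  norm restricted to a set, the denominator integrates \<open>g\<close>. After division by
  \<open>B\<close> both integrands have the growth allowed in \<open>close\<close>, so exchanging
  \<open>\<mu>\<close> for \<open>\<nu>\<close> costs \<open>B * e\<close> in each. The assumption
  \<open>small\<close> keeps the denominator of \<open>\<mu>\<close> above half of that of
  \<open>\<nu>\<close>.\<close>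

lemma posterior_wasserstein1_le:
  fixes \<mu> \<nu> :: "('i \<Rightarrow> real) measure"
  assumes pr: "prob_space \<mu>" "prob_space \<nu>" and sets: "sets \<mu> = sets (euclid I)" "sets \<nu> = sets (euclid I)"
    and int: "integrable \<mu> (\<lambda>u. L2_set u I)" "integrable \<nu> (\<lambda>u. L2_set u I)"
    and g: "g \<in> borel_measurable (euclid I)" "\<And>u. u \<in> space (euclid I) \<Longrightarrow> 0 \<le> g u" "\<And>u. u \<in> space (euclid I) \<Longrightarrow> g u \<le> B" "1 \<le> B"
    and Z: "0 < (\<integral>u. g u \<partial>\<nu>)"
    and close: "\<And>H. H \<in> borel_measurable (euclid I) \<Longrightarrow> (\<And>u. u \<in> space (euclid I) \<Longrightarrow> \<bar>H u\<bar> \<le> 1 + L2_set u I) \<Longrightarrow>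
      \<bar>(\<integral>u. H u \<partial>\<mu>) - (\<integral>u. H u \<partial>\<nu>)\<bar> \<le> e"
    and small: "B * e \<le> (\<integral>u. g u \<partial>\<nu>) / 2"
  shows "0 < (\<integral>u. g u \<partial>\<mu>)"
    and "wasserstein1 I (posterior g \<mu>) (posterior g \<nu>)
      \<le> ennreal (2 * (2 * B * e / (\<integral>u. g u \<partial>\<nu>) + 2 * B\<^sup>2 * (\<integral>u. L2_set u I \<partial>\<nu>) * e / (\<integral>u. g u \<partial>\<nu>)\<^sup>2))"
proof -
  let ?N = "\<lambda>u. L2_set u I"
  note [measurable_cong] = sets
  note [measurable] = g(1)
  have sp: "space \<mu> = space (euclid I)" "space \<nu> = space (euclid I)" using sets by (auto dest: sets_eq_imp_space_eq)
  define Z where "Z = (\<integral>u. g u \<partial>\<nu>)"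
  define Y where "Y = (\<integral>u. g u \<partial>\<mu>)"
  define m where "m = (\<integral>u. ?N u \<partial>\<nu>)"
  have Z0: "0 < Z" using Z by (simp add: Z_def)
  have e0: "0 \<le> e" using close[of "\<lambda>_. 0"] by simp
  have m0: "0 \<le> m" unfolding m_def by (intro Bochner_Integration.integral_nonneg) simp
  have scaled: "\<bar>(\<integral>u. H u \<partial>\<mu>) - (\<integral>u. H u \<partial>\<nu>)\<bar> \<le> B * e"
    if [measurable]: "H \<in> borel_measurable (euclid I)" and "\<And>u. u \<in> space (euclid I) \<Longrightarrow> \<bar>H u\<bar> \<le> B * (1 + ?N u)" for H
  proof -
    have "\<bar>(\<integral>u. H u / B \<partial>\<mu>) - (\<integral>u. H u / B \<partial>\<nu>)\<bar> \<le> e"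
    proof (rule close)
      show "\<bar>H u / B\<bar> \<le> 1 + ?N u" if "u \<in> space (euclid I)" for u
        using \<open>\<And>u. u \<in> space (euclid I) \<Longrightarrow> \<bar>H u\<bar> \<le> B * (1 + ?N u)\<close>[OF that] g(4) by (simp add: abs_div field_simps)
    qed measurable
    then have "\<bar>((\<integral>u. H u \<partial>\<mu>) - (\<integral>u. H u \<partial>\<nu>)) / B\<bar> \<le> e" by (simp add: diff_divide_distrib)
    then show ?thesis using g(4) by (simp add: abs_div field_simps)
  qed
  have YZ: "\<bar>Y - Z\<bar> \<le> B * e" unfolding Y_def Z_def
  proof (rule scaled)
    fix u assume u: "u \<in> space (euclid I)"
    have "\<bar>g u\<bar> \<le> B * 1" using g(2,3)[OF u] by simp
    also have "\<dots> \<le> B * (1 + ?N u)" using g(4) by (intro mult_left_mono) auto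
    finally show "\<bar>g u\<bar> \<le> B * (1 + ?N u)" .
  qed measurable
  then have Y2: "Z / 2 \<le> Y" using small unfolding Z_def[symmetric] by (simp add: abs_le_iff)
  then have Y0: "0 < Y" using Z0 by simp
  then show "0 < (\<integral>u. g u \<partial>\<mu>)" by (simp add: Y_def)
  have gm: "g \<in> borel_measurable \<mu>" "g \<in> borel_measurable \<nu>" by measurable
  have gb: "\<forall>u\<in>space \<mu>. 0 \<le> g u \<and> g u \<le> B" "\<forall>u\<in>space \<nu>. 0 \<le> g u \<and> g u \<le> B" using g(2,3) sp by auto
  note pm = posterior_laws[OF pr(1) gm(1) gb(1) Y0[unfolded Y_def]]
  note pn = posterior_laws[OF pr(2) gm(2) gb(2) Z]
  have "wasserstein1 I (posterior g \<mu>) (posterior g \<nu>) \<le> ennreal (2 * (2 * B * e / Z + 2 * B\<^sup>2 * m * e / Z\<^sup>2))"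
  proof (rule wasserstein1_le)
    show "prob_space (posterior g \<mu>)" "prob_space (posterior g \<nu>)" using pm pn by auto
    show "sets (posterior g \<mu>) = sets (euclid I)" "sets (posterior g \<nu>) = sets (euclid I)" using pm pn sets by auto
    show "integrable (posterior g \<mu>) ?N" "integrable (posterior g \<nu>) ?N" using pm(4) pn(4) int by auto
    fix A assume [measurable]: "A \<in> sets (euclid I)"
    define G where "G u = g u * (indicator A u * ?N u)" for u
    have Gm [measurable]: "G \<in> borel_measurable (euclid I)" unfolding G_def by measurable
    have GN: "0 \<le> G u" "G u \<le> B * ?N u" if u: "u \<in> space (euclid I)" for u
      using g(2,3)[OF u] g(4) by (auto simp: G_def split: split_indicator intro!: mult_right_mono)
    have GB: "\<bar>(\<integral>u. G u \<partial>\<mu>) - (\<integral>u. G u \<partial>\<nu>)\<bar> \<le> B * e"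
    proof (rule scaled[OF Gm])
      fix u assume u: "u \<in> space (euclid I)"
      have "B * ?N u \<le> B * (1 + ?N u)" using g(4) by (intro mult_left_mono) auto
      then show "\<bar>G u\<bar> \<le> B * (1 + ?N u)" using GN[OF u] by linarith
    qed
    have Gn: "0 \<le> (\<integral>u. G u \<partial>\<nu>)" "(\<integral>u. G u \<partial>\<nu>) \<le> B * m"
    proof -
      show "0 \<le> (\<integral>u. G u \<partial>\<nu>)" using GN sp by (intro Bochner_Integration.integral_nonneg) auto
      have "\<bar>\<integral>u. G u \<partial>\<nu>\<bar> \<le> (\<integral>u. B * ?N u \<partial>\<nu>)"
      proof (rule abs_integral_le(2))
        show "integrable \<nu> (\<lambda>u. B * ?N u)" using int by simp
        show "G \<in> borel_measurable \<nu>" by measurable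
        show "\<bar>G u\<bar> \<le> B * ?N u" if "u \<in> space \<nu>" for u using GN[of u] that sp by simp
      qed
      then show "(\<integral>u. G u \<partial>\<nu>) \<le> B * m" by (simp add: m_def)
    qed
    have iA: "(\<lambda>u. indicator A u * ?N u) \<in> borel_measurable \<mu>" "(\<lambda>u. indicator A u * ?N u) \<in> borel_measurable \<nu>" by measurable
    have "(\<integral>u. indicator A u * ?N u \<partial>posterior g \<mu>) - (\<integral>u. indicator A u * ?N u \<partial>posterior g \<nu>)
      = (\<integral>u. G u \<partial>\<mu>) / Y - (\<integral>u. G u \<partial>\<nu>) / Z"
      using pm(3)[OF iA(1)] pn(3)[OF iA(2)] by (simp add: G_def Y_def Z_def)
    \<comment> \<open>One error at a time: first the numerator over the denominator
      \<open>Y\<close>, then the denominator with the numerator of \<open>\<nu>\<close>, which is at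
      most \<open>B * m\<close>.\<close>
    also have "\<dots> = ((\<integral>u. G u \<partial>\<mu>) - (\<integral>u. G u \<partial>\<nu>)) / Y + (\<integral>u. G u \<partial>\<nu>) * (Z - Y) / (Y * Z)"
      using Y0 Z0 by (simp add: field_simps)
    also have "\<bar>\<dots>\<bar> \<le> B * e / Y + (B * m) * (B * e) / (Y * Z)"
    proof (intro order_trans[OF abs_triangle_ineq] add_mono)
      show "\<bar>((\<integral>u. G u \<partial>\<mu>) - (\<integral>u. G u \<partial>\<nu>)) / Y\<bar> \<le> B * e / Y"
        using GB Y0 by (simp add: abs_div divide_right_mono)
      have "\<bar>(\<integral>u. G u \<partial>\<nu>) * (Z - Y)\<bar> \<le> (B * m) * (B * e)"
        unfolding abs_mult using Gn YZ e0 g(4) by (intro mult_mono) (auto simp: abs_minus_commute)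
      then show "\<bar>(\<integral>u. G u \<partial>\<nu>) * (Z - Y) / (Y * Z)\<bar> \<le> (B * m) * (B * e) / (Y * Z)"
        using Y0 Z0 by (simp add: abs_div divide_right_mono abs_mult)
    qed
    also have "\<dots> \<le> B * e / (Z / 2) + (B * m) * (B * e) / (Z / 2 * Z)"
      using Y2 Y0 Z0 e0 g(4) m0 by (intro add_mono divide_left_mono mult_right_mono) auto
    also have "\<dots> = 2 * B * e / Z + 2 * B\<^sup>2 * m * e / Z\<^sup>2" by (simp add: power2_eq_square mult_ac)
    finally show "\<bar>(\<integral>u. indicator A u * ?N u \<partial>posterior g \<mu>) - (\<integral>u. indicator A u * ?N u \<partial>posterior g \<nu>)\<bar>
      \<le> 2 * B * e / Z + 2 * B\<^sup>2 * m * e / Z\<^sup>2" .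
  qed
  then show "wasserstein1 I (posterior g \<mu>) (posterior g \<nu>)
      \<le> ennreal (2 * (2 * B * e / (\<integral>u. g u \<partial>\<nu>) + 2 * B\<^sup>2 * (\<integral>u. L2_set u I \<partial>\<nu>) * e / (\<integral>u. g u \<partial>\<nu>)\<^sup>2))"
    by (simp add: Z_def m_def)
qed

section \<open>Lipschitz functions\<close>

text \<open>The sum of absolute differences replaces the Euclidean norm. On a finite index set this
  changes only the constant, and sums and compositions can then be estimated coordinatewise.\<close>

definition lipschitz1 :: "'i set \<Rightarrow> (('i \<Rightarrow> real) \<Rightarrow> real) \<Rightarrow> bool" where
  "lipschitz1 I f \<longleftrightarrow> (\<exists>C\<ge>0. \<forall>u\<in>space (euclid I). \<forall>v\<in>space (euclid I).
     \<bar>f u - f v\<bar> \<le> C * (\<Sum>i\<in>I. \<bar>u i - v i\<bar>))"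

lemma space_euclid: "space (euclid I) = (\<Pi>\<^sub>E i\<in>I. UNIV)"
  by (simp add: euclid_def space_PiM)

text \<open>A Lipschitz function is the infimum of the cones based at the rational points.\<close>

lemma lipschitz1_measurable:
  assumes fin: "finite I" and f: "lipschitz1 I f"
  shows "f \<in> borel_measurable (euclid I)"
proof -
  obtain C where C0: "0 \<le> C" and C: "\<And>u v. u \<in> space (euclid I) \<Longrightarrow> v \<in> space (euclid I) \<Longrightarrow> \<bar>f u - f v\<bar> \<le> C * (\<Sum>i\<in>I. \<bar>u i - v i\<bar>)"
    using f by (auto simp: lipschitz1_def)
  define D where "D = (\<Pi>\<^sub>E i\<in>I. (\<rat> :: real set))"
  have Dc: "countable D" unfolding D_def using fin countable_rat by (intro countable_PiE) auto
  have DI: "d \<in> space (euclid I)" if "d \<in> D" for d using that by (auto simp: D_def space_euclid PiE_def)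
  have Dne: "D \<noteq> {}" unfolding D_def by (simp add: PiE_eq_empty_iff) (metis Rats_0 empty_iff)
  define h where "h d u = f d + C * (\<Sum>i\<in>I. \<bar>u i - d i\<bar>)" for d u
  have lower: "f u \<le> h d u" if "d \<in> D" "u \<in> space (euclid I)" for d u
    using C[OF that(2) DI[OF that(1)]] by (simp add: h_def abs_le_iff)
  have bdd: "bdd_below ((\<lambda>d. h d u) ` D)" if "u \<in> space (euclid I)" for u
    using lower[OF _ that] by (intro bdd_belowI2)
  have "(\<lambda>u. INF d\<in>D. h d u) \<in> borel_measurable (euclid I)"
  proof (rule borel_measurable_cINF[OF Dc _ bdd])
    fix d show "h d \<in> borel_measurable (euclid I)" unfolding h_def euclid_def by measurable
  qed
  moreover have "(INF d\<in>D. h d u) = f u" if u: "u \<in> space (euclid I)" for u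
  proof (rule antisym)
    show "f u \<le> (INF d\<in>D. h d u)" using Dne lower u by (intro cINF_greatest)
    show "(INF d\<in>D. h d u) \<le> f u"
    proof (rule field_le_epsilon)
      fix e :: real assume e: "0 < e"
      \<comment> \<open>Chosen so that a rational point within \<open>\<delta>\<close> in each
        coordinate changes the cone by at most \<open>e\<close>; the added ones keep
        \<open>K\<close> positive when \<open>C = 0\<close> or \<open>I\<close> is empty.\<close>
      define K where "K = 2 * (C + 1) * (real (card I) + 1)"
      have K: "0 < K" using C0 by (simp add: K_def)
      define \<delta> where "\<delta> = e / K"
      have \<delta>: "0 < \<delta>" using e K by (simp add: \<delta>_def)
      have "\<exists>q\<in>\<rat>. u i - \<delta> < q \<and> q < u i" for i using Rats_dense_in_real[of "u i - \<delta>" "u i"] \<delta> by auto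
      then obtain q where q: "\<And>i. q i \<in> \<rat>" "\<And>i. u i - \<delta> < q i" "\<And>i. q i < u i" by metis
      define d where "d = (\<lambda>i\<in>I. q i)"
      have dD: "d \<in> D" using q by (auto simp: d_def D_def)
      have S: "(\<Sum>i\<in>I. \<bar>u i - d i\<bar>) \<le> real (card I) * \<delta>"
      proof -
        have "\<bar>u i - d i\<bar> \<le> \<delta>" if "i \<in> I" for i using q(2,3)[of i] that by (simp add: d_def)
        then have "(\<Sum>i\<in>I. \<bar>u i - d i\<bar>) \<le> (\<Sum>i\<in>I. \<delta>)" by (rule sum_mono)
        then show ?thesis by simp
      qed
      have S0: "0 \<le> (\<Sum>i\<in>I. \<bar>u i - d i\<bar>)" by (simp add: sum_nonneg)
      have "(INF d\<in>D. h d u) \<le> h d u" using bdd[OF u] dD by (rule cINF_lower)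
      also have "\<dots> \<le> f u + 2 * (C * (\<Sum>i\<in>I. \<bar>u i - d i\<bar>))"
        using C[OF u DI[OF dD]] unfolding h_def abs_le_iff by linarith
      also have "\<dots> \<le> f u + 2 * ((C + 1) * ((real (card I) + 1) * \<delta>))"
      proof -
        have "(\<Sum>i\<in>I. \<bar>u i - d i\<bar>) \<le> (real (card I) + 1) * \<delta>" using S \<delta> by (simp add: distrib_right)
        then have "C * (\<Sum>i\<in>I. \<bar>u i - d i\<bar>) \<le> (C + 1) * ((real (card I) + 1) * \<delta>)"
          using C0 S0 by (intro mult_mono) auto
        then show ?thesis by simp
      qed
      also have "\<dots> = f u + K * \<delta>" by (simp add: K_def)
      also have "\<dots> = f u + e" using K by (simp add: \<delta>_def)
      finally show "(INF d\<in>D. h d u) \<le> f u + e" .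
    qed
  qed
  ultimately show ?thesis by (subst measurable_cong[where g = "\<lambda>u. INF d\<in>D. h d u"]) auto
qed

lemma lipschitz1_growth:
  assumes "lipschitz1 I f"
  shows "\<exists>c\<ge>0. \<forall>u\<in>space (euclid I). \<bar>f u\<bar> \<le> c * (1 + (\<Sum>i\<in>I. \<bar>u i\<bar>))"
proof -
  obtain C where C0: "0 \<le> C" and C: "\<And>u v. u \<in> space (euclid I) \<Longrightarrow> v \<in> space (euclid I) \<Longrightarrow> \<bar>f u - f v\<bar> \<le> C * (\<Sum>i\<in>I. \<bar>u i - v i\<bar>)"
    using assms by (auto simp: lipschitz1_def)
  define o' where "o' = (\<lambda>i\<in>I. 0 :: real)"
  have o: "o' \<in> space (euclid I)" by (simp add: o'_def space_euclid)
  show ?thesis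
  proof (intro exI[of _ "\<bar>f o'\<bar> + C"] conjI ballI)
    fix u assume u: "u \<in> space (euclid I)"
    have s: "(\<Sum>i\<in>I. \<bar>u i - o' i\<bar>) = (\<Sum>i\<in>I. \<bar>u i\<bar>)" by (intro sum.cong) (auto simp: o'_def)
    have s0: "0 \<le> (\<Sum>i\<in>I. \<bar>u i\<bar>)" by (simp add: sum_nonneg)
    have "\<bar>f u\<bar> \<le> \<bar>f o'\<bar> + C * (\<Sum>i\<in>I. \<bar>u i\<bar>)" using C[OF u o] unfolding s by linarith
    also have "\<dots> \<le> (\<bar>f o'\<bar> + C) * (1 + (\<Sum>i\<in>I. \<bar>u i\<bar>))" using C0 s0 by (simp add: algebra_simps)
    finally show "\<bar>f u\<bar> \<le> (\<bar>f o'\<bar> + C) * (1 + (\<Sum>i\<in>I. \<bar>u i\<bar>))" .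
  qed (use C0 in simp)
qed

section \<open>Full support of the standard Gaussian law\<close>

lemma emeasure_std_normal_Icc_pos:
  assumes "x < y"
  shows "0 < emeasure std_normal_distribution {x..y}"
proof (rule ccontr)
  assume "\<not> 0 < emeasure std_normal_distribution {x..y}"
  then have "(\<integral>\<^sup>+t. ennreal (std_normal_density t) * indicator {x..y} t \<partial>lborel) = 0"
    by (simp add: emeasure_density not_less)
  then have "AE t in lborel. ennreal (std_normal_density t) * indicator {x..y} t = 0"
    by (subst (asm) nn_integral_0_iff_AE) auto
  then have "AE t in lborel. t \<notin> {x..y}"
  proof eventually_elim
    case (elim t)
    have "0 < std_normal_density t" by (simp add: normal_density_pos)
    with elim show ?case by (auto simp: indicator_def ennreal_eq_0_iff split: if_splits)
  qed
  then have "{x..y} \<in> null_sets lborel" by (subst AE_iff_null_sets) auto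
  then have "emeasure lborel {x..y} = 0" by auto
  with assms show False by simp
qed

text \<open>A value \<open>f z \<noteq> 0\<close> persists on a box around \<open>z\<close>, and
  boxes have positive Gaussian measure. The passage from almost everywhere to everywhere is what
  makes the reduction to the range of a covariance valid for every choice of the weights.\<close>

lemma std_gaussian_AE_zero:
  assumes fin: "finite I" and f: "lipschitz1 I f" and AE: "AE z in std_gaussian I. f z = 0"
    and z: "z \<in> space (euclid I)"
  shows "f z = 0"
proof (rule ccontr)
  assume nz: "f z \<noteq> 0"
  obtain C where C0: "0 \<le> C" and C: "\<And>u v. u \<in> space (euclid I) \<Longrightarrow> v \<in> space (euclid I) \<Longrightarrow> \<bar>f u - f v\<bar> \<le> C * (\<Sum>i\<in>I. \<bar>u i - v i\<bar>)"
    using f by (auto simp: lipschitz1_def)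
  define K where "K = 2 * (C + 1) * (real (card I) + 1)"
  have K: "0 < K" using C0 by (simp add: K_def)
  \<comment> \<open>Within a box of this half-width \<open>f\<close> differs from \<open>f z\<close>
    by at most \<open>\<bar>f z\<bar> / 2\<close>.\<close>
  define r where "r = \<bar>f z\<bar> / K"
  have r: "0 < r" using nz K by (simp add: r_def)
  define box where "box = (\<Pi>\<^sub>E i\<in>I. {z i - r..z i + r})"
  interpret product_sigma_finite "\<lambda>_. std_normal_distribution"
    by (unfold product_sigma_finite_def) (blast intro: prob_space_imp_sigma_finite prob_space_normal_density zero_less_one)
  have boxs: "box \<in> sets (std_gaussian I)" unfolding box_def using fin by (intro sets_PiM_I_finite) auto
  have "emeasure (std_gaussian I) box = (\<Prod>i\<in>I. emeasure std_normal_distribution {z i - r..z i + r})"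
    unfolding box_def by (rule emeasure_PiM[OF fin]) simp
  also have "\<dots> \<noteq> 0" using emeasure_std_normal_Icc_pos[of "z _ - r" "z _ + r"] r fin by (simp add: prod_zero_iff less_imp_neq zero_less_iff_neq_zero)
  finally have pos: "emeasure (std_gaussian I) box \<noteq> 0" .
  have "f u \<noteq> 0" if u: "u \<in> box" for u
  proof -
    have us: "u \<in> space (euclid I)" using u by (auto simp: box_def space_euclid PiE_def)
    have "(\<Sum>i\<in>I. \<bar>u i - z i\<bar>) \<le> (\<Sum>i\<in>I. r)"
    proof (rule sum_mono)
      fix i assume "i \<in> I"
      then have "u i \<in> {z i - r..z i + r}" using u by (auto simp: box_def PiE_def Pi_def)
      then show "\<bar>u i - z i\<bar> \<le> r" by (simp add: abs_le_iff)
    qed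
    also have "\<dots> \<le> (real (card I) + 1) * r" using r by (simp add: distrib_right)
    finally have S: "(\<Sum>i\<in>I. \<bar>u i - z i\<bar>) \<le> (real (card I) + 1) * r" .
    have "\<bar>f u - f z\<bar> \<le> C * (\<Sum>i\<in>I. \<bar>u i - z i\<bar>)" by (rule C[OF us z])
    also have "\<dots> \<le> (C + 1) * ((real (card I) + 1) * r)" using S C0 by (intro mult_mono) (auto simp: sum_nonneg)
    also have "\<dots> = K * r / 2" by (simp add: K_def)
    also have "\<dots> = \<bar>f z\<bar> / 2" using K by (simp add: r_def)
    also have "\<dots> < \<bar>f z\<bar>" using nz by simp
    finally show ?thesis by auto
  qed
  then have "AE u in std_gaussian I. u \<notin> box" using AE by (auto elim!: eventually_mono)
  then have "box \<in> null_sets (std_gaussian I)" using boxs by (subst AE_iff_null_sets)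
  then show False using pos by auto
qed

lemma lipschitz_map_component:
  assumes fin: "finite I" "finite T" and F: "lipschitz_map I T F" and j: "j \<in> T"
  shows "lipschitz1 I (\<lambda>u. F u j)"
proof -
  obtain C where C: "\<And>u v. u \<in> space (euclid I) \<Longrightarrow> v \<in> space (euclid I) \<Longrightarrow> L2_set (\<lambda>j. F u j - F v j) T \<le> C * L2_set (\<lambda>i. u i - v i) I"
    using F by (auto simp: lipschitz_map_def)
  show ?thesis unfolding lipschitz1_def
  proof (intro exI[of _ "\<bar>C\<bar>"] conjI ballI)
    fix u v assume uv: "u \<in> space (euclid I)" "v \<in> space (euclid I)"
    have "\<bar>F u j - F v j\<bar> \<le> L2_set (\<lambda>j. \<bar>F u j - F v j\<bar>) T" using fin j by (intro member_le_L2_set) auto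
    also have "\<dots> = L2_set (\<lambda>j. F u j - F v j) T" by (simp add: L2_set_def)
    also have "\<dots> \<le> C * L2_set (\<lambda>i. u i - v i) I" by (rule C[OF uv])
    also have "\<dots> \<le> \<bar>C\<bar> * (\<Sum>i\<in>I. \<bar>u i - v i\<bar>)" by (intro mult_mono L2_set_le_sum_abs) auto
    finally show "\<bar>F u j - F v j\<bar> \<le> \<bar>C\<bar> * (\<Sum>i\<in>I. \<bar>u i - v i\<bar>)" .
  qed simp
qed

lemma lipschitz_functional_lipschitz1:
  assumes "lipschitz_functional I g"
  shows "lipschitz1 I g"
proof -
  obtain C where C: "\<And>u v. u \<in> space (euclid I) \<Longrightarrow> v \<in> space (euclid I) \<Longrightarrow> \<bar>g u - g v\<bar> \<le> C * L2_set (\<lambda>i. u i - v i) I"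
    using assms by (auto simp: lipschitz_functional_def)
  show ?thesis unfolding lipschitz1_def
  proof (intro exI[of _ "\<bar>C\<bar>"] conjI ballI)
    fix u v assume uv: "u \<in> space (euclid I)" "v \<in> space (euclid I)"
    have "\<bar>g u - g v\<bar> \<le> C * L2_set (\<lambda>i. u i - v i) I" by (rule C[OF uv])
    also have "\<dots> \<le> \<bar>C\<bar> * (\<Sum>i\<in>I. \<bar>u i - v i\<bar>)" by (intro mult_mono L2_set_le_sum_abs) auto
    finally show "\<bar>g u - g v\<bar> \<le> \<bar>C\<bar> * (\<Sum>i\<in>I. \<bar>u i - v i\<bar>)" .
  qed simp
qed

lemma lipschitz1_sum:
  assumes "finite A" "\<And>s. s \<in> A \<Longrightarrow> lipschitz1 I (f s)"
  shows "lipschitz1 I (\<lambda>u. \<Sum>s\<in>A. w s * f s u)"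
proof -
  obtain C where C: "\<And>s. s \<in> A \<Longrightarrow> 0 \<le> C s" "\<And>s u v. s \<in> A \<Longrightarrow> u \<in> space (euclid I) \<Longrightarrow> v \<in> space (euclid I) \<Longrightarrow> \<bar>f s u - f s v\<bar> \<le> C s * (\<Sum>i\<in>I. \<bar>u i - v i\<bar>)"
    using assms(2) unfolding lipschitz1_def by metis
  show ?thesis unfolding lipschitz1_def
  proof (intro exI[of _ "\<Sum>s\<in>A. \<bar>w s\<bar> * C s"] conjI ballI)
    fix u v assume uv: "u \<in> space (euclid I)" "v \<in> space (euclid I)"
    have "\<bar>(\<Sum>s\<in>A. w s * f s u) - (\<Sum>s\<in>A. w s * f s v)\<bar> = \<bar>\<Sum>s\<in>A. w s * (f s u - f s v)\<bar>"
      by (simp add: right_diff_distrib sum_subtractf)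
    also have "\<dots> \<le> (\<Sum>s\<in>A. \<bar>w s\<bar> * (C s * (\<Sum>i\<in>I. \<bar>u i - v i\<bar>)))"
    proof (intro order_trans[OF sum_abs] sum_mono)
      fix s assume "s \<in> A"
      then show "\<bar>w s * (f s u - f s v)\<bar> \<le> \<bar>w s\<bar> * (C s * (\<Sum>i\<in>I. \<bar>u i - v i\<bar>))"
        unfolding abs_mult using C(2) uv by (intro mult_left_mono) auto
    qed
    also have "\<dots> = (\<Sum>s\<in>A. \<bar>w s\<bar> * C s) * (\<Sum>i\<in>I. \<bar>u i - v i\<bar>)" by (simp add: sum_distrib_right mult.assoc)
    finally show "\<bar>(\<Sum>s\<in>A. w s * f s u) - (\<Sum>s\<in>A. w s * f s v)\<bar> \<le> (\<Sum>s\<in>A. \<bar>w s\<bar> * C s) * (\<Sum>i\<in>I. \<bar>u i - v i\<bar>)" .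
  qed (use C(1) in \<open>auto intro!: sum_nonneg\<close>)
qed

lemma lipschitz1_compose:
  assumes f: "lipschitz1 I f" and T: "\<And>z. z \<in> space (euclid J) \<Longrightarrow> T z \<in> space (euclid I)"
    and c: "\<And>i. i \<in> I \<Longrightarrow> lipschitz1 J (\<lambda>z. T z i)" and fin: "finite I"
  shows "lipschitz1 J (\<lambda>z. f (T z))"
proof -
  obtain C where C0: "0 \<le> C" and C: "\<And>u v. u \<in> space (euclid I) \<Longrightarrow> v \<in> space (euclid I) \<Longrightarrow> \<bar>f u - f v\<bar> \<le> C * (\<Sum>i\<in>I. \<bar>u i - v i\<bar>)"
    using f by (auto simp: lipschitz1_def)
  obtain c' where c': "\<And>i. i \<in> I \<Longrightarrow> 0 \<le> c' i" "\<And>i u v. i \<in> I \<Longrightarrow> u \<in> space (euclid J) \<Longrightarrow> v \<in> space (euclid J) \<Longrightarrow> \<bar>T u i - T v i\<bar> \<le> c' i * (\<Sum>j\<in>J. \<bar>u j - v j\<bar>)"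
    using c unfolding lipschitz1_def by metis
  show ?thesis unfolding lipschitz1_def
  proof (intro exI[of _ "C * (\<Sum>i\<in>I. c' i)"] conjI ballI)
    show "0 \<le> C * (\<Sum>i\<in>I. c' i)" using C0 c'(1) by (simp add: sum_nonneg)
    fix u v assume uv: "u \<in> space (euclid J)" "v \<in> space (euclid J)"
    have "\<bar>f (T u) - f (T v)\<bar> \<le> C * (\<Sum>i\<in>I. \<bar>T u i - T v i\<bar>)" using uv by (intro C T)
    also have "\<dots> \<le> C * (\<Sum>i\<in>I. c' i * (\<Sum>j\<in>J. \<bar>u j - v j\<bar>))" using C0 c'(2) uv by (intro mult_left_mono sum_mono) auto
    also have "\<dots> = C * (\<Sum>i\<in>I. c' i) * (\<Sum>j\<in>J. \<bar>u j - v j\<bar>)" by (simp add: sum_distrib_right)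
    finally show "\<bar>f (T u) - f (T v)\<bar> \<le> C * (\<Sum>i\<in>I. c' i) * (\<Sum>j\<in>J. \<bar>u j - v j\<bar>)" .
  qed
qed

lemma lipschitz1_linear:
  assumes "finite J"
  shows "lipschitz1 J (\<lambda>z. \<Sum>j\<in>J. w j * z j)"
proof (rule lipschitz1_sum[OF assms])
  fix j assume j: "j \<in> J"
  show "lipschitz1 J (\<lambda>z. z j)" unfolding lipschitz1_def
  proof (intro exI[of _ 1] conjI ballI)
    show "\<bar>u j - v j\<bar> \<le> 1 * (\<Sum>j\<in>J. \<bar>u j - v j\<bar>)" for u v :: "'a \<Rightarrow> real"
      using member_le_sum[OF j, of "\<lambda>j. \<bar>u j - v j\<bar>"] assms by simp
  qed simp
qed

text \<open>Cauchy-Schwarz twice, in the form \<open>sq\<close>: first for the absolute values, then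
  for the squares. It brings powers up to the fourth of a function of linear growth into the quartic
  class.\<close>

lemma sum_abs_power4_le:
  fixes z :: "'i \<Rightarrow> real"
  assumes fin: "finite J"
  shows "(1 + (\<Sum>j\<in>J. \<bar>z j\<bar>)) ^ 4 \<le> (1 + real (card J)) ^ 3 * (1 + (\<Sum>j\<in>J. z j ^ 4))"
proof -
  have sq: "(1 + (\<Sum>j\<in>J. f j))\<^sup>2 \<le> (1 + real (card J)) * (1 + (\<Sum>j\<in>J. (f j)\<^sup>2))" for f :: "'i \<Rightarrow> real"
  proof -
    have 1: "(\<Sum>j\<in>J. f j)\<^sup>2 \<le> real (card J) * (\<Sum>j\<in>J. (f j)\<^sup>2)"
      using Cauchy_Schwarz_ineq_sum[of "\<lambda>_. 1" f J] by simp
    have "(\<Sum>j\<in>J. 2 * f j) \<le> (\<Sum>j\<in>J. 1 + (f j)\<^sup>2)"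
    proof (rule sum_mono)
      fix j
      have "0 \<le> (f j - 1)\<^sup>2" by simp
      then show "2 * f j \<le> 1 + (f j)\<^sup>2" by (simp add: power2_eq_square algebra_simps)
    qed
    then have 2: "2 * (\<Sum>j\<in>J. f j) \<le> real (card J) + (\<Sum>j\<in>J. (f j)\<^sup>2)" by (simp add: sum_distrib_left sum.distrib)
    have "(1 + (\<Sum>j\<in>J. f j))\<^sup>2 = 1 + 2 * (\<Sum>j\<in>J. f j) + (\<Sum>j\<in>J. f j)\<^sup>2" by (simp add: power2_sum)
    also have "\<dots> \<le> 1 + (real (card J) + (\<Sum>j\<in>J. (f j)\<^sup>2)) + real (card J) * (\<Sum>j\<in>J. (f j)\<^sup>2)" using 1 2 by linarith
    also have "\<dots> = (1 + real (card J)) * (1 + (\<Sum>j\<in>J. (f j)\<^sup>2))" by (simp add: algebra_simps)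
    finally show ?thesis .
  qed
  have "(1 + (\<Sum>j\<in>J. \<bar>z j\<bar>)) ^ 4 = ((1 + (\<Sum>j\<in>J. \<bar>z j\<bar>))\<^sup>2)\<^sup>2" by simp
  also have "\<dots> \<le> ((1 + real (card J)) * (1 + (\<Sum>j\<in>J. \<bar>z j\<bar>\<^sup>2)))\<^sup>2" by (intro power_mono sq) simp
  also have "\<dots> = (1 + real (card J))\<^sup>2 * (1 + (\<Sum>j\<in>J. (z j)\<^sup>2))\<^sup>2" by (simp add: power_mult_distrib)
  also have "\<dots> \<le> (1 + real (card J))\<^sup>2 * ((1 + real (card J)) * (1 + (\<Sum>j\<in>J. ((z j)\<^sup>2)\<^sup>2)))"
    by (intro mult_left_mono sq) simp
  also have "\<dots> = (1 + real (card J)) ^ 3 * (1 + (\<Sum>j\<in>J. z j ^ 4))"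
    by (simp add: power2_eq_square power3_eq_cube power4_eq_xxxx mult.assoc)
  finally show ?thesis .
qed

section \<open>Networks with identity covariances\<close>

definition weight_index :: "(nat \<Rightarrow> nat) \<Rightarrow> (nat \<Rightarrow> nat) \<Rightarrow> nat \<Rightarrow> (nat \<times> nat \<times> nat \<times> nat) set" where
  "weight_index a n L = (SIGMA l:{1..L}. {1..n l} \<times> {1..n (l - 1)} \<times> {1..a l})"

text \<open>The weights that lead from layer \<open>l\<close> to layer \<open>Suc l\<close>. Fubini
  separates them from those in \<open>weight_index a n l\<close>, given which the new layer is
  Gaussian.\<close>

definition layer_index :: "(nat \<Rightarrow> nat) \<Rightarrow> (nat \<Rightarrow> nat) \<Rightarrow> nat \<Rightarrow> (nat \<times> nat \<times> nat \<times> nat) set" where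
  "layer_index a n l = {Suc l} \<times> {1..n (Suc l)} \<times> {1..n l} \<times> {1..a (Suc l)}"

definition entry_law :: "(nat \<Rightarrow> nat) \<Rightarrow> nat \<times> nat \<times> nat \<times> nat \<Rightarrow> real measure" where
  "entry_law n w = density lborel (normal_density 0 (sqrt (1 / real (n (fst w - 1)))))"

lemma weight_law_eq: "weight_law a n L = Pi\<^sub>M (weight_index a n L) (entry_law n)"
  unfolding weight_law_def weight_index_def entry_law_def by (intro PiM_cong) auto

lemma finite_weight_index [simp]: "finite (weight_index a n L)"
  by (auto simp: weight_index_def)

lemma finite_layer_index [simp]: "finite (layer_index a n l)"
  by (auto simp: layer_index_def)

lemma weight_index_Suc: "weight_index a n (Suc l) = weight_index a n l \<union> layer_index a n l"
  by (auto simp: weight_index_def layer_index_def le_Suc_eq)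

lemma weight_index_disjoint: "weight_index a n l \<inter> layer_index a n l = {}"
  by (auto simp: weight_index_def layer_index_def)

lemma sets_entry_law [simp, measurable_cong]: "sets (entry_law n w) = sets borel"
  by (simp add: entry_law_def)

text \<open>The product theory asks for sigma-finiteness at every index, also at those fed by a
  layer of width 0. There \<open>1 / 0 = 0\<close> makes the standard deviation 0, the density
  vanishes and the measure is null.\<close>

lemma sigma_finite_entry_law: "sigma_finite_measure (entry_law n w)"
proof (cases "n (fst w - 1) = 0")
  case True
  then have "emeasure (entry_law n w) (space (entry_law n w)) = 0"
    by (simp add: entry_law_def normal_density_def emeasure_density)
  then interpret finite_measure "entry_law n w" by (intro finite_measureI) simp
  show ?thesis by unfold_locales
next
  case False
  then have "prob_space (entry_law n w)" unfolding entry_law_def by (intro prob_space_normal_density) simp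
  then show ?thesis by (rule prob_space_imp_sigma_finite)
qed

lemma product_sigma_finite_entry_law: "product_sigma_finite (entry_law n)"
  by (simp add: product_sigma_finite_def sigma_finite_entry_law)

lemma prob_space_entry_PiM:
  assumes "\<And>w. w \<in> A \<Longrightarrow> 1 \<le> n (fst w - 1)"
  shows "prob_space (Pi\<^sub>M A (entry_law n))"
proof -
  \<comment> \<open>Off \<open>A\<close> the widths are not controlled; a point mass there makes all
    factors probability measures.\<close>
  define N where "N w = (if w \<in> A then entry_law n w else return borel 0)" for w
  have "prob_space (N w)" for w
    using assms[of w] by (auto simp: N_def entry_law_def intro!: prob_space_normal_density prob_space_return)
  then have "prob_space (Pi\<^sub>M A N)" by (intro prob_space_PiM)
  also have "Pi\<^sub>M A N = Pi\<^sub>M A (entry_law n)" by (intro PiM_cong) (auto simp: N_def)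
  finally show ?thesis .
qed

lemma prob_space_weight_law:
  assumes "\<And>l. l < L \<Longrightarrow> 1 \<le> n l"
  shows "prob_space (weight_law a n L)"
  unfolding weight_law_eq
proof (rule prob_space_entry_PiM)
  fix w assume "w \<in> weight_index a n L"
  then have "fst w - 1 < L" by (auto simp: weight_index_def)
  then show "1 \<le> n (fst w - 1)" by (rule assms)
qed

lemma network_cong_weights:
  assumes "\<And>w. w \<in> weight_index a n l \<Longrightarrow> W w = W' w"
  shows "network S a n \<psi> x W l = network S a n \<psi> x W' l"
  using assms
proof (induction l)
  case (Suc l)
  have IH: "network S a n \<psi> x W l = network S a n \<psi> x W' l"
    using Suc by (auto simp: weight_index_Suc)
  have "W (Suc l, i, j, b) = W' (Suc l, i, j, b)" if "i \<in> {1..n (Suc l)}" "j \<in> {1..n l}" "b \<in> {1..a (Suc l)}" for i j b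
    using that by (intro Suc.prems) (auto simp: weight_index_def)
  then show ?case unfolding network.simps IH by (intro restrict_ext) (auto intro!: sum.cong)
qed simp

text \<open>\<open>J l\<close> indexes independent standard coordinates, in the application as many
  as the rank of the limiting covariance. By \<open>white\<close>, standard coordinates in one layer
  lead to identity covariance in the next. \<open>J 0\<close> is empty because the input is
  deterministic; its values enter through the first activation.\<close>

locale whitened_network =
  fixes J :: "nat \<Rightarrow> 's set" and a :: "nat \<Rightarrow> nat"
    and \<psi> :: "nat \<Rightarrow> ('s \<Rightarrow> real) \<Rightarrow> nat \<times> 's \<Rightarrow> real" and x :: "'s \<Rightarrow> real"
  assumes J0: "J 0 = {}"
    and fin: "\<And>l. finite (J l)"
    and meas: "\<And>l b s. b \<in> {1..a (Suc l)} \<Longrightarrow> s \<in> J (Suc l) \<Longrightarrow> (\<lambda>z. \<psi> (Suc l) z (b, s)) \<in> borel_measurable (euclid (J l))"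
    and growth: "\<And>l. \<exists>c\<ge>0. \<forall>b\<in>{1..a (Suc l)}. \<forall>s\<in>J (Suc l). \<forall>z\<in>space (euclid (J l)).
        \<bar>\<psi> (Suc l) z (b, s)\<bar> \<le> c * (1 + (\<Sum>j\<in>J l. \<bar>z j\<bar>))"
    and white: "\<And>l s t. s \<in> J (Suc l) \<Longrightarrow> t \<in> J (Suc l) \<Longrightarrow>
        (\<Sum>b=1..a (Suc l). \<integral>z. \<psi> (Suc l) z (b, s) * \<psi> (Suc l) z (b, t) \<partial>std_gaussian (J l)) = (if s = t then 1 else 0)"
begin

abbreviation "net n W l \<equiv> network J a n \<psi> x W l"

definition gram :: "nat \<Rightarrow> ('s \<Rightarrow> real) \<Rightarrow> 's \<Rightarrow> 's \<Rightarrow> real" where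
  "gram l z s t = (\<Sum>b=1..a (Suc l). \<psi> (Suc l) z (b, s) * \<psi> (Suc l) z (b, t))"

definition row :: "nat \<Rightarrow> (nat \<times> 's \<Rightarrow> real) \<Rightarrow> nat \<Rightarrow> 's \<Rightarrow> real" where
  "row l h i = (\<lambda>s\<in>J l. h (i, s))"

text \<open>The covariance of a row of layer \<open>Suc l\<close> conditionally on the weights
  below: every weight has variance \<open>1 / n l\<close>, and each row of layer \<open>l\<close>
  contributes one Gram matrix.\<close>

definition cov :: "(nat \<Rightarrow> nat) \<Rightarrow> (nat \<times> nat \<times> nat \<times> nat \<Rightarrow> real) \<Rightarrow> nat \<Rightarrow> 's \<Rightarrow> 's \<Rightarrow> real" where
  "cov n W l s t = (\<Sum>i=1..n l. gram l (row l (net n W l) i) s t) / real (n l)"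

text \<open>The map \<open>r\<close> renames selected neurons by \<open>R\<close>, so that a bound
  stated for \<open>{1..m}\<close> applies to any \<open>m\<close> distinct neurons.\<close>

definition rows :: "nat set \<Rightarrow> (nat \<Rightarrow> nat) \<Rightarrow> (nat \<Rightarrow> nat) \<Rightarrow> (nat \<times> nat \<times> nat \<times> nat \<Rightarrow> real) \<Rightarrow> nat \<Rightarrow> nat \<times> 's \<Rightarrow> real" where
  "rows R r n W l = (\<lambda>(i, s)\<in>R \<times> J l. net n W l (r i, s))"

lemma row_space: "row l h i \<in> space (euclid (J l))"
  by (simp add: row_def space_euclid)

lemma row_measurable:
  assumes "i \<in> R"
  shows "(\<lambda>h. row l h i) \<in> measurable (euclid (R \<times> J l)) (euclid (J l))"
  unfolding row_def euclid_def
  by (intro measurable_restrict measurable_component_singleton) (use assms in auto)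

lemma gram_measurable:
  assumes "s \<in> J (Suc l)" "t \<in> J (Suc l)"
  shows "(\<lambda>z. gram l z s t) \<in> borel_measurable (euclid (J l))"
  unfolding gram_def using assms meas by (intro borel_measurable_sum borel_measurable_times) auto

lemma gram_sym: "gram l z s t = gram l z t s"
  by (simp add: gram_def mult.commute)

lemma cov_sym: "cov n W l s t = cov n W l t s"
  unfolding cov_def by (subst gram_sym) simp

lemma net_measurable:
  assumes "l \<le> L"
  shows "(\<lambda>W. net n W l) \<in> measurable (weight_law a n L) (euclid ({1..n l} \<times> J l))"
  using assms
proof (induction l)
  case 0
  show ?case by (simp add: J0 euclid_def)
next
  case (Suc l)
  then have IH: "(\<lambda>W. net n W l) \<in> measurable (weight_law a n L) (euclid ({1..n l} \<times> J l))" by simp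
  have entry: "(\<lambda>W. \<Sum>j=1..n l. \<Sum>b=1..a (Suc l). W (Suc l, i, j, b) * \<psi> (Suc l) (\<lambda>t\<in>J l. net n W l (j, t)) (b, s))
      \<in> borel_measurable (weight_law a n L)" if i: "i \<in> {1..n (Suc l)}" and s: "s \<in> J (Suc l)" for i s
  proof (intro borel_measurable_sum borel_measurable_times)
    fix j b assume j: "j \<in> {1..n l}" and b: "b \<in> {1..a (Suc l)}"
    have "(Suc l, i, j, b) \<in> weight_index a n L" using Suc.prems i j b by (auto simp: weight_index_def)
    from measurable_component_singleton[OF this, of "entry_law n"]
    show "(\<lambda>W. W (Suc l, i, j, b)) \<in> borel_measurable (weight_law a n L)"
      unfolding weight_law_eq by (simp cong: measurable_cong_sets)
    have "(\<lambda>W. row l (net n W l) j) \<in> measurable (weight_law a n L) (euclid (J l))"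
      using measurable_compose[OF IH row_measurable[OF j]] .
    from measurable_compose[OF this meas[OF b s]]
    show "(\<lambda>W. \<psi> (Suc l) (\<lambda>t\<in>J l. net n W l (j, t)) (b, s)) \<in> borel_measurable (weight_law a n L)"
      by (simp add: row_def)
  qed
  show ?case unfolding network.simps euclid_def
  proof (rule measurable_restrict)
    fix p assume "p \<in> {1..n (Suc l)} \<times> J (Suc l)"
    then obtain i s where "p = (i, s)" "i \<in> {1..n (Suc l)}" "s \<in> J (Suc l)" by auto
    then show "(\<lambda>W. case p of (i, s) \<Rightarrow> \<Sum>j=1..n l. \<Sum>b=1..a (Suc l). W (Suc l, i, j, b) * \<psi> (Suc l) (\<lambda>t\<in>J l. net n W l (j, t)) (b, s))
      \<in> borel_measurable (weight_law a n L)" using entry by simp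
  qed
qed

lemma rows_measurable:
  assumes "l \<le> L" "r ` R \<subseteq> {1..n l}"
  shows "(\<lambda>W. rows R r n W l) \<in> measurable (weight_law a n L) (euclid (R \<times> J l))"
  unfolding rows_def euclid_def
proof (rule measurable_restrict)
  fix p assume "p \<in> R \<times> J l"
  then obtain i s where p: "p = (i, s)" and "(r i, s) \<in> {1..n l} \<times> J l" using assms(2) by auto
  from measurable_compose[OF net_measurable[where n = n, OF assms(1), unfolded euclid_def] measurable_component_singleton[OF this(2)]]
  show "(\<lambda>W. case p of (i, s) \<Rightarrow> net n W l (r i, s)) \<in> borel_measurable (weight_law a n L)" by (simp add: p)
qed

lemma cov_measurable:
  assumes "s \<in> J (Suc l)" "t \<in> J (Suc l)"
  shows "(\<lambda>W. cov n W l s t) \<in> borel_measurable (weight_law a n l)"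
proof -
  have "(\<lambda>W. gram l (row l (net n W l) i) s t) \<in> borel_measurable (weight_law a n l)" if "i \<in> {1..n l}" for i
    using measurable_compose[OF measurable_compose[OF net_measurable[where n = n, OF order_refl] row_measurable[OF that]] gram_measurable[OF assms]] .
  then show ?thesis unfolding cov_def by (intro borel_measurable_divide borel_measurable_sum) auto
qed

text \<open>With the lower weights \<open>W\<close> frozen, the layer is linear in its own weights
  \<open>V\<close>. Distinct rows read disjoint weights and \<open>r\<close> is injective, so mixed
  covariances vanish; within a row the sum over the weights is \<open>cov\<close>.\<close>

lemma layer_gaussian:
  assumes n: "1 \<le> n l" and r: "inj_on r R" "r ` R \<subseteq> {1..n (Suc l)}" and finR: "finite R"
  shows "gaussian_law (R \<times> J (Suc l)) (block_cov (cov n W l))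
    (distr (Pi\<^sub>M (layer_index a n l) (entry_law n)) (euclid (R \<times> J (Suc l)))
      (\<lambda>V. rows R r n (merge (weight_index a n l) (layer_index a n l) (W, V)) (Suc l)))"
proof -
  define P where "P j b s = \<psi> (Suc l) (row l (net n W l) j) (b, s)" for j b s
  define M where "M y q = (case q of (l', i, j, b) \<Rightarrow> if i = r (fst y) then P j b (snd y) else 0)" for y :: "nat \<times> 's" and q :: "nat \<times> nat \<times> nat \<times> nat"
  let ?Q = "layer_index a n l"
  define sd where "sd = sqrt (1 / real (n l))"
  have sd: "0 < sd" "sd\<^sup>2 = 1 / real (n l)" using n by (auto simp: sd_def)
  have sumQ: "(\<Sum>q\<in>?Q. f q) = (\<Sum>i=1..n (Suc l). \<Sum>j=1..n l. \<Sum>b=1..a (Suc l). f (Suc l, i, j, b))" for f :: "_ \<Rightarrow> real"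
    unfolding layer_index_def by (simp add: sum.cartesian_product')
  have eq1: "Pi\<^sub>M ?Q (entry_law n) = (\<Pi>\<^sub>M q\<in>?Q. density lborel (normal_density 0 sd))"
    by (intro PiM_cong) (auto simp: layer_index_def entry_law_def sd_def)
  have eq2: "rows R r n (merge (weight_index a n l) ?Q (W, V)) (Suc l) = (\<lambda>y\<in>R \<times> J (Suc l). \<Sum>q\<in>?Q. M y q * V q)" for V
  proof -
    define W' where "W' = merge (weight_index a n l) ?Q (W, V)"
    \<comment> \<open>The lower layers read only lower weights, which merging leaves as in
      \<open>W\<close>.\<close>
    have net: "net n W' l = net n W l"
      using weight_index_disjoint[of a n l] by (intro network_cong_weights) (auto simp: W'_def merge_def)
    have W': "W' q = V q" if "q \<in> ?Q" for q using weight_index_disjoint[of a n l] that by (auto simp: W'_def merge_def)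
    show ?thesis unfolding W'_def[symmetric] rows_def
    proof (intro restrict_ext, clarify)
      fix i s assume iss: "i \<in> R" "s \<in> J (Suc l)"
      then have ri: "r i \<in> {1..n (Suc l)}" using r by auto
      have "net n W' (Suc l) (r i, s) = (\<Sum>j=1..n l. \<Sum>b=1..a (Suc l). W' (Suc l, r i, j, b) * P j b s)"
        using ri iss by (simp add: net P_def row_def)
      also have "\<dots> = (\<Sum>j=1..n l. \<Sum>b=1..a (Suc l). P j b s * V (Suc l, r i, j, b))"
        using ri by (intro sum.cong refl) (subst W', auto simp: layer_index_def)
      also have "\<dots> = (\<Sum>i'=1..n (Suc l). if i' = r i then (\<Sum>j=1..n l. \<Sum>b=1..a (Suc l). P j b s * V (Suc l, i', j, b)) else 0)"
        using ri by simp
      also have "\<dots> = (\<Sum>q\<in>?Q. M (i, s) q * V q)"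
        unfolding sumQ M_def by (intro sum.cong refl) auto
      finally show "net n W' (Suc l) (r i, s) = (\<Sum>q\<in>?Q. M (i, s) q * V q)" .
    qed
  qed
  have "gaussian_law (R \<times> J (Suc l)) (\<lambda>y y'. \<Sum>q\<in>?Q. sd\<^sup>2 * M y q * M y' q)
    (distr (\<Pi>\<^sub>M q\<in>?Q. density lborel (normal_density 0 sd)) (euclid (R \<times> J (Suc l))) (\<lambda>V. \<lambda>y\<in>R \<times> J (Suc l). \<Sum>q\<in>?Q. M y q * V q))"
    by (rule gaussian_law_linear_image) (use finR fin sd in auto)
  moreover have "(\<Sum>q\<in>?Q. sd\<^sup>2 * M y q * M y' q) = block_cov (cov n W l) y y'" if "y \<in> R \<times> J (Suc l)" "y' \<in> R \<times> J (Suc l)" for y y'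
  proof -
    obtain i s k t where y: "y = (i, s)" "y' = (k, t)" "i \<in> R" "k \<in> R" using \<open>y \<in> R \<times> J (Suc l)\<close> \<open>y' \<in> R \<times> J (Suc l)\<close> by auto
    have ri: "r i \<in> {1..n (Suc l)}" using r y by auto
    have rr: "r i = r k \<longleftrightarrow> i = k" using r(1) y by (auto simp: inj_on_def)
    have "(\<Sum>q\<in>?Q. sd\<^sup>2 * M y q * M y' q)
      = (\<Sum>i'=1..n (Suc l). if i' = r i then (if i = k then \<Sum>j=1..n l. \<Sum>b=1..a (Suc l). sd\<^sup>2 * P j b s * P j b t else 0) else 0)"
      unfolding sumQ M_def y by (intro sum.cong refl) (auto simp: rr)
    also have "\<dots> = (if i = k then \<Sum>j=1..n l. \<Sum>b=1..a (Suc l). sd\<^sup>2 * P j b s * P j b t else 0)" using ri by simp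
    also have "\<dots> = block_cov (cov n W l) y y'"
      by (simp add: y cov_def gram_def P_def sd(2) sum_divide_distrib sum_distrib_left)
    finally show ?thesis .
  qed
  ultimately show ?thesis unfolding eq1 eq2 gaussian_law_def by (simp cong: sum.cong)
qed

end

text \<open>\<open>\<epsilon>\<close> is a common upper bound for the inverse hidden widths up to
  layer \<open>l\<close>, so one value serves all layers; \<open>\<epsilon> \<le> 1\<close> allows a
  factor \<open>\<epsilon>\<close> to be dropped from upper bounds.\<close>

definition admissible :: "(nat \<Rightarrow> nat) \<Rightarrow> nat \<Rightarrow> real \<Rightarrow> bool" where
  "admissible n l \<epsilon> \<longleftrightarrow> n 0 = 1 \<and> (\<forall>i\<in>{1..l}. 1 \<le> n i \<and> 1 / real (n i) \<le> \<epsilon>) \<and> 0 \<le> \<epsilon> \<and> \<epsilon> \<le> 1"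

lemma admissible_mono: "admissible n l \<epsilon> \<Longrightarrow> k \<le> l \<Longrightarrow> admissible n k \<epsilon>"
  by (auto simp: admissible_def)

lemma admissible_pos: "admissible n l \<epsilon> \<Longrightarrow> k \<le> l \<Longrightarrow> 1 \<le> n k"
  by (cases k) (auto simp: admissible_def)

lemma std_gaussian_quartic:
  assumes "finite X"
  shows "integrable (std_gaussian X) (\<lambda>z. 1 + (\<Sum>x\<in>X. z x ^ 4))"
    and "(\<integral>z. 1 + (\<Sum>x\<in>X. z x ^ 4) \<partial>std_gaussian X) = 1 + 3 * real (card X)"
proof -
  interpret prob_space "std_gaussian X" by (rule prob_space_std_gaussian)
  note m = gaussian_law_fourth_moment[OF assms gaussian_law_std_gaussian[OF assms]]
  show "integrable (std_gaussian X) (\<lambda>z. 1 + (\<Sum>x\<in>X. z x ^ 4))" using m(1) by simp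
  show "(\<integral>z. 1 + (\<Sum>x\<in>X. z x ^ 4) \<partial>std_gaussian X) = 1 + 3 * real (card X)" using m prob_space by simp
qed

lemma std_gaussian_integrable_growth:
  assumes "finite X" and f: "f \<in> borel_measurable (euclid X)"
    and b: "\<And>z. z \<in> space (euclid X) \<Longrightarrow> \<bar>f z\<bar> \<le> K * (1 + (\<Sum>x\<in>X. z x ^ 4))"
  shows "integrable (std_gaussian X) f" "\<bar>\<integral>z. f z \<partial>std_gaussian X\<bar> \<le> K * (1 + 3 * real (card X))"
proof -
  have i: "integrable (std_gaussian X) (\<lambda>z. K * (1 + (\<Sum>x\<in>X. z x ^ 4)))"
    using std_gaussian_quartic(1)[OF assms(1)] by (rule integrable_mult_right)
  have f': "f \<in> borel_measurable (std_gaussian X)" using f unfolding measurable_cong_sets[OF std_gaussian_sets refl] .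
  have b': "\<bar>f z\<bar> \<le> K * (1 + (\<Sum>x\<in>X. z x ^ 4))" if "z \<in> space (std_gaussian X)" for z
    using b that sets_eq_imp_space_eq[OF std_gaussian_sets, of X] by simp
  show "integrable (std_gaussian X) f" by (rule abs_integral_le(1)[OF i f' b'])
  have "\<bar>\<integral>z. f z \<partial>std_gaussian X\<bar> \<le> (\<integral>z. K * (1 + (\<Sum>x\<in>X. z x ^ 4)) \<partial>std_gaussian X)"
    by (rule abs_integral_le(2)[OF i f' b'])
  also have "\<dots> = K * (1 + 3 * real (card X))"
    unfolding integral_mult_right_zero std_gaussian_quartic(2)[OF assms(1)] ..
  finally show "\<bar>\<integral>z. f z \<partial>std_gaussian X\<bar> \<le> K * (1 + 3 * real (card X))" .
qed

section \<open>Covariance errors, closeness of laws, and the passage between them\<close>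

context whitened_network
begin

definition cov_err :: "(nat \<Rightarrow> nat) \<Rightarrow> (nat \<times> nat \<times> nat \<times> nat \<Rightarrow> real) \<Rightarrow> nat \<Rightarrow> 's \<Rightarrow> 's \<Rightarrow> real" where
  "cov_err n W l s t = cov n W l s t - (if s = t then 1 else 0)"

text \<open>The mean is bounded apart from the mean square, which alone would only give a mean of
  order \<open>sqrt \<epsilon>\<close>. The constant precedes the widths and hence does not depend
  on them.\<close>

definition cov_close :: "nat \<Rightarrow> bool" where
  "cov_close l \<longleftrightarrow> (\<exists>C\<ge>0. \<forall>n \<epsilon>. admissible n l \<epsilon> \<longrightarrow> (\<forall>s\<in>J (Suc l). \<forall>t\<in>J (Suc l).
     integrable (weight_law a n l) (\<lambda>W. (cov_err n W l s t)\<^sup>2) \<and>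
     \<bar>\<integral>W. cov_err n W l s t \<partial>weight_law a n l\<bar> \<le> C * \<epsilon> \<and>
     (\<integral>W. (cov_err n W l s t)\<^sup>2 \<partial>weight_law a n l) \<le> C * \<epsilon>))"

text \<open>\<open>C\<close> precedes \<open>n\<close>, \<open>r\<close> and \<open>H\<close>: a
  weighted total variation bound, uniform in the widths and in the choice of the \<open>m\<close>
  rows.\<close>

definition law_close :: "nat \<Rightarrow> nat \<Rightarrow> bool" where
  "law_close l m \<longleftrightarrow> (\<exists>C\<ge>0. \<forall>n \<epsilon> r H. admissible n l \<epsilon> \<longrightarrow> inj_on r {1..m} \<longrightarrow> r ` {1..m} \<subseteq> {1..n (Suc l)} \<longrightarrow>
     H \<in> borel_measurable (euclid ({1..m} \<times> J (Suc l))) \<longrightarrow>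
     (\<forall>z\<in>space (euclid ({1..m} \<times> J (Suc l))). \<bar>H z\<bar> \<le> 1 + (\<Sum>x\<in>{1..m} \<times> J (Suc l). z x ^ 4)) \<longrightarrow>
     integrable (weight_law a n (Suc l)) (\<lambda>W. H (rows {1..m} r n W (Suc l))) \<and>
     \<bar>(\<integral>W. H (rows {1..m} r n W (Suc l)) \<partial>weight_law a n (Suc l)) - (\<integral>z. H z \<partial>std_gaussian ({1..m} \<times> J (Suc l)))\<bar> \<le> C * \<epsilon>)"

text \<open>No random layer lies below. Since \<open>J 0\<close> is empty, the standard Gaussian on
  it is a point mass at the only possible row; \<open>n 0 = 1\<close> makes the average that of a
  single row, and \<open>white\<close> gives the covariance exactly.\<close>

lemma cov_close_0: "cov_close 0"
proof -
  have "cov_err n W 0 s t = 0" if n: "n 0 = 1" and st: "s \<in> J (Suc 0)" "t \<in> J (Suc 0)" for n W s t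
  proof -
    have "(\<integral>z. f z \<partial>std_gaussian (J 0)) = f (\<lambda>_. undefined)" for f :: "('s \<Rightarrow> real) \<Rightarrow> real"
      by (simp add: J0 PiM_empty lebesgue_integral_count_space_finite)
    then have "gram 0 (\<lambda>_. undefined) s t = (if s = t then 1 else 0)"
      using white[OF st] by (simp add: gram_def)
    moreover have "row 0 h i = (\<lambda>_. undefined)" for h i by (simp add: row_def J0 restrict_def)
    ultimately show ?thesis by (simp add: cov_err_def cov_def n)
  qed
  then show ?thesis unfolding cov_close_def by (intro exI[of _ 0]) (auto simp: admissible_def)
qed

lemma cov_err_measurable:
  assumes "s \<in> J (Suc l)" "t \<in> J (Suc l)"
  shows "(\<lambda>W. cov_err n W l s t) \<in> borel_measurable (weight_law a n l)"
  unfolding cov_err_def using cov_measurable[OF assms] by simp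

text \<open>Conditionally on the lower weights the rows are Gaussian, so
  \<open>gaussian_expansion\<close> applies with \<open>N\<close> the random covariance. Its
  coefficients do not depend on \<open>N\<close>; integrating over the lower weights therefore
  leaves the mean error in the linear term and the mean square error in the remainder, and
  \<open>cov_close\<close> bounds both.\<close>

lemma law_close_if_cov_close:
  assumes "cov_close l"
  shows "law_close l m"
proof -
  obtain C1 where C10: "0 \<le> C1" and C1: "\<forall>n \<epsilon>. admissible n l \<epsilon> \<longrightarrow> (\<forall>s\<in>J (Suc l). \<forall>t\<in>J (Suc l).
     integrable (weight_law a n l) (\<lambda>W. (cov_err n W l s t)\<^sup>2) \<and>
     \<bar>\<integral>W. cov_err n W l s t \<partial>weight_law a n l\<bar> \<le> C1 * \<epsilon> \<and>
     (\<integral>W. (cov_err n W l s t)\<^sup>2 \<partial>weight_law a n l) \<le> C1 * \<epsilon>)"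
    using assms unfolding cov_close_def by (elim exE conjE)
  define R where "R = {1..m}"
  define Js where "Js = J (Suc l)"
  define X where "X = R \<times> Js"
  have finR: "finite R" and finJ: "finite Js" and finX: "finite X" using fin by (auto simp: R_def Js_def X_def)
  obtain C where C0: "0 \<le> C" and C: "\<forall>H\<in>borel_measurable (euclid (R \<times> Js)). (\<forall>z\<in>space (euclid (R \<times> Js)). \<bar>H z\<bar> \<le> 1 + (\<Sum>x\<in>R \<times> Js. z x ^ 4)) \<longrightarrow>
    (\<exists>d. (\<forall>s\<in>Js. \<forall>t\<in>Js. \<bar>d s t\<bar> \<le> C) \<and>
      (\<forall>N \<Gamma>. gaussian_law (R \<times> Js) (block_cov N) \<Gamma> \<longrightarrow> (\<forall>s\<in>Js. \<forall>t\<in>Js. N s t = N t s) \<longrightarrow>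
        \<bar>(\<integral>z. H z \<partial>\<Gamma>) - (\<integral>z. H z \<partial>std_gaussian (R \<times> Js)) - (\<Sum>s\<in>Js. \<Sum>t\<in>Js. d s t * (N s t - (if s = t then 1 else 0)))\<bar>
          \<le> C * (\<Sum>s\<in>Js. \<Sum>t\<in>Js. (N s t - (if s = t then 1 else 0))\<^sup>2)))"
    using gaussian_expansion[OF finR finJ] by (elim exE conjE)
  define N2 where "N2 = real (card Js) * real (card Js)"
  have main: "integrable (weight_law a n (Suc l)) (\<lambda>W. H (rows R r n W (Suc l))) \<and>
     \<bar>(\<integral>W. H (rows R r n W (Suc l)) \<partial>weight_law a n (Suc l)) - (\<integral>z. H z \<partial>std_gaussian X)\<bar> \<le> 2 * C * C1 * N2 * \<epsilon>"
    if adm: "admissible n l \<epsilon>" and r: "inj_on r R" "r ` R \<subseteq> {1..n (Suc l)}"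
      and H: "H \<in> borel_measurable (euclid X)" and Hb: "\<forall>z\<in>space (euclid X). \<bar>H z\<bar> \<le> 1 + (\<Sum>x\<in>X. z x ^ 4)"
    for n \<epsilon> r H
  proof -
    let ?A = "weight_index a n l" and ?B = "layer_index a n l"
    let ?P = "Pi\<^sub>M ?A (entry_law n)" and ?L = "Pi\<^sub>M ?B (entry_law n)" and ?PL = "Pi\<^sub>M (?A \<union> ?B) (entry_law n)"
    interpret product_sigma_finite "entry_law n" by (rule product_sigma_finite_entry_law)
    have nl: "1 \<le> n k" if "k \<le> l" for k using admissible_pos[OF adm that] .
    have wl: "weight_law a n (Suc l) = ?PL" "weight_law a n l = ?P" by (simp_all add: weight_law_eq weight_index_Suc)
    interpret P: prob_space ?P unfolding wl(2)[symmetric] using nl by (intro prob_space_weight_law) simp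
    interpret L: prob_space ?L using nl by (intro prob_space_entry_PiM) (auto simp: layer_index_def)
    define E where "E s t W = cov_err n W l s t" for s t W
    have Em [measurable]: "E s t \<in> borel_measurable ?P" if "s \<in> Js" "t \<in> Js" for s t
      unfolding E_def using cov_err_measurable[of s l t n] that by (simp add: wl Js_def)
    have C1': "integrable ?P (\<lambda>W. (E s t W)\<^sup>2)" "\<bar>\<integral>W. E s t W \<partial>?P\<bar> \<le> C1 * \<epsilon>" "(\<integral>W. (E s t W)\<^sup>2 \<partial>?P) \<le> C1 * \<epsilon>"
      if "s \<in> Js" "t \<in> Js" for s t
      using C1[rule_format, OF adm, of s t] that by (auto simp: E_def wl Js_def)
    have Ei: "integrable ?P (E s t)" if st: "s \<in> Js" "t \<in> Js" for s t
    proof (rule abs_integral_le(1))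
      show "integrable ?P (\<lambda>W. 1 + (E s t W)\<^sup>2)" using C1'(1)[OF st] by simp
      fix W
      have "0 \<le> (\<bar>E s t W\<bar> - 1)\<^sup>2 + \<bar>E s t W\<bar>\<^sup>2" by simp
      then have "2 * \<bar>E s t W\<bar> \<le> 1 + 2 * \<bar>E s t W\<bar>\<^sup>2" by (simp add: power2_eq_square algebra_simps)
      then show "\<bar>E s t W\<bar> \<le> 1 + (E s t W)\<^sup>2" by simp
    qed (use st in measurable)
    define T where "T W = rows R r n W (Suc l)" for W
    have Tm: "T \<in> measurable ?PL (euclid X)"
      using rows_measurable[where l = "Suc l" and L = "Suc l" and n = n, OF order_refl r(2)] unfolding T_def wl X_def Js_def .
    have mg: "merge ?A ?B \<in> measurable (?P \<Otimes>\<^sub>M ?L) ?PL" by (rule measurable_merge)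
    define \<Gamma> where "\<Gamma> W = distr ?L (euclid X) (\<lambda>V. T (merge ?A ?B (W, V)))" for W
    have TVm: "(\<lambda>V. T (merge ?A ?B (W, V))) \<in> measurable ?L (euclid X)" if "W \<in> space ?P" for W
      using measurable_compose[OF measurable_compose[OF measurable_Pair1'[OF that] mg] Tm] .
    have law: "gaussian_law X (block_cov (cov n W l)) (\<Gamma> W)" for W
      unfolding \<Gamma>_def T_def X_def Js_def using layer_gaussian[of n l r R W] nl[of l] r finR by auto
    define g where "g z = 1 + (\<Sum>x\<in>X. z x ^ 4)" for z :: "nat \<times> 's \<Rightarrow> real"
    have gm: "g \<in> borel_measurable (euclid X)" unfolding g_def euclid_def by measurable
    define G where "G W = 1 + (\<Sum>x\<in>X. 3 * (block_cov (cov n W l) x x)\<^sup>2)" for W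
    \<comment> \<open>The conditional integral of the quartic majorant in closed form. It is
      quadratic in the covariance, hence integrable over the lower weights, which gives the
      integrability that Fubini for \<open>H\<close> asks for.\<close>
    have inner: "(\<integral>\<^sup>+V. ennreal (g (T (merge ?A ?B (W, V)))) \<partial>?L) = ennreal (G W)" if W: "W \<in> space ?P" for W
    proof -
      interpret \<Gamma>: prob_space "\<Gamma> W" using law by (simp add: gaussian_law_def)
      note m4 = gaussian_law_fourth_moment[OF finX law[of W]]
      have "(\<integral>\<^sup>+V. ennreal (g (T (merge ?A ?B (W, V)))) \<partial>?L) = (\<integral>\<^sup>+z. ennreal (g z) \<partial>\<Gamma> W)"
        unfolding \<Gamma>_def using gm by (subst nn_integral_distr[OF TVm[OF W]]) auto
      also have "\<dots> = ennreal (\<integral>z. g z \<partial>\<Gamma> W)"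
        using m4 unfolding g_def by (intro nn_integral_eq_integral) (auto intro!: AE_I2 sum_nonneg add_nonneg_nonneg)
      also have "(\<integral>z. g z \<partial>\<Gamma> W) = G W" using m4 by (simp add: g_def G_def \<Gamma>.prob_space)
      finally show ?thesis .
    qed
    have Gi: "integrable ?P G"
    proof -
      have "integrable ?P (\<lambda>W. (cov n W l s s)\<^sup>2)" if s: "s \<in> Js" for s
      proof (rule abs_integral_le(1))
        show "integrable ?P (\<lambda>W. 2 + 2 * (E s s W)\<^sup>2)" using C1'(1)[OF s s] by simp
        show "(\<lambda>W. (cov n W l s s)\<^sup>2) \<in> borel_measurable ?P" using cov_measurable[of s l s n] s by (simp add: wl Js_def)
        fix W
        have "0 \<le> (cov n W l s s - 2)\<^sup>2" by simp
        then show "\<bar>(cov n W l s s)\<^sup>2\<bar> \<le> 2 + 2 * (E s s W)\<^sup>2" by (simp add: E_def cov_err_def power2_eq_square algebra_simps)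
      qed
      then have "integrable ?P (\<lambda>W. \<Sum>x\<in>X. 3 * (block_cov (cov n W l) x x)\<^sup>2)" by (intro Bochner_Integration.integrable_sum) (auto simp: X_def)
      then show ?thesis unfolding G_def by simp
    qed
    have fm: "(\<lambda>W. H (T W)) \<in> borel_measurable ?PL" by (rule measurable_compose[OF Tm H])
    have fi: "integrable ?PL (\<lambda>W. H (T W))"
    proof (rule integrableI_bounded[OF fm])
      have "(\<integral>\<^sup>+W. ennreal (norm (H (T W))) \<partial>?PL) \<le> (\<integral>\<^sup>+W. ennreal (g (T W)) \<partial>?PL)"
      proof (rule nn_integral_mono)
        fix W assume "W \<in> space ?PL"
        then have "T W \<in> space (euclid X)" by (rule measurable_space[OF Tm])
        then show "ennreal (norm (H (T W))) \<le> ennreal (g (T W))" using Hb by (auto simp: g_def intro!: ennreal_leI)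
      qed
      also have "\<dots> = (\<integral>\<^sup>+W. \<integral>\<^sup>+V. ennreal (g (T (merge ?A ?B (W, V)))) \<partial>?L \<partial>?P)"
        using measurable_compose[OF Tm gm] by (intro product_nn_integral_fold) (auto simp: weight_index_disjoint)
      also have "\<dots> = (\<integral>\<^sup>+W. ennreal (G W) \<partial>?P)" using inner by (intro nn_integral_cong)
      also have "\<dots> < \<infinity>" using Gi unfolding G_def by (subst nn_integral_eq_integral) (auto intro!: AE_I2 sum_nonneg add_nonneg_nonneg)
      finally show "(\<integral>\<^sup>+W. ennreal (norm (H (T W))) \<partial>?PL) < \<infinity>" .
    qed
    define \<phi> where "\<phi> W = (\<integral>V. H (T (merge ?A ?B (W, V))) \<partial>?L)" for W
    have \<phi>m: "\<phi> \<in> borel_measurable ?P"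
      unfolding \<phi>_def using measurable_compose[OF mg fm] by (intro L.borel_measurable_lebesgue_integral) (simp add: case_prod_unfold)
    have f\<phi>: "(\<integral>W. H (T W) \<partial>?PL) = (\<integral>W. \<phi> W \<partial>?P)"
      unfolding \<phi>_def by (rule product_integral_fold[OF weight_index_disjoint _ _ fi]) auto
    obtain d where d: "\<forall>s\<in>Js. \<forall>t\<in>Js. \<bar>d s t\<bar> \<le> C" and
      dN: "\<forall>N \<Gamma>. gaussian_law (R \<times> Js) (block_cov N) \<Gamma> \<longrightarrow> (\<forall>s\<in>Js. \<forall>t\<in>Js. N s t = N t s) \<longrightarrow>
        \<bar>(\<integral>z. H z \<partial>\<Gamma>) - (\<integral>z. H z \<partial>std_gaussian (R \<times> Js)) - (\<Sum>s\<in>Js. \<Sum>t\<in>Js. d s t * (N s t - (if s = t then 1 else 0)))\<bar>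
          \<le> C * (\<Sum>s\<in>Js. \<Sum>t\<in>Js. (N s t - (if s = t then 1 else 0))\<^sup>2)"
      using C[THEN bspec, OF H[unfolded X_def], THEN mp, OF Hb[unfolded X_def]] by (elim exE conjE)
    define h0 where "h0 = (\<integral>z. H z \<partial>std_gaussian X)"
    define lin where "lin W = (\<Sum>s\<in>Js. \<Sum>t\<in>Js. d s t * E s t W)" for W
    define S where "S W = (\<Sum>s\<in>Js. \<Sum>t\<in>Js. (E s t W)\<^sup>2)" for W
    have bound: "\<bar>\<phi> W - h0 - lin W\<bar> \<le> C * S W" if W: "W \<in> space ?P" for W
    proof -
      have "\<phi> W = (\<integral>z. H z \<partial>\<Gamma> W)" unfolding \<phi>_def \<Gamma>_def by (rule integral_distr[OF TVm[OF W] H, symmetric])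
      then show ?thesis
        using dN[rule_format, OF law[of W, unfolded X_def] cov_sym] by (simp add: h0_def X_def lin_def S_def E_def cov_err_def)
    qed
    have Si: "integrable ?P S" unfolding S_def using C1'(1) by (intro Bochner_Integration.integrable_sum) auto
    have li: "integrable ?P lin" unfolding lin_def using Ei by (intro Bochner_Integration.integrable_sum integrable_mult_right) auto
    have rm: "(\<lambda>W. \<phi> W - h0 - lin W) \<in> borel_measurable ?P"
      using \<phi>m borel_measurable_integrable[OF li] by simp
    have CS: "integrable ?P (\<lambda>W. C * S W)" using Si by simp
    have ri: "integrable ?P (\<lambda>W. \<phi> W - h0 - lin W)" by (rule abs_integral_le(1)[OF CS rm bound])
    have rb: "\<bar>\<integral>W. \<phi> W - h0 - lin W \<partial>?P\<bar> \<le> (\<integral>W. C * S W \<partial>?P)" by (rule abs_integral_le(2)[OF CS rm bound])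
    have "(\<integral>W. \<phi> W \<partial>?P) = (\<integral>W. (\<phi> W - h0 - lin W) + (h0 + lin W) \<partial>?P)" by simp
    also have "\<dots> = (\<integral>W. \<phi> W - h0 - lin W \<partial>?P) + (h0 + (\<integral>W. lin W \<partial>?P))"
      using ri li by (subst Bochner_Integration.integral_add) (auto simp: P.prob_space)
    finally have "\<bar>(\<integral>W. \<phi> W \<partial>?P) - h0\<bar> \<le> (\<integral>W. C * S W \<partial>?P) + \<bar>\<integral>W. lin W \<partial>?P\<bar>" using rb by linarith
    also have "(\<integral>W. C * S W \<partial>?P) \<le> C * (\<Sum>s\<in>Js. \<Sum>t\<in>Js. C1 * \<epsilon>)"
    proof -
      have "(\<integral>W. C * S W \<partial>?P) = C * (\<Sum>s\<in>Js. \<Sum>t\<in>Js. \<integral>W. (E s t W)\<^sup>2 \<partial>?P)" unfolding S_def using C1'(1) by simp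
      also have "\<dots> \<le> C * (\<Sum>s\<in>Js. \<Sum>t\<in>Js. C1 * \<epsilon>)" using C0 C1'(3) by (intro mult_left_mono sum_mono) auto
      finally show ?thesis .
    qed
    also have "\<bar>\<integral>W. lin W \<partial>?P\<bar> \<le> (\<Sum>s\<in>Js. \<Sum>t\<in>Js. C * (C1 * \<epsilon>))"
    proof -
      have "(\<integral>W. lin W \<partial>?P) = (\<Sum>s\<in>Js. \<Sum>t\<in>Js. d s t * (\<integral>W. E s t W \<partial>?P))" unfolding lin_def using Ei by simp
      also have "\<bar>\<dots>\<bar> \<le> (\<Sum>s\<in>Js. \<Sum>t\<in>Js. C * (C1 * \<epsilon>))"
      proof (intro order_trans[OF sum_abs] sum_mono)
        fix s t assume st: "s \<in> Js" "t \<in> Js"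
        show "\<bar>d s t * (\<integral>W. E s t W \<partial>?P)\<bar> \<le> C * (C1 * \<epsilon>)"
          unfolding abs_mult using d st C1'(2)[OF st] C0 by (intro mult_mono) auto
      qed
      finally show ?thesis .
    qed
    also have "C * (\<Sum>s\<in>Js. \<Sum>t\<in>Js. C1 * \<epsilon>) + (\<Sum>s\<in>Js. \<Sum>t\<in>Js. C * (C1 * \<epsilon>)) = 2 * C * C1 * N2 * \<epsilon>"
      by (simp add: N2_def)
    finally show ?thesis using fi unfolding f\<phi>[symmetric] h0_def T_def wl by simp
  qed
  have "0 \<le> 2 * C * C1 * N2" using C0 C10 by (simp add: N2_def)
  then show ?thesis unfolding law_close_def
    using main[unfolded X_def Js_def R_def] by (intro exI[of _ "2 * C * C1 * N2"]) blast
qed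

end

context whitened_network
begin

definition gram_err :: "nat \<Rightarrow> 's \<Rightarrow> 's \<Rightarrow> ('s \<Rightarrow> real) \<Rightarrow> real" where
  "gram_err l s t z = gram l z s t - (if s = t then 1 else 0)"

lemma gram_err_measurable:
  assumes "s \<in> J (Suc l)" "t \<in> J (Suc l)"
  shows "gram_err l s t \<in> borel_measurable (euclid (J l))"
  unfolding gram_err_def using gram_measurable[OF assms] by simp

text \<open>Activations grow linearly, so a Gram entry grows quadratically and the square of its
  error lies in the quartic class. \<open>1 \<le> K\<close> lets the same bound serve for the error
  itself.\<close>

lemma gram_err_growth:
  "\<exists>K\<ge>1. \<forall>s\<in>J (Suc l). \<forall>t\<in>J (Suc l). \<forall>z\<in>space (euclid (J l)). (gram_err l s t z)\<^sup>2 \<le> K * (1 + (\<Sum>j\<in>J l. z j ^ 4))"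
proof -
  obtain c where c0: "0 \<le> c" and c: "\<And>b s z. b \<in> {1..a (Suc l)} \<Longrightarrow> s \<in> J (Suc l) \<Longrightarrow> z \<in> space (euclid (J l)) \<Longrightarrow>
      \<bar>\<psi> (Suc l) z (b, s)\<bar> \<le> c * (1 + (\<Sum>j\<in>J l. \<bar>z j\<bar>))"
    using growth by blast
  define A where "A = real (a (Suc l)) * c\<^sup>2 + 1"
  define K where "K = A\<^sup>2 * (1 + real (card (J l))) ^ 3"
  have A1: "1 \<le> A" by (simp add: A_def)
  have K1: "1 \<le> K"
  proof -
    have "1 * 1 \<le> K" unfolding K_def using A1 by (intro mult_mono one_le_power) auto
    then show ?thesis by simp
  qed
  show ?thesis
  proof (intro exI[of _ K] conjI ballI)
    fix s t z assume st: "s \<in> J (Suc l)" "t \<in> J (Suc l)" and z: "z \<in> space (euclid (J l))"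
    define u where "u = 1 + (\<Sum>j\<in>J l. \<bar>z j\<bar>)"
    have u1: "1 \<le> u" by (simp add: u_def sum_nonneg)
    have "\<bar>gram l z s t\<bar> \<le> (\<Sum>b=1..a (Suc l). (c * u) * (c * u))"
      unfolding gram_def
    proof (intro order_trans[OF sum_abs] sum_mono)
      fix b assume "b \<in> {1..a (Suc l)}"
      then show "\<bar>\<psi> (Suc l) z (b, s) * \<psi> (Suc l) z (b, t)\<bar> \<le> (c * u) * (c * u)"
        unfolding abs_mult u_def using c st z c0 by (intro mult_mono) (auto intro!: mult_nonneg_nonneg add_nonneg_nonneg sum_nonneg)
    qed
    also have "\<dots> = real (a (Suc l)) * c\<^sup>2 * u\<^sup>2" by (simp add: power2_eq_square mult_ac)
    finally have "\<bar>gram_err l s t z\<bar> \<le> real (a (Suc l)) * c\<^sup>2 * u\<^sup>2 + 1" by (auto simp: gram_err_def)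
    also have "\<dots> \<le> real (a (Suc l)) * c\<^sup>2 * u\<^sup>2 + u\<^sup>2" using u1 by (simp add: one_le_power)
    also have "\<dots> = A * u\<^sup>2" by (simp add: A_def distrib_right)
    finally have "\<bar>gram_err l s t z\<bar>\<^sup>2 \<le> (A * u\<^sup>2)\<^sup>2" by (intro power_mono) auto
    then have "(gram_err l s t z)\<^sup>2 \<le> A\<^sup>2 * u ^ 4" by (simp add: power_mult_distrib)
    also have "\<dots> \<le> A\<^sup>2 * ((1 + real (card (J l))) ^ 3 * (1 + (\<Sum>j\<in>J l. z j ^ 4)))"
      unfolding u_def by (intro mult_left_mono sum_abs_power4_le fin) simp
    finally show "(gram_err l s t z)\<^sup>2 \<le> K * (1 + (\<Sum>j\<in>J l. z j ^ 4))" by (simp add: K_def)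
  qed (rule K1)
qed

lemma gram_err_mean:
  assumes st: "s \<in> J (Suc l)" "t \<in> J (Suc l)"
  shows "(\<integral>z. gram_err l s t z \<partial>std_gaussian (J l)) = 0"
proof -
  interpret prob_space "std_gaussian (J l)" by (rule prob_space_std_gaussian)
  obtain c where c0: "0 \<le> c" and c: "\<And>b s z. b \<in> {1..a (Suc l)} \<Longrightarrow> s \<in> J (Suc l) \<Longrightarrow> z \<in> space (euclid (J l)) \<Longrightarrow>
      \<bar>\<psi> (Suc l) z (b, s)\<bar> \<le> c * (1 + (\<Sum>j\<in>J l. \<bar>z j\<bar>))"
    using growth by blast
  have i: "integrable (std_gaussian (J l)) (\<lambda>z. \<psi> (Suc l) z (b, s) * \<psi> (Suc l) z (b, t))" if b: "b \<in> {1..a (Suc l)}" for b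
  proof (rule std_gaussian_integrable_growth(1)[OF fin])
    show "(\<lambda>z. \<psi> (Suc l) z (b, s) * \<psi> (Suc l) z (b, t)) \<in> borel_measurable (euclid (J l))"
      using meas b st by (intro borel_measurable_times) auto
    fix z assume z: "z \<in> space (euclid (J l))"
    define u where "u = 1 + (\<Sum>j\<in>J l. \<bar>z j\<bar>)"
    have u1: "1 \<le> u" by (simp add: u_def sum_nonneg)
    have "\<bar>\<psi> (Suc l) z (b, s) * \<psi> (Suc l) z (b, t)\<bar> \<le> (c * u) * (c * u)"
      unfolding abs_mult u_def using c st z b c0 by (intro mult_mono) (auto intro!: mult_nonneg_nonneg add_nonneg_nonneg sum_nonneg)
    also have "\<dots> = c\<^sup>2 * u\<^sup>2" by (simp add: power2_eq_square)
    also have "\<dots> \<le> c\<^sup>2 * u ^ 4" using u1 by (intro mult_left_mono power_increasing) auto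
    also have "\<dots> \<le> c\<^sup>2 * ((1 + real (card (J l))) ^ 3 * (1 + (\<Sum>j\<in>J l. z j ^ 4)))"
      unfolding u_def by (intro mult_left_mono sum_abs_power4_le fin) simp
    finally show "\<bar>\<psi> (Suc l) z (b, s) * \<psi> (Suc l) z (b, t)\<bar> \<le> (c\<^sup>2 * (1 + real (card (J l))) ^ 3) * (1 + (\<Sum>j\<in>J l. z j ^ 4))"
      by (simp add: mult.assoc)
  qed
  have "(\<integral>z. gram l z s t \<partial>std_gaussian (J l)) = (if s = t then 1 else 0)"
    unfolding gram_def using i white[OF st] by simp
  moreover have "integrable (std_gaussian (J l)) (\<lambda>z. gram l z s t)"
    unfolding gram_def using i by (intro Bochner_Integration.integrable_sum)
  ultimately show ?thesis unfolding gram_err_def by (simp add: prob_space)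
qed

lemma std_gaussian_row:
  fixes F :: "('s \<Rightarrow> real) \<Rightarrow> real"
  assumes F: "F \<in> borel_measurable (euclid (J l))"
  shows "(\<integral>z. F (row l z i) \<partial>std_gaussian ({i} \<times> J l)) = (\<integral>z. F z \<partial>std_gaussian (J l))"
proof -
  have inj: "inj_on (\<lambda>s. (i, s)) (J l)" by (simp add: inj_on_def)
  have map: "(\<lambda>s. (i, s)) \<in> J l \<rightarrow> {i} \<times> J l" by auto
  have pr: "\<And>j. j \<in> {i} \<times> J l \<Longrightarrow> prob_space std_normal_distribution" by (rule prob_space_normal_density) simp
  have "distr (std_gaussian ({i} \<times> J l)) (std_gaussian (J l)) (\<lambda>\<omega>. row l \<omega> i) = std_gaussian (J l)"
    unfolding row_def by (rule distr_PiM_reindex[where M = "\<lambda>_. std_normal_distribution" and f = "\<lambda>s. (i, s)", OF pr inj map])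
  then have "(\<integral>z. F z \<partial>std_gaussian (J l)) = (\<integral>z. F z \<partial>distr (std_gaussian ({i} \<times> J l)) (std_gaussian (J l)) (\<lambda>\<omega>. row l \<omega> i))"
    by (rule arg_cong[OF sym])
  also have "\<dots> = (\<integral>z. F (row l z i) \<partial>std_gaussian ({i} \<times> J l))"
  proof (rule integral_distr)
    show "(\<lambda>\<omega>. row l \<omega> i) \<in> measurable (std_gaussian ({i} \<times> J l)) (std_gaussian (J l))"
      unfolding measurable_cong_sets[OF std_gaussian_sets std_gaussian_sets] by (rule row_measurable) simp
    show "F \<in> borel_measurable (std_gaussian (J l))"
      using F unfolding measurable_cong_sets[OF std_gaussian_sets refl] .
  qed
  finally show ?thesis by (rule sym)
qed

text \<open>In the limit two rows are independent, so the integral over the second row already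
  produces the factor 0.\<close>

lemma std_gaussian_two_rows:
  fixes F :: "('s \<Rightarrow> real) \<Rightarrow> real"
  assumes F: "F \<in> borel_measurable (euclid (J l))" and mean: "(\<integral>z. F z \<partial>std_gaussian (J l)) = 0"
    and int: "integrable (std_gaussian ({1..2} \<times> J l)) (\<lambda>z. F (row l z 1) * F (row l z 2))"
  shows "(\<integral>z. F (row l z 1) * F (row l z 2) \<partial>std_gaussian ({1..2} \<times> J l)) = 0"
proof -
  interpret product_sigma_finite "\<lambda>_. std_normal_distribution"
    by (unfold product_sigma_finite_def) (blast intro: prob_space_imp_sigma_finite prob_space_normal_density zero_less_one)
  have X: "{1..2} \<times> J l = {1} \<times> J l \<union> {2::nat} \<times> J l" by (auto simp: le_Suc_eq numeral_2_eq_2)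
  have "(\<integral>z. F (row l z 1) * F (row l z 2) \<partial>std_gaussian ({1} \<times> J l \<union> {2} \<times> J l))
    = (\<integral>x. (\<integral>y. F (row l (merge ({1} \<times> J l) ({2} \<times> J l) (x, y)) 1) * F (row l (merge ({1} \<times> J l) ({2} \<times> J l) (x, y)) 2) \<partial>std_gaussian ({2} \<times> J l)) \<partial>std_gaussian ({1} \<times> J l))"
    by (rule product_integral_fold[OF _ _ _ int[unfolded X]]) (use fin in auto)
  also have "\<dots> = (\<integral>x. (\<integral>y. F (row l x 1) * F (row l y 2) \<partial>std_gaussian ({2} \<times> J l)) \<partial>std_gaussian ({1} \<times> J l))"
  proof -
    have "row l (merge ({1} \<times> J l) ({2} \<times> J l) (x, y)) 1 = row l x 1" "row l (merge ({1} \<times> J l) ({2} \<times> J l) (x, y)) 2 = row l y 2" for x y :: "nat \<times> 's \<Rightarrow> real"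
      by (auto simp: row_def merge_def fun_eq_iff restrict_def)
    then show ?thesis by simp
  qed
  also have "\<dots> = 0" by (simp add: std_gaussian_row[OF F] mean)
  finally show ?thesis unfolding X .
qed

lemma law_close_scaled:
  assumes "law_close l m"
  shows "\<exists>C\<ge>0. \<forall>n \<epsilon> r H K. admissible n l \<epsilon> \<longrightarrow> inj_on r {1..m} \<longrightarrow> r ` {1..m} \<subseteq> {1..n (Suc l)} \<longrightarrow>
     H \<in> borel_measurable (euclid ({1..m} \<times> J (Suc l))) \<longrightarrow> 0 < K \<longrightarrow>
     (\<forall>z\<in>space (euclid ({1..m} \<times> J (Suc l))). \<bar>H z\<bar> \<le> K * (1 + (\<Sum>x\<in>{1..m} \<times> J (Suc l). z x ^ 4))) \<longrightarrow>
     integrable (weight_law a n (Suc l)) (\<lambda>W. H (rows {1..m} r n W (Suc l))) \<and>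
     \<bar>(\<integral>W. H (rows {1..m} r n W (Suc l)) \<partial>weight_law a n (Suc l)) - (\<integral>z. H z \<partial>std_gaussian ({1..m} \<times> J (Suc l)))\<bar> \<le> K * C * \<epsilon>"
proof -
  obtain C where C0: "0 \<le> C" and C: "\<forall>n \<epsilon> r H. admissible n l \<epsilon> \<longrightarrow> inj_on r {1..m} \<longrightarrow> r ` {1..m} \<subseteq> {1..n (Suc l)} \<longrightarrow>
     H \<in> borel_measurable (euclid ({1..m} \<times> J (Suc l))) \<longrightarrow>
     (\<forall>z\<in>space (euclid ({1..m} \<times> J (Suc l))). \<bar>H z\<bar> \<le> 1 + (\<Sum>x\<in>{1..m} \<times> J (Suc l). z x ^ 4)) \<longrightarrow>
     integrable (weight_law a n (Suc l)) (\<lambda>W. H (rows {1..m} r n W (Suc l))) \<and>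
     \<bar>(\<integral>W. H (rows {1..m} r n W (Suc l)) \<partial>weight_law a n (Suc l)) - (\<integral>z. H z \<partial>std_gaussian ({1..m} \<times> J (Suc l)))\<bar> \<le> C * \<epsilon>"
    using assms unfolding law_close_def by (elim exE conjE)
  show ?thesis
  proof (intro exI[of _ C] conjI allI impI)
    fix n \<epsilon> r H and K :: real
    assume adm: "admissible n l \<epsilon>" and r: "inj_on r {1..m}" "r ` {1..m} \<subseteq> {1..n (Suc l)}"
      and H: "H \<in> borel_measurable (euclid ({1..m} \<times> J (Suc l)))" and K: "0 < K"
      and b: "\<forall>z\<in>space (euclid ({1..m} \<times> J (Suc l))). \<bar>H z\<bar> \<le> K * (1 + (\<Sum>x\<in>{1..m} \<times> J (Suc l). z x ^ 4))"
    have H': "(\<lambda>z. H z / K) \<in> borel_measurable (euclid ({1..m} \<times> J (Suc l)))" using H by simp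
    have b': "\<forall>z\<in>space (euclid ({1..m} \<times> J (Suc l))). \<bar>H z / K\<bar> \<le> 1 + (\<Sum>x\<in>{1..m} \<times> J (Suc l). z x ^ 4)"
      using b K by (simp add: abs_div pos_divide_le_eq mult.commute)
    note * = C[rule_format, OF adm r H' b'[rule_format]]
    have "integrable (weight_law a n (Suc l)) (\<lambda>W. K * (H (rows {1..m} r n W (Suc l)) / K))"
      using *[THEN conjunct1] by (rule integrable_mult_right)
    then show "integrable (weight_law a n (Suc l)) (\<lambda>W. H (rows {1..m} r n W (Suc l)))" using K by simp
    have "\<bar>((\<integral>W. H (rows {1..m} r n W (Suc l)) \<partial>weight_law a n (Suc l)) - (\<integral>z. H z \<partial>std_gaussian ({1..m} \<times> J (Suc l)))) / K\<bar> \<le> C * \<epsilon>"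
      using *[THEN conjunct2] by (simp add: diff_divide_distrib)
    then show "\<bar>(\<integral>W. H (rows {1..m} r n W (Suc l)) \<partial>weight_law a n (Suc l)) - (\<integral>z. H z \<partial>std_gaussian ({1..m} \<times> J (Suc l)))\<bar> \<le> K * C * \<epsilon>"
      using K by (simp add: abs_div pos_divide_le_eq mult_ac)
  qed (rule C0)
qed

text \<open>The off-diagonal terms of the second moment of the empirical covariance are controlled by the law
  of two rows: no conditional independence is needed.\<close>

lemma cov_close_Suc:
  assumes L1: "law_close l 1" and L2: "law_close l 2"
  shows "cov_close (Suc l)"
proof -
  define k where "k = Suc l"
  obtain C1 where C10: "0 \<le> C1" and C1: "\<forall>n \<epsilon> r H K. admissible n l \<epsilon> \<longrightarrow> inj_on r {1..1::nat} \<longrightarrow> r ` {1..1} \<subseteq> {1..n (Suc l)} \<longrightarrow>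
     H \<in> borel_measurable (euclid ({1..1} \<times> J (Suc l))) \<longrightarrow> 0 < K \<longrightarrow>
     (\<forall>z\<in>space (euclid ({1..1} \<times> J (Suc l))). \<bar>H z\<bar> \<le> K * (1 + (\<Sum>x\<in>{1..1} \<times> J (Suc l). z x ^ 4))) \<longrightarrow>
     integrable (weight_law a n (Suc l)) (\<lambda>W. H (rows {1..1} r n W (Suc l))) \<and>
     \<bar>(\<integral>W. H (rows {1..1} r n W (Suc l)) \<partial>weight_law a n (Suc l)) - (\<integral>z. H z \<partial>std_gaussian ({1..1} \<times> J (Suc l)))\<bar> \<le> K * C1 * \<epsilon>"
    using law_close_scaled[OF L1] by (elim exE conjE)
  obtain C2 where C20: "0 \<le> C2" and C2: "\<forall>n \<epsilon> r H K. admissible n l \<epsilon> \<longrightarrow> inj_on r {1..2::nat} \<longrightarrow> r ` {1..2} \<subseteq> {1..n (Suc l)} \<longrightarrow>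
     H \<in> borel_measurable (euclid ({1..2} \<times> J (Suc l))) \<longrightarrow> 0 < K \<longrightarrow>
     (\<forall>z\<in>space (euclid ({1..2} \<times> J (Suc l))). \<bar>H z\<bar> \<le> K * (1 + (\<Sum>x\<in>{1..2} \<times> J (Suc l). z x ^ 4))) \<longrightarrow>
     integrable (weight_law a n (Suc l)) (\<lambda>W. H (rows {1..2} r n W (Suc l))) \<and>
     \<bar>(\<integral>W. H (rows {1..2} r n W (Suc l)) \<partial>weight_law a n (Suc l)) - (\<integral>z. H z \<partial>std_gaussian ({1..2} \<times> J (Suc l)))\<bar> \<le> K * C2 * \<epsilon>"
    using law_close_scaled[OF L2] by (elim exE conjE)
  obtain K where K1: "1 \<le> K" and K: "\<forall>s\<in>J (Suc k). \<forall>t\<in>J (Suc k). \<forall>z\<in>space (euclid (J k)). (gram_err k s t z)\<^sup>2 \<le> K * (1 + (\<Sum>j\<in>J k. z j ^ 4))"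
    using gram_err_growth[of k] by (elim exE conjE)
  \<comment> \<open>The first two summands bound a diagonal term of the second moment, by closeness
    to its limit and by the limit itself; \<open>K * C2\<close> belongs to the off-diagonal terms,
    whose limit is 0.\<close>
  define D where "D = K * C1 + K * (1 + 3 * real (card (J k))) + K * C2"
  have main: "integrable (weight_law a n k) (\<lambda>W. (cov_err n W k s t)\<^sup>2) \<and>
     \<bar>\<integral>W. cov_err n W k s t \<partial>weight_law a n k\<bar> \<le> D * \<epsilon> \<and>
     (\<integral>W. (cov_err n W k s t)\<^sup>2 \<partial>weight_law a n k) \<le> D * \<epsilon>"
    if adm: "admissible n k \<epsilon>" and st: "s \<in> J (Suc k)" "t \<in> J (Suc k)" for n \<epsilon> s t
  proof -
    have adml: "admissible n l \<epsilon>" by (rule admissible_mono[OF adm]) (simp add: k_def)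
    have "k \<in> {1..k}" by (simp add: k_def)
    with adm have e: "0 \<le> \<epsilon>" "\<epsilon> \<le> 1" and n1: "1 \<le> n k" and ne: "1 / real (n k) \<le> \<epsilon>"
      unfolding admissible_def by blast+
    define F where "F = gram_err k s t"
    define N where "N = real (n k)"
    have N: "1 \<le> N" using n1 by (simp add: N_def)
    have Fm: "F \<in> borel_measurable (euclid (J k))" unfolding F_def by (rule gram_err_measurable[OF st])
    have F2: "(F z)\<^sup>2 \<le> K * (1 + (\<Sum>j\<in>J k. z j ^ 4))" if "z \<in> space (euclid (J k))" for z
      unfolding F_def by (rule K[rule_format, OF st that])
    \<comment> \<open>The bound on the square is at least 1 and hence at most its own square, so it
      bounds \<open>\<bar>F z\<bar>\<close> as well.\<close>
    have F1: "\<bar>F z\<bar> \<le> K * (1 + (\<Sum>j\<in>J k. z j ^ 4))" if "z \<in> space (euclid (J k))" for z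
    proof -
      define q where "q = (\<Sum>j\<in>J k. z j ^ 4)"
      have q: "0 \<le> q" by (simp add: q_def sum_nonneg)
      have "(F z)\<^sup>2 \<le> K * (1 + q)" using F2[OF that] by (simp add: q_def)
      also have "\<dots> \<le> (K * (1 + q)) * (K * (1 + q))"
      proof -
        have "1 * 1 \<le> K * (1 + q)" using K1 q by (intro mult_mono) auto
        then have "(K * (1 + q)) * 1 \<le> (K * (1 + q)) * (K * (1 + q))" using K1 q by (intro mult_left_mono) auto
        then show ?thesis by simp
      qed
      finally have "\<bar>F z\<bar>\<^sup>2 \<le> (K * (1 + q))\<^sup>2" by (simp add: power2_eq_square)
      moreover have "0 \<le> K * (1 + q)" using K1 q by (intro mult_nonneg_nonneg) linarith+
      ultimately show ?thesis unfolding q_def[symmetric] by (rule power2_le_imp_le)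
    qed
    have mean: "(\<integral>z. F z \<partial>std_gaussian (J k)) = 0" unfolding F_def by (rule gram_err_mean[OF st])
    define f where "f i W = F (row k (net n W k) i)" for i W
    have one: "integrable (weight_law a n k) (\<lambda>W. G (row k (net n W k) i)) \<and>
        \<bar>(\<integral>W. G (row k (net n W k) i) \<partial>weight_law a n k) - (\<integral>z. G z \<partial>std_gaussian (J k))\<bar> \<le> K * C1 * \<epsilon>"
      if i: "i \<in> {1..n k}" and G: "G \<in> borel_measurable (euclid (J k))"
        and Gb: "\<And>z. z \<in> space (euclid (J k)) \<Longrightarrow> \<bar>G z\<bar> \<le> K * (1 + (\<Sum>j\<in>J k. z j ^ 4))" for i G
    proof -
      define r where "r = (\<lambda>_::nat. i)"
      define H where "H z = G (row k z 1)" for z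
      have rr: "row k (rows {1..1} r n W k) 1 = row k (net n W k) i" for W
        by (auto simp: row_def rows_def r_def fun_eq_iff)
      have H: "H \<in> borel_measurable (euclid ({1..1} \<times> J (Suc l)))"
        unfolding H_def k_def[symmetric] using measurable_compose[OF row_measurable[of 1 "{1..1}" k] G] by simp
      have Hb: "\<bar>H z\<bar> \<le> K * (1 + (\<Sum>x\<in>{1..1} \<times> J (Suc l). z x ^ 4))" if "z \<in> space (euclid ({1..1} \<times> J (Suc l)))" for z
        using Gb[OF row_space[of k z 1]] by (simp add: H_def k_def[symmetric] sum.cartesian_product' row_def)
      have "inj_on r {1..1}" "r ` {1..1} \<subseteq> {1..n (Suc l)}" using i by (auto simp: r_def k_def)
      note c1 = C1[rule_format, OF adml this H _ Hb]
      from c1 K1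
      have *: "integrable (weight_law a n k) (\<lambda>W. H (rows {1..1} r n W k)) \<and>
        \<bar>(\<integral>W. H (rows {1..1} r n W k) \<partial>weight_law a n k) - (\<integral>z. H z \<partial>std_gaussian ({1..1} \<times> J k))\<bar> \<le> K * C1 * \<epsilon>"
        by (simp add: k_def[symmetric])
      have eq: "(\<integral>z. H z \<partial>std_gaussian ({1..1} \<times> J k)) = (\<integral>z. G z \<partial>std_gaussian (J k))"
        unfolding H_def using std_gaussian_row[OF G, of 1] by simp
      show ?thesis using *[unfolded eq] unfolding H_def rr .
    qed
    have two: "integrable (weight_law a n k) (\<lambda>W. f i W * f j W) \<and> \<bar>\<integral>W. f i W * f j W \<partial>weight_law a n k\<bar> \<le> K * C2 * \<epsilon>"
      if ij: "i \<in> {1..n k}" "j \<in> {1..n k}" "i \<noteq> j" for i j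
    proof -
      define r where "r = (\<lambda>m::nat. if m = 1 then i else j)"
      define H where "H z = F (row k z 1) * F (row k z 2)" for z
      have rr: "row k (rows {1..2} r n W k) 1 = row k (net n W k) i" "row k (rows {1..2} r n W k) 2 = row k (net n W k) j" for W
        by (auto simp: row_def rows_def r_def fun_eq_iff)
      have H: "H \<in> borel_measurable (euclid ({1..2} \<times> J (Suc l)))"
        unfolding H_def k_def[symmetric] using Fm
        by (intro borel_measurable_times measurable_compose[OF row_measurable[of 1 "{1..2}" k]] measurable_compose[OF row_measurable[of 2 "{1..2}" k]]) auto
      have Hb: "\<bar>H z\<bar> \<le> K * (1 + (\<Sum>x\<in>{1..2} \<times> J (Suc l). z x ^ 4))" for z
      proof -
        have two_set: "{1..2} = {1, 2::nat}" by auto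
        define u v where "u = F (row k z 1)" and "v = F (row k z 2)"
        define p q where "p = (\<Sum>j\<in>J k. z (1, j) ^ 4)" and "q = (\<Sum>j\<in>J k. z (2, j) ^ 4)"
        have "u\<^sup>2 \<le> K * (1 + p)" "v\<^sup>2 \<le> K * (1 + q)"
          using F2[OF row_space[of k z 1]] F2[OF row_space[of k z 2]] by (simp_all add: u_def v_def p_def q_def row_def)
        moreover have "2 * \<bar>u * v\<bar> \<le> u\<^sup>2 + v\<^sup>2"
        proof -
          have "0 \<le> (\<bar>u\<bar> - \<bar>v\<bar>)\<^sup>2" by simp
          then show ?thesis by (simp add: power2_eq_square algebra_simps abs_mult)
        qed
        ultimately have "2 * \<bar>u * v\<bar> \<le> K * (1 + p) + K * (1 + q)" by linarith
        also have "\<dots> \<le> 2 * (K * (1 + (p + q)))"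
        proof -
          have "0 \<le> p" "0 \<le> q" by (auto simp: p_def q_def sum_nonneg)
          then have "K * (1 + p) \<le> K * (1 + (p + q))" "K * (1 + q) \<le> K * (1 + (p + q))" using K1 by (auto intro!: mult_left_mono)
          then show ?thesis by linarith
        qed
        finally have le: "\<bar>u * v\<bar> \<le> K * (1 + (p + q))" by simp
        have "(\<Sum>x\<in>{1..2} \<times> J k. z x ^ 4) = (\<Sum>x\<in>{1, 2}. \<Sum>j\<in>J k. z (x, j) ^ 4)"
          unfolding two_set sum.cartesian_product' ..
        also have "\<dots> = p + q" by (simp add: p_def q_def)
        finally show ?thesis using le unfolding H_def u_def[symmetric] v_def[symmetric] k_def[symmetric] by (simp only:)
      qed
      have "inj_on r {1..2}" "r ` {1..2} \<subseteq> {1..n (Suc l)}" using ij by (auto simp: r_def k_def inj_on_def)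
      from C2[rule_format, OF adml this H _ Hb] K1
      have *: "integrable (weight_law a n k) (\<lambda>W. H (rows {1..2} r n W k)) \<and>
        \<bar>(\<integral>W. H (rows {1..2} r n W k) \<partial>weight_law a n k) - (\<integral>z. H z \<partial>std_gaussian ({1..2} \<times> J k))\<bar> \<le> K * C2 * \<epsilon>"
        by (simp add: k_def[symmetric])
      have "integrable (std_gaussian ({1..2} \<times> J k)) H"
        using fin by (intro std_gaussian_integrable_growth(1)[OF _ H[folded k_def] Hb[folded k_def]]) auto
      then have eq: "(\<integral>z. H z \<partial>std_gaussian ({1..2} \<times> J k)) = 0"
        unfolding H_def by (rule std_gaussian_two_rows[OF Fm mean])
      show ?thesis using *[unfolded eq diff_0_right] unfolding H_def rr f_def .
    qed
    have cov: "cov_err n W k s t = (\<Sum>i=1..n k. f i W) / N" for W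
    proof -
      have "(\<Sum>i=1..n k. f i W) = (\<Sum>i=1..n k. gram k (row k (net n W k) i) s t) - N * (if s = t then 1 else 0)"
        by (simp add: f_def F_def gram_err_def sum_subtractf N_def)
      then show ?thesis using N by (simp add: cov_err_def cov_def N_def diff_divide_distrib)
    qed
    have sq: "(cov_err n W k s t)\<^sup>2 = (\<Sum>i=1..n k. \<Sum>j=1..n k. f i W * f j W) / N\<^sup>2" for W
      by (simp add: cov power_divide power2_eq_square[of "sum _ _"] sum_product)
    have fi: "integrable (weight_law a n k) (f i)" "\<bar>\<integral>W. f i W \<partial>weight_law a n k\<bar> \<le> K * C1 * \<epsilon>" if "i \<in> {1..n k}" for i
      using one[OF that Fm F1] by (simp_all add: f_def[abs_def] mean)
    have ff: "integrable (weight_law a n k) (\<lambda>W. f i W * f i W)"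
      "\<bar>\<integral>W. f i W * f i W \<partial>weight_law a n k\<bar> \<le> K * C1 + K * (1 + 3 * real (card (J k)))" if i: "i \<in> {1..n k}" for i
    proof -
      have G: "(\<lambda>z. F z * F z) \<in> borel_measurable (euclid (J k))" using Fm by simp
      have Gb: "\<bar>F z * F z\<bar> \<le> K * (1 + (\<Sum>j\<in>J k. z j ^ 4))" if "z \<in> space (euclid (J k))" for z
        using F2[OF that] by (simp add: power2_eq_square)
      note * = one[OF i G Gb]
      show "integrable (weight_law a n k) (\<lambda>W. f i W * f i W)" using * by (simp add: f_def)
      have "\<bar>\<integral>z. F z * F z \<partial>std_gaussian (J k)\<bar> \<le> K * (1 + 3 * real (card (J k)))"
        by (rule std_gaussian_integrable_growth(2)[OF fin G Gb])
      moreover have "K * C1 * \<epsilon> \<le> K * C1" using e C10 K1 by (intro mult_left_le) auto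
      ultimately show "\<bar>\<integral>W. f i W * f i W \<partial>weight_law a n k\<bar> \<le> K * C1 + K * (1 + 3 * real (card (J k)))"
        using * unfolding f_def by linarith
    qed
    \<comment> \<open>Diagonal terms are merely bounded, but there are only \<open>N\<close> of them
      among \<open>N\<^sup>2\<close>, which leaves \<open>A / N \<le> A * \<epsilon>\<close>. The
      other terms are of order \<open>\<epsilon>\<close> one by one.\<close>
    define A where "A = K * C1 + K * (1 + 3 * real (card (J k)))"
    have A0: "0 \<le> A" using K1 C10 by (simp add: A_def)
    have gi: "integrable (weight_law a n k) (\<lambda>W. f i W * f j W)" if "i \<in> {1..n k}" "j \<in> {1..n k}" for i j
      using ff(1)[OF that(1)] two[OF that] by (cases "i = j") auto
    have gb: "\<bar>\<integral>W. f i W * f j W \<partial>weight_law a n k\<bar> \<le> (if i = j then A else 0) + K * C2 * \<epsilon>" if "i \<in> {1..n k}" "j \<in> {1..n k}" for i j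
    proof (cases "i = j")
      case True
      have "0 \<le> K * C2 * \<epsilon>" using K1 C20 e by simp
      then show ?thesis using ff(2)[OF that(1)] True by (simp add: A_def)
    qed (use two[OF that] in auto)
    have "integrable (weight_law a n k) (\<lambda>W. (cov_err n W k s t)\<^sup>2)"
      unfolding sq using gi by (intro Bochner_Integration.integrable_divide Bochner_Integration.integrable_sum) auto
    moreover have "\<bar>\<integral>W. cov_err n W k s t \<partial>weight_law a n k\<bar> \<le> D * \<epsilon>"
    proof -
      have "(\<integral>W. cov_err n W k s t \<partial>weight_law a n k) = (\<Sum>i=1..n k. \<integral>W. f i W \<partial>weight_law a n k) / N"
        unfolding cov using fi(1) by simp
      also have "\<bar>\<dots>\<bar> = \<bar>\<Sum>i=1..n k. \<integral>W. f i W \<partial>weight_law a n k\<bar> / N" using N by (simp add: abs_div)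
      also have "\<dots> \<le> (\<Sum>i=1..n k. K * C1 * \<epsilon>) / N"
        using N fi(2) by (intro divide_right_mono order_trans[OF sum_abs] sum_mono) auto
      also have "\<dots> = K * C1 * \<epsilon>" using N by (simp add: N_def)
      also have "\<dots> \<le> D * \<epsilon>" using e K1 C10 C20 by (intro mult_right_mono) (auto simp: D_def)
      finally show ?thesis .
    qed
    moreover have "(\<integral>W. (cov_err n W k s t)\<^sup>2 \<partial>weight_law a n k) \<le> D * \<epsilon>"
    proof -
      have "(\<integral>W. (cov_err n W k s t)\<^sup>2 \<partial>weight_law a n k) = (\<Sum>i=1..n k. \<Sum>j=1..n k. \<integral>W. f i W * f j W \<partial>weight_law a n k) / N\<^sup>2"
      proof -
        have "(\<integral>W. (\<Sum>i=1..n k. \<Sum>j=1..n k. f i W * f j W) \<partial>weight_law a n k)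
          = (\<Sum>i=1..n k. \<integral>W. (\<Sum>j=1..n k. f i W * f j W) \<partial>weight_law a n k)"
          using gi by (intro Bochner_Integration.integral_sum Bochner_Integration.integrable_sum)
        also have "\<dots> = (\<Sum>i=1..n k. \<Sum>j=1..n k. \<integral>W. f i W * f j W \<partial>weight_law a n k)"
          using gi by (intro sum.cong refl Bochner_Integration.integral_sum)
        finally show ?thesis unfolding sq by simp
      qed
      also have "\<dots> \<le> (\<Sum>i=1..n k. \<Sum>j=1..n k. (if i = j then A else 0) + K * C2 * \<epsilon>) / N\<^sup>2"
        by (intro divide_right_mono sum_mono order_trans[OF abs_ge_self gb]) auto
      also have "(\<Sum>i=1..n k. \<Sum>j=1..n k. (if i = j then A else 0) + K * C2 * \<epsilon>) = N * A + N\<^sup>2 * (K * C2 * \<epsilon>)"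
        by (simp add: sum.distrib N_def power2_eq_square algebra_simps)
      also have "(N * A + N\<^sup>2 * (K * C2 * \<epsilon>)) / N\<^sup>2 = A * (1 / N) + K * C2 * \<epsilon>"
        using N by (simp add: add_divide_distrib power2_eq_square)
      also have "\<dots> \<le> A * \<epsilon> + K * C2 * \<epsilon>" using mult_left_mono[OF ne A0] by (simp add: N_def)
      also have "\<dots> = D * \<epsilon>" by (simp add: D_def A_def algebra_simps)
      finally show ?thesis .
    qed
    ultimately show ?thesis by blast
  qed
  have "0 \<le> D" using K1 C10 C20 by (simp add: D_def)
  then show ?thesis unfolding cov_close_def using main by (intro exI[of _ D]) (simp add: k_def)
qed

text \<open>A covariance bound at layer \<open>l\<close> gives closeness for any number of rows of
  layer \<open>Suc l\<close>, and one and two rows are enough for the covariance bound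
  there.\<close>

theorem law_close: "law_close l m"
proof -
  have "cov_close l"
  proof (induction l)
    case 0
    show ?case by (rule cov_close_0)
  next
    case (Suc l)
    then show ?case by (intro cov_close_Suc law_close_if_cov_close)
  qed
  then show ?thesis by (rule law_close_if_cov_close)
qed

end

section \<open>Reduction to identity covariances\<close>

text \<open>\<open>centered_gaussian\<close> picks some square factor of \<open>K\<close>. Padding
  \<open>A\<close> with zero columns shows that one exists, so the chosen matrix is a factor, and
  two factors of one matrix give the same characteristic function.\<close>

lemma centered_gaussian_eq:
  assumes fin: "finite I" and J: "J \<subseteq> I" and AA: "\<And>s t. s \<in> I \<Longrightarrow> t \<in> I \<Longrightarrow> (\<Sum>j\<in>J. A s j * A t j) = K s t"
  shows "centered_gaussian I K = distr (std_gaussian J) (euclid I) (\<lambda>z. \<lambda>s\<in>I. \<Sum>j\<in>J. A s j * z j)"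
proof -
  define P where "P A' \<longleftrightarrow> (\<forall>s\<in>I. \<forall>t\<in>I. (\<Sum>u\<in>I. A' s u * A' t u) = K s t)" for A'
  define A0 where "A0 s u = (if u \<in> J then A s u else 0)" for s u
  have "P A0" unfolding P_def
  proof (intro ballI)
    fix s t assume "s \<in> I" "t \<in> I"
    have "(\<Sum>u\<in>I. A0 s u * A0 t u) = (\<Sum>u\<in>J. A0 s u * A0 t u)"
      using fin J by (intro sum.mono_neutral_right) (auto simp: A0_def)
    also have "\<dots> = K s t" using AA \<open>s \<in> I\<close> \<open>t \<in> I\<close> by (simp add: A0_def)
    finally show "(\<Sum>u\<in>I. A0 s u * A0 t u) = K s t" .
  qed
  then have P: "P (SOME A'. P A')" by (rule someI[where P = P])
  define A1 where "A1 = (SOME A'. P A')"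
  have A1: "(\<Sum>u\<in>I. A1 s u * A1 t u) = K s t" if "s \<in> I" "t \<in> I" for s t
    using P[folded A1_def] that unfolding P_def by blast
  have eq: "centered_gaussian I K = distr (std_gaussian I) (euclid I) (\<lambda>z. \<lambda>s\<in>I. \<Sum>u\<in>I. A1 s u * z u)"
    by (simp add: centered_gaussian_def A1_def P_def Let_def)
  show ?thesis unfolding eq
    by (rule gaussian_law_unique[OF fin gaussian_law_std[OF fin fin] gaussian_law_std[OF fin finite_subset[OF J fin]]])
      (simp add: A1 AA)
qed

lemma lipschitz1_product_integrable:
  assumes fin: "finite J" and f: "lipschitz1 J f" "lipschitz1 J g"
  shows "integrable (std_gaussian J) (\<lambda>z. f z * g z)"
proof -
  obtain c where c: "0 \<le> c" "\<And>z. z \<in> space (euclid J) \<Longrightarrow> \<bar>f z\<bar> \<le> c * (1 + (\<Sum>i\<in>J. \<bar>z i\<bar>))"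
    using lipschitz1_growth[OF f(1)] by blast
  obtain d where d: "0 \<le> d" "\<And>z. z \<in> space (euclid J) \<Longrightarrow> \<bar>g z\<bar> \<le> d * (1 + (\<Sum>i\<in>J. \<bar>z i\<bar>))"
    using lipschitz1_growth[OF f(2)] by blast
  show ?thesis
  proof (rule std_gaussian_integrable_growth(1)[OF fin])
    show "(\<lambda>z. f z * g z) \<in> borel_measurable (euclid J)"
      using lipschitz1_measurable[OF fin] f by (intro borel_measurable_times) auto
    fix z assume z: "z \<in> space (euclid J)"
    define u where "u = 1 + (\<Sum>j\<in>J. \<bar>z j\<bar>)"
    have u1: "1 \<le> u" by (simp add: u_def sum_nonneg)
    have "\<bar>f z\<bar> \<le> c * u" "\<bar>g z\<bar> \<le> d * u" using c(2)[OF z] d(2)[OF z] by (simp_all add: u_def)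
    then have "\<bar>f z * g z\<bar> \<le> (c * u) * (d * u)"
      unfolding abs_mult using c(1) u1 by (intro mult_mono) auto
    also have "\<dots> = c * d * u\<^sup>2" by (simp add: power2_eq_square)
    also have "\<dots> \<le> c * d * u ^ 4" using u1 c(1) d(1) by (intro mult_left_mono power_increasing) auto
    also have "\<dots> \<le> c * d * ((1 + real (card J)) ^ 3 * (1 + (\<Sum>j\<in>J. z j ^ 4)))"
      unfolding u_def using c(1) d(1) by (intro mult_left_mono sum_abs_power4_le fin) auto
    finally show "\<bar>f z * g z\<bar> \<le> (c * d * (1 + real (card J)) ^ 3) * (1 + (\<Sum>j\<in>J. z j ^ 4))"
      by (simp add: mult.assoc)
  qed
qed

text \<open>Here \<open>\<phi>\<close> is the activation composed with the map that represents the limiting law of the previous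
  layer. Since a standard Gaussian has full support and \<open>\<phi>\<close> is continuous, the values of \<open>\<phi>\<close> lie in the
  range of the covariance everywhere, even when the covariance is singular.\<close>

lemma gaussian_gram_psd:
  fixes \<phi> :: "('i \<Rightarrow> real) \<Rightarrow> nat \<Rightarrow> 't \<Rightarrow> real"
  assumes finJ: "finite J" and finI: "finite I" and lip: "\<And>b s. b \<in> {1..m} \<Longrightarrow> s \<in> I \<Longrightarrow> lipschitz1 J (\<lambda>z. \<phi> z b s)"
    and K: "\<And>s t. s \<in> I \<Longrightarrow> t \<in> I \<Longrightarrow> K s t = (\<Sum>b=1..m. \<integral>z. \<phi> z b s * \<phi> z b t \<partial>std_gaussian J)"
  shows "0 \<le> (\<Sum>s\<in>I. \<Sum>t\<in>I. w s * w t * K s t)"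
    and "\<lbrakk>(\<Sum>s\<in>I. \<Sum>t\<in>I. w s * w t * K s t) = 0; z \<in> space (euclid J); b \<in> {1..m}\<rbrakk> \<Longrightarrow> (\<Sum>s\<in>I. w s * \<phi> z b s) = 0"
proof -
  define q where "q b z = (\<Sum>s\<in>I. w s * \<phi> z b s)" for b z
  have ql: "lipschitz1 J (q b)" if "b \<in> {1..m}" for b
    unfolding q_def using lip that by (intro lipschitz1_sum finI) auto
  have int: "integrable (std_gaussian J) (\<lambda>z. \<phi> z b s * \<phi> z b t)" if "b \<in> {1..m}" "s \<in> I" "t \<in> I" for b s t
    using lip that by (intro lipschitz1_product_integrable finJ) auto
  have qi: "integrable (std_gaussian J) (\<lambda>z. q b z * q b z)" if "b \<in> {1..m}" for b
    by (intro lipschitz1_product_integrable finJ ql that)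
  have qint: "(\<integral>z. q b z * q b z \<partial>std_gaussian J) = (\<Sum>s\<in>I. \<Sum>t\<in>I. w s * w t * (\<integral>z. \<phi> z b s * \<phi> z b t \<partial>std_gaussian J))" if b: "b \<in> {1..m}" for b
  proof -
    have "q b z * q b z = (\<Sum>s\<in>I. \<Sum>t\<in>I. w s * w t * (\<phi> z b s * \<phi> z b t))" for z
      unfolding q_def sum_product by (intro sum.cong refl) (simp add: mult_ac)
    then have "(\<integral>z. q b z * q b z \<partial>std_gaussian J) = (\<integral>z. (\<Sum>s\<in>I. \<Sum>t\<in>I. w s * w t * (\<phi> z b s * \<phi> z b t)) \<partial>std_gaussian J)" by simp
    also have "\<dots> = (\<Sum>s\<in>I. \<integral>z. (\<Sum>t\<in>I. w s * w t * (\<phi> z b s * \<phi> z b t)) \<partial>std_gaussian J)"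
      using int[OF b] by (intro Bochner_Integration.integral_sum Bochner_Integration.integrable_sum integrable_mult_right)
    also have "\<dots> = (\<Sum>s\<in>I. \<Sum>t\<in>I. \<integral>z. w s * w t * (\<phi> z b s * \<phi> z b t) \<partial>std_gaussian J)"
      using int[OF b] by (intro sum.cong refl Bochner_Integration.integral_sum integrable_mult_right)
    finally show ?thesis by simp
  qed
  \<comment> \<open>The form at \<open>w\<close> is the second moment of the pairing of
    \<open>w\<close> with \<open>\<phi>\<close>, summed over \<open>b\<close>; nonnegativity and the
    kernel are both read off from this.\<close>
  have quad: "(\<Sum>s\<in>I. \<Sum>t\<in>I. w s * w t * K s t) = (\<Sum>b=1..m. \<integral>z. q b z * q b z \<partial>std_gaussian J)"
  proof -
    have "(\<Sum>s\<in>I. \<Sum>t\<in>I. w s * w t * K s t) = (\<Sum>s\<in>I. \<Sum>t\<in>I. \<Sum>b=1..m. w s * w t * (\<integral>z. \<phi> z b s * \<phi> z b t \<partial>std_gaussian J))"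
      by (intro sum.cong refl) (simp add: K sum_distrib_left)
    also have "\<dots> = (\<Sum>s\<in>I. \<Sum>b=1..m. \<Sum>t\<in>I. w s * w t * (\<integral>z. \<phi> z b s * \<phi> z b t \<partial>std_gaussian J))"
      by (intro sum.cong refl sum.swap)
    also have "\<dots> = (\<Sum>b=1..m. \<Sum>s\<in>I. \<Sum>t\<in>I. w s * w t * (\<integral>z. \<phi> z b s * \<phi> z b t \<partial>std_gaussian J))" by (rule sum.swap)
    also have "\<dots> = (\<Sum>b=1..m. \<integral>z. q b z * q b z \<partial>std_gaussian J)" using qint by (intro sum.cong) auto
    finally show ?thesis .
  qed
  have nn: "0 \<le> (\<integral>z. q b z * q b z \<partial>std_gaussian J)" for b by (intro Bochner_Integration.integral_nonneg) simp
  show "0 \<le> (\<Sum>s\<in>I. \<Sum>t\<in>I. w s * w t * K s t)" unfolding quad by (intro sum_nonneg nn)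
  assume 0: "(\<Sum>s\<in>I. \<Sum>t\<in>I. w s * w t * K s t) = 0" and z: "z \<in> space (euclid J)" and b: "b \<in> {1..m}"
  have "(\<integral>z. q b z * q b z \<partial>std_gaussian J) = 0"
    using 0 b nn unfolding quad by (subst (asm) sum_nonneg_eq_0_iff) auto
  then have "AE z in std_gaussian J. q b z * q b z = 0"
    using qi[OF b] by (subst (asm) integral_nonneg_eq_0_iff_AE) auto
  then have "AE z in std_gaussian J. q b z = 0" by eventually_elim simp
  from std_gaussian_AE_zero[OF finJ ql[OF b] this z] show "(\<Sum>s\<in>I. w s * \<phi> z b s) = 0" by (simp add: q_def)
qed

section \<open>Limiting laws as images of standard Gaussian laws\<close>

locale lipschitz_network =
  fixes S :: "nat \<Rightarrow> 's set" and a :: "nat \<Rightarrow> nat"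
    and \<sigma> :: "nat \<Rightarrow> ('s \<Rightarrow> real) \<Rightarrow> nat \<times> 's \<Rightarrow> real" and x :: "'s \<Rightarrow> real" and L :: nat
  assumes finS: "\<And>l. l \<le> L \<Longrightarrow> finite (S l)"
    and lip: "\<And>l. l \<in> {1..L} \<Longrightarrow> lipschitz_map (S (l - 1)) ({1..a l} \<times> S l) (\<sigma> l)"
begin

lemma activation_lipschitz1:
  assumes "Suc l \<le> L" "b \<in> {1..a (Suc l)}" "s \<in> S (Suc l)"
  shows "lipschitz1 (S l) (\<lambda>u. \<sigma> (Suc l) u (b, s))"
proof (rule lipschitz_map_component)
  show "lipschitz_map (S l) ({1..a (Suc l)} \<times> S (Suc l)) (\<sigma> (Suc l))" using lip[of "Suc l"] assms by simp
qed (use assms finS in auto)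

text \<open>The limiting law may live on a proper subspace or be a point mass, whereas the standard
  Gaussian of which it is an image has full support. The Lipschitz condition makes an activation
  composed with \<open>T\<close> a Lipschitz function of the standard coordinates.\<close>

definition represents :: "nat \<Rightarrow> 's set \<Rightarrow> (('s \<Rightarrow> real) \<Rightarrow> 's \<Rightarrow> real) \<Rightarrow> bool" where
  "represents l J T \<longleftrightarrow> finite J \<and> (\<forall>z\<in>space (euclid J). T z \<in> space (euclid (S l))) \<and>
     (\<forall>s\<in>S l. lipschitz1 J (\<lambda>z. T z s)) \<and> limit_law S a \<sigma> x l = distr (std_gaussian J) (euclid (S l)) T"

lemma represents_activation:
  assumes "represents l J T" "Suc l \<le> L" "b \<in> {1..a (Suc l)}" "s \<in> S (Suc l)"
  shows "lipschitz1 J (\<lambda>z. \<sigma> (Suc l) (T z) (b, s))"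
  using assms(1) finS assms(2) unfolding represents_def
  by (intro lipschitz1_compose[OF activation_lipschitz1[OF assms(2-4)]]) auto

lemma represents_covariance:
  assumes rep: "represents l J T" and l: "Suc l \<le> L" and st: "s \<in> S (Suc l)" "t \<in> S (Suc l)"
  shows "limit_covariance S a \<sigma> x (Suc l) s t
    = (\<Sum>b=1..a (Suc l). \<integral>z. \<sigma> (Suc l) (T z) (b, s) * \<sigma> (Suc l) (T z) (b, t) \<partial>std_gaussian J)"
proof -
  have fS: "finite (S l)" using finS l by simp
  have T: "T \<in> measurable (std_gaussian J) (euclid (S l))"
  proof -
    have "(\<lambda>z. \<lambda>s\<in>S l. T z s) \<in> measurable (euclid J) (euclid (S l))"
      unfolding euclid_def[of "S l"] using rep lipschitz1_measurable unfolding represents_def by (intro measurable_restrict) auto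
    moreover have "(\<lambda>s\<in>S l. T z s) = T z" if "z \<in> space (euclid J)" for z
      using rep that unfolding represents_def by (auto simp: space_euclid PiE_def extensional_def fun_eq_iff)
    ultimately have "T \<in> measurable (euclid J) (euclid (S l))" by (simp cong: measurable_cong)
    then show ?thesis unfolding measurable_cong_sets[OF std_gaussian_sets refl] .
  qed
  have "(\<integral>u. \<sigma> (Suc l) u (b, s) * \<sigma> (Suc l) u (b, t) \<partial>limit_law S a \<sigma> x l)
     = (\<integral>z. \<sigma> (Suc l) (T z) (b, s) * \<sigma> (Suc l) (T z) (b, t) \<partial>std_gaussian J)" if "b \<in> {1..a (Suc l)}" for b
  proof -
    have "(\<lambda>u. \<sigma> (Suc l) u (b, s) * \<sigma> (Suc l) u (b, t)) \<in> borel_measurable (euclid (S l))"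
      using activation_lipschitz1[OF l that] st by (intro borel_measurable_times lipschitz1_measurable fS) auto
    then show ?thesis using rep T unfolding represents_def by (simp add: integral_distr)
  qed
  then show ?thesis by (simp add: limit_covariance_def layer_covariance_def)
qed

lemma covariance_sym: "limit_covariance S a \<sigma> x l s t = limit_covariance S a \<sigma> x l t s"
  by (simp add: limit_covariance_def layer_covariance_def mult.commute)

definition factors :: "nat \<Rightarrow> 's set \<Rightarrow> ('s \<Rightarrow> 's \<Rightarrow> real) \<Rightarrow> ('s \<Rightarrow> 's \<Rightarrow> real) \<Rightarrow> bool" where
  "factors l J A B \<longleftrightarrow> J \<subseteq> S l \<and> (\<forall>s\<in>S l. \<forall>t\<in>S l. (\<Sum>j\<in>J. A s j * A t j) = limit_covariance S a \<sigma> x l s t)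
     \<and> (\<forall>i\<in>J. \<forall>j\<in>J. (\<Sum>s\<in>S l. B i s * A s j) = (if i = j then 1 else 0))"

lemma represents_0: "represents 0 {} (\<lambda>_. \<lambda>s\<in>S 0. x s)"
proof -
  have "distr (std_gaussian ({} :: 's set)) (euclid (S 0)) (\<lambda>_. \<lambda>s\<in>S 0. x s) = return (euclid (S 0)) (\<lambda>s\<in>S 0. x s)"
    by (rule prob_space.distr_const[OF prob_space_std_gaussian]) (simp add: space_euclid)
  then show ?thesis unfolding represents_def lipschitz1_def by (auto simp: space_euclid)
qed

lemma represents_Suc:
  assumes "factors (Suc l) J A B" and l: "Suc l \<le> L"
  shows "represents (Suc l) J (\<lambda>z. \<lambda>s\<in>S (Suc l). \<Sum>j\<in>J. A s j * z j)"
proof -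
  have f: "finite (S (Suc l))" using finS l by simp
  have J: "J \<subseteq> S (Suc l)" and finJ: "finite J" using assms f by (auto simp: factors_def intro: finite_subset)
  have "limit_law S a \<sigma> x (Suc l) = centered_gaussian (S (Suc l)) (limit_covariance S a \<sigma> x (Suc l))"
    by (simp add: limit_covariance_def[abs_def])
  also have "\<dots> = distr (std_gaussian J) (euclid (S (Suc l))) (\<lambda>z. \<lambda>s\<in>S (Suc l). \<Sum>j\<in>J. A s j * z j)"
    using assms by (intro centered_gaussian_eq[OF f J]) (auto simp: factors_def)
  finally show ?thesis unfolding represents_def using finJ lipschitz1_linear[OF finJ] by (auto simp: space_euclid)
qed

lemma factors_exist:
  assumes rep: "represents l J T" and l: "Suc l \<le> L"
  shows "\<exists>J A B. factors (Suc l) J A B"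
  unfolding factors_def
proof (rule psd_factorization)
  show f: "finite (S (Suc l))" using finS l by simp
  have "finite J" using rep by (simp add: represents_def)
  then show "0 \<le> (\<Sum>s\<in>S (Suc l). \<Sum>t\<in>S (Suc l). w s * w t * limit_covariance S a \<sigma> x (Suc l) s t)" for w
    by (rule gaussian_gram_psd(1)[OF _ f, where \<phi> = "\<lambda>z b s. \<sigma> (Suc l) (T z) (b, s)"])
      (use represents_activation[OF rep l] represents_covariance[OF rep l] in auto)
qed (rule covariance_sym)

lemma represents_exists: "l \<le> L \<Longrightarrow> \<exists>J T. represents l J T"
proof (induction l)
  case 0
  show ?case using represents_0 by blast
next
  case (Suc l)
  then obtain J T where "represents l J T" by auto
  from factors_exist[OF this Suc.prems] obtain J' A B where "factors (Suc l) J' A B" by blast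
  from represents_Suc[OF this Suc.prems] show ?case by blast
qed

text \<open>Layers beyond \<open>L\<close> get the empty set, so that the assumptions of
  \<open>whitened_network\<close>, which range over all layers, hold trivially there.\<close>

lemma all_factors_exist:
  "\<exists>J A B. J 0 = {} \<and> (\<forall>l>L. J l = {}) \<and> (\<forall>l. 1 \<le> l \<longrightarrow> l \<le> L \<longrightarrow> factors l (J l) (A l) (B l))"
proof -
  have "\<exists>J A B. factors l J A B" if l1: "1 \<le> l" and lL: "l \<le> L" for l
  proof -
    obtain k where k: "l = Suc k" using l1 by (cases l) auto
    obtain J T where "represents k J T" using represents_exists[of k] lL k by auto
    from factors_exist[OF this] lL k show ?thesis by simp
  qed
  then have "\<forall>l. \<exists>p. 1 \<le> l \<longrightarrow> l \<le> L \<longrightarrow> factors l (fst p) (fst (snd p)) (snd (snd p))" by (metis fst_conv snd_conv)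
  then obtain p where p: "\<forall>l. 1 \<le> l \<longrightarrow> l \<le> L \<longrightarrow> factors l (fst (p l)) (fst (snd (p l))) (snd (snd (p l)))" by (rule choice[THEN exE])
  show ?thesis
    by (intro exI[of _ "\<lambda>l. if 1 \<le> l \<and> l \<le> L then fst (p l) else {}"] exI[of _ "\<lambda>l. fst (snd (p l))"] exI[of _ "\<lambda>l. snd (snd (p l))"])
      (use p in auto)
qed

end

section \<open>The network in standard coordinates\<close>

locale factored_network = lipschitz_network S a \<sigma> x L
  for S :: "nat \<Rightarrow> 's set" and a :: "nat \<Rightarrow> nat"
    and \<sigma> :: "nat \<Rightarrow> ('s \<Rightarrow> real) \<Rightarrow> nat \<times> 's \<Rightarrow> real" and x :: "'s \<Rightarrow> real" and L :: nat +
  fixes J :: "nat \<Rightarrow> 's set" and A B :: "nat \<Rightarrow> 's \<Rightarrow> 's \<Rightarrow> real"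
  assumes J0: "J 0 = {}" and J_outside: "\<And>l. L < l \<Longrightarrow> J l = {}"
    and factored: "\<And>l. 1 \<le> l \<Longrightarrow> l \<le> L \<Longrightarrow> factors l (J l) (A l) (B l)"
begin

text \<open>From standard coordinates to the values of the limiting law. Layer 0 has no standard
  coordinates, so its lift is the constant input.\<close>

definition lift :: "nat \<Rightarrow> ('s \<Rightarrow> real) \<Rightarrow> 's \<Rightarrow> real" where
  "lift l z = (if l = 0 then (\<lambda>s\<in>S 0. x s) else (\<lambda>s\<in>S l. \<Sum>j\<in>J l. A l s j * z j))"

text \<open>The activation seen in standard coordinates: the left inverse \<open>B\<close> of the
  factor undoes the passage to the original index set.\<close>

definition reduced :: "nat \<Rightarrow> ('s \<Rightarrow> real) \<Rightarrow> nat \<times> 's \<Rightarrow> real" where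
  "reduced l z = (\<lambda>(b, j). \<Sum>s\<in>S l. B l j s * \<sigma> l (lift (l - 1) z) (b, s))"

lemma finJ: "finite (J l)"
proof (cases "1 \<le> l \<and> l \<le> L")
  case True
  then show ?thesis using factored[of l] finS[of l] by (auto simp: factors_def intro: finite_subset)
next
  case False
  then have "l = 0 \<or> L < l" by auto
  then show ?thesis using J0 J_outside by auto
qed

lemma represents_lift: "l \<le> L \<Longrightarrow> represents l (J l) (lift l)"
proof (cases l)
  case 0
  then show ?thesis using represents_0 by (simp add: J0 lift_def[abs_def])
next
  case (Suc k)
  assume "l \<le> L"
  with Suc represents_Suc[OF factored[of "Suc k"]] show ?thesis by (simp add: lift_def[abs_def])
qed

lemma reduced_lipschitz1:
  assumes l: "Suc l \<le> L" and b: "b \<in> {1..a (Suc l)}"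
  shows "lipschitz1 (J l) (\<lambda>z. reduced (Suc l) z (b, j))"
  unfolding reduced_def prod.case diff_Suc_1
  using represents_activation[OF represents_lift l b] l finS by (intro lipschitz1_sum) auto

text \<open>By \<open>gaussian_gram_psd\<close> the activations at \<open>lift l z\<close> are
  orthogonal to the kernel of the covariance, and on such vectors \<open>A B\<close> is the identity
  by \<open>range_of_factor\<close>. This holds at every \<open>z\<close>, hence also at the values
  that a network of finite width takes.\<close>

lemma activation_lift:
  assumes l: "Suc l \<le> L" and z: "z \<in> space (euclid (J l))" and b: "b \<in> {1..a (Suc l)}" and s: "s \<in> S (Suc l)"
  shows "(\<Sum>j\<in>J (Suc l). A (Suc l) s j * reduced (Suc l) z (b, j)) = \<sigma> (Suc l) (lift l z) (b, s)"
  unfolding reduced_def prod.case diff_Suc_1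
proof (rule range_of_factor[where K = "limit_covariance S a \<sigma> x (Suc l)"])
  have rep: "represents l (J l) (lift l)" using l by (intro represents_lift) simp
  show f: "finite (S (Suc l))" using finS l by simp
  fix w assume w: "(\<Sum>s\<in>S (Suc l). \<Sum>t\<in>S (Suc l). w s * w t * limit_covariance S a \<sigma> x (Suc l) s t) = 0"
  show "(\<Sum>s\<in>S (Suc l). w s * \<sigma> (Suc l) (lift l z) (b, s)) = 0"
    by (rule gaussian_gram_psd(2)[OF finJ f _ _ w z b, where \<phi> = "\<lambda>z b s. \<sigma> (Suc l) (lift l z) (b, s)"])
      (use represents_activation[OF rep l] represents_covariance[OF rep l] in auto)
qed (use factored[of "Suc l"] l s finJ in \<open>auto simp: factors_def\<close>)

sublocale whitened: whitened_network J a reduced x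
proof
  show "J 0 = {}" by (rule J0)
  show "finite (J l)" for l by (rule finJ)
  fix l
  show "\<exists>c\<ge>0. \<forall>b\<in>{1..a (Suc l)}. \<forall>s\<in>J (Suc l). \<forall>z\<in>space (euclid (J l)). \<bar>reduced (Suc l) z (b, s)\<bar> \<le> c * (1 + (\<Sum>j\<in>J l. \<bar>z j\<bar>))"
  proof (cases "Suc l \<le> L")
    case True
    define P where "P = {1..a (Suc l)} \<times> J (Suc l)"
    have "\<forall>p\<in>P. \<exists>c\<ge>0. \<forall>z\<in>space (euclid (J l)). \<bar>reduced (Suc l) z p\<bar> \<le> c * (1 + (\<Sum>j\<in>J l. \<bar>z j\<bar>))"
      using lipschitz1_growth[OF reduced_lipschitz1[OF True]] by (auto simp: P_def)
    then obtain c where c: "\<forall>p\<in>P. 0 \<le> c p \<and> (\<forall>z\<in>space (euclid (J l)). \<bar>reduced (Suc l) z p\<bar> \<le> c p * (1 + (\<Sum>j\<in>J l. \<bar>z j\<bar>)))"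
      by (rule bchoice[THEN exE])
    have finP: "finite P" using finJ by (simp add: P_def)
    show ?thesis
    proof (intro exI[of _ "\<Sum>p\<in>P. c p"] conjI ballI)
      show "0 \<le> (\<Sum>p\<in>P. c p)" using c by (intro sum_nonneg) auto
      fix b s z assume bs: "b \<in> {1..a (Suc l)}" "s \<in> J (Suc l)" and z: "z \<in> space (euclid (J l))"
      have p: "(b, s) \<in> P" using bs by (simp add: P_def)
      have "\<bar>reduced (Suc l) z (b, s)\<bar> \<le> c (b, s) * (1 + (\<Sum>j\<in>J l. \<bar>z j\<bar>))" using c p z by blast
      also have "\<dots> \<le> (\<Sum>p\<in>P. c p) * (1 + (\<Sum>j\<in>J l. \<bar>z j\<bar>))"
        using c p finP by (intro mult_right_mono member_le_sum) (auto intro!: add_nonneg_nonneg sum_nonneg)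
      finally show "\<bar>reduced (Suc l) z (b, s)\<bar> \<le> (\<Sum>p\<in>P. c p) * (1 + (\<Sum>j\<in>J l. \<bar>z j\<bar>))" .
    qed
  next
    case False
    then show ?thesis using J_outside[of "Suc l"] by (intro exI[of _ 0]) auto
  qed
  fix s assume s: "s \<in> J (Suc l)"
  then have l: "Suc l \<le> L" using J_outside[of "Suc l"] by (cases "Suc l \<le> L") auto
  show "(\<lambda>z. reduced (Suc l) z (b, s)) \<in> borel_measurable (euclid (J l))" if "b \<in> {1..a (Suc l)}" for b
    by (rule lipschitz1_measurable[OF finJ reduced_lipschitz1[OF l that]])
  fix t assume t: "t \<in> J (Suc l)"
  have rep: "represents l (J l) (lift l)" using l by (intro represents_lift) simp
  define f where "f b u z = \<sigma> (Suc l) (lift l z) (b, u)" for b u z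
  let ?I = "S (Suc l)"
  have fint: "integrable (std_gaussian (J l)) (\<lambda>z. f b u z * f b v z)" if "b \<in> {1..a (Suc l)}" "u \<in> ?I" "v \<in> ?I" for b u v
    unfolding f_def using represents_activation[OF rep l that(1)] that by (intro lipschitz1_product_integrable finJ) auto
  have fac: "factors (Suc l) (J (Suc l)) (A (Suc l)) (B (Suc l))" using factored l by simp
  \<comment> \<open>The covariance of the reduced activations is \<open>B K\<close> times the
    transpose of \<open>B\<close>. With \<open>K\<close> equal to \<open>A\<close> times its
    transpose, \<open>B A = 1\<close> makes this the identity.\<close>
  have "(\<Sum>b=1..a (Suc l). \<integral>z. reduced (Suc l) z (b, s) * reduced (Suc l) z (b, t) \<partial>std_gaussian (J l))
    = (\<Sum>b=1..a (Suc l). \<Sum>u\<in>?I. \<Sum>v\<in>?I. B (Suc l) s u * B (Suc l) t v * (\<integral>z. f b u z * f b v z \<partial>std_gaussian (J l)))"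
  proof (rule sum.cong[OF refl])
    fix b assume b: "b \<in> {1..a (Suc l)}"
    have "reduced (Suc l) z (b, s) * reduced (Suc l) z (b, t) = (\<Sum>u\<in>?I. \<Sum>v\<in>?I. B (Suc l) s u * B (Suc l) t v * (f b u z * f b v z))" for z
      unfolding reduced_def f_def prod.case diff_Suc_1 sum_product by (intro sum.cong refl) (simp add: mult_ac)
    then have "(\<integral>z. reduced (Suc l) z (b, s) * reduced (Suc l) z (b, t) \<partial>std_gaussian (J l))
      = (\<integral>z. (\<Sum>u\<in>?I. \<Sum>v\<in>?I. B (Suc l) s u * B (Suc l) t v * (f b u z * f b v z)) \<partial>std_gaussian (J l))" by simp
    also have "\<dots> = (\<Sum>u\<in>?I. \<integral>z. (\<Sum>v\<in>?I. B (Suc l) s u * B (Suc l) t v * (f b u z * f b v z)) \<partial>std_gaussian (J l))"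
      using fint[OF b] by (intro Bochner_Integration.integral_sum Bochner_Integration.integrable_sum integrable_mult_right)
    also have "\<dots> = (\<Sum>u\<in>?I. \<Sum>v\<in>?I. \<integral>z. B (Suc l) s u * B (Suc l) t v * (f b u z * f b v z) \<partial>std_gaussian (J l))"
      using fint[OF b] by (intro sum.cong refl Bochner_Integration.integral_sum integrable_mult_right)
    finally show "(\<integral>z. reduced (Suc l) z (b, s) * reduced (Suc l) z (b, t) \<partial>std_gaussian (J l))
      = (\<Sum>u\<in>?I. \<Sum>v\<in>?I. B (Suc l) s u * B (Suc l) t v * (\<integral>z. f b u z * f b v z \<partial>std_gaussian (J l)))" by simp
  qed
  also have "\<dots> = (\<Sum>u\<in>?I. \<Sum>v\<in>?I. \<Sum>b=1..a (Suc l). B (Suc l) s u * B (Suc l) t v * (\<integral>z. f b u z * f b v z \<partial>std_gaussian (J l)))"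
    by (subst sum.swap, intro sum.cong refl, subst sum.swap) simp
  also have "\<dots> = (\<Sum>u\<in>?I. \<Sum>v\<in>?I. B (Suc l) s u * B (Suc l) t v * (\<Sum>j\<in>J (Suc l). A (Suc l) u j * A (Suc l) v j))"
  proof (intro sum.cong refl)
    fix u v assume uv: "u \<in> ?I" "v \<in> ?I"
    have "(\<Sum>j\<in>J (Suc l). A (Suc l) u j * A (Suc l) v j) = (\<Sum>b=1..a (Suc l). \<integral>z. f b u z * f b v z \<partial>std_gaussian (J l))"
      using fac uv represents_covariance[OF rep l uv] unfolding factors_def f_def by simp
    then show "(\<Sum>b=1..a (Suc l). B (Suc l) s u * B (Suc l) t v * (\<integral>z. f b u z * f b v z \<partial>std_gaussian (J l)))
      = B (Suc l) s u * B (Suc l) t v * (\<Sum>j\<in>J (Suc l). A (Suc l) u j * A (Suc l) v j)" by (simp add: sum_distrib_left)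
  qed
  also have "\<dots> = (\<Sum>u\<in>?I. \<Sum>v\<in>?I. \<Sum>j\<in>J (Suc l). (B (Suc l) s u * A (Suc l) u j) * (B (Suc l) t v * A (Suc l) v j))"
    by (simp add: sum_distrib_left mult_ac)
  also have "\<dots> = (\<Sum>j\<in>J (Suc l). \<Sum>u\<in>?I. \<Sum>v\<in>?I. (B (Suc l) s u * A (Suc l) u j) * (B (Suc l) t v * A (Suc l) v j))"
    by (subst (2) sum.swap, subst sum.swap) simp
  also have "\<dots> = (\<Sum>j\<in>J (Suc l). (if s = j then 1 else 0) * (if t = j then 1 else 0))"
    using fac s t by (intro sum.cong refl) (simp add: sum_product[symmetric] factors_def)
  also have "\<dots> = (if s = t then 1 else 0)"
    using s finJ by (simp add: if_distrib[of "\<lambda>u. u * _"] cong: if_cong)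
  finally show "(\<Sum>b=1..a (Suc l). \<integral>z. reduced (Suc l) z (b, s) * reduced (Suc l) z (b, t) \<partial>std_gaussian (J l)) = (if s = t then 1 else 0)" .
qed

text \<open>Weights act on neurons and channels, \<open>A\<close> on the index inside a neuron, so
  the two operations commute. With \<open>activation_lift\<close> this carries the identity from
  layer to layer, for each fixed \<open>W\<close>.\<close>

lemma network_eq_lift:
  assumes "l \<le> L" "i \<in> {1..n l}"
  shows "(\<lambda>s\<in>S l. network S a n \<sigma> x W l (i, s)) = lift l (whitened.row l (network J a n reduced x W l) i)"
  using assms
proof (induction l arbitrary: i)
  case 0
  then show ?case by (auto simp: lift_def fun_eq_iff)
next
  case (Suc l)
  define z where "z j = whitened.row l (network J a n reduced x W l) j" for j
  have zs: "z j \<in> space (euclid (J l))" for j unfolding z_def by (rule whitened.row_space)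
  have l: "Suc l \<le> L" by fact
  show ?case
  proof
    fix s
    show "(\<lambda>s\<in>S (Suc l). network S a n \<sigma> x W (Suc l) (i, s)) s = lift (Suc l) (whitened.row (Suc l) (network J a n reduced x W (Suc l)) i) s"
    proof (cases "s \<in> S (Suc l)")
      case s: True
      have "network S a n \<sigma> x W (Suc l) (i, s) = (\<Sum>k=1..n l. \<Sum>b=1..a (Suc l). W (Suc l, i, k, b) * \<sigma> (Suc l) (\<lambda>t\<in>S l. network S a n \<sigma> x W l (k, t)) (b, s))"
        using Suc.prems s by simp
      also have "\<dots> = (\<Sum>k=1..n l. \<Sum>b=1..a (Suc l). W (Suc l, i, k, b) * (\<Sum>j\<in>J (Suc l). A (Suc l) s j * reduced (Suc l) (z k) (b, j)))"
      proof (intro sum.cong refl)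
        fix k b assume k: "k \<in> {1..n l}" and b: "b \<in> {1..a (Suc l)}"
        have "(\<lambda>t\<in>S l. network S a n \<sigma> x W l (k, t)) = lift l (z k)"
          unfolding z_def by (rule Suc.IH[OF _ k]) (use l in simp)
        then show "W (Suc l, i, k, b) * \<sigma> (Suc l) (\<lambda>t\<in>S l. network S a n \<sigma> x W l (k, t)) (b, s)
          = W (Suc l, i, k, b) * (\<Sum>j\<in>J (Suc l). A (Suc l) s j * reduced (Suc l) (z k) (b, j))"
          by (simp only: activation_lift[OF l zs b s])
      qed
      also have "\<dots> = (\<Sum>k=1..n l. \<Sum>j\<in>J (Suc l). \<Sum>b=1..a (Suc l). A (Suc l) s j * (W (Suc l, i, k, b) * reduced (Suc l) (z k) (b, j)))"
        by (intro sum.cong refl, subst sum.swap) (simp add: sum_distrib_left mult_ac)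
      also have "\<dots> = (\<Sum>j\<in>J (Suc l). A (Suc l) s j * (\<Sum>k=1..n l. \<Sum>b=1..a (Suc l). W (Suc l, i, k, b) * reduced (Suc l) (z k) (b, j)))"
        by (subst sum.swap) (simp add: sum_distrib_left)
      also have "\<dots> = (\<Sum>j\<in>J (Suc l). A (Suc l) s j * network J a n reduced x W (Suc l) (i, j))"
        using Suc.prems by (intro sum.cong refl) (simp add: z_def whitened.row_def)
      finally show ?thesis using s by (simp add: lift_def whitened.row_def del: network.simps)
    qed (simp add: lift_def)
  qed
qed

end

text \<open>Independence of the copies turns the characteristic function into a product, whose
  exponents add up to the form of the block covariance.\<close>

lemma gaussian_law_PiM:
  assumes finR: "finite R" and finI: "finite I" and law: "gaussian_law I K \<mu>"
  shows "gaussian_law (R \<times> I) (block_cov K)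
    (distr (\<Pi>\<^sub>M i\<in>R. \<mu>) (euclid (R \<times> I)) (\<lambda>h. \<lambda>(i, s)\<in>R \<times> I. h i s))"
proof -
  interpret \<mu>: prob_space \<mu> using law by (simp add: gaussian_law_def)
  interpret product_sigma_finite "\<lambda>_. \<mu>" by (simp add: product_sigma_finite_def \<mu>.sigma_finite_measure_axioms)
  let ?P = "\<Pi>\<^sub>M i\<in>R. \<mu>" and ?f = "\<lambda>h. \<lambda>(i, s)\<in>R \<times> I. h i s"
  have s: "sets \<mu> = sets (\<Pi>\<^sub>M s\<in>I. borel)" using law by (simp add: gaussian_law_def euclid_def)
  have entry: "(\<lambda>u. u s) \<in> borel_measurable \<mu>" if "s \<in> I" for s
    using measurable_component_singleton[OF that, of "\<lambda>_. borel"] unfolding measurable_cong_sets[OF s refl] by simp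
  have f: "?f \<in> measurable ?P (euclid (R \<times> I))" unfolding euclid_def
  proof (rule measurable_restrict)
    fix p assume "p \<in> R \<times> I"
    then obtain i t where p: "p = (i, t)" "i \<in> R" "t \<in> I" by auto
    from measurable_compose[OF measurable_component_singleton[OF p(2), of "\<lambda>_. \<mu>"] entry[OF p(3)]]
    show "(\<lambda>h. case p of (i, s) \<Rightarrow> h i s) \<in> borel_measurable ?P" by (simp add: p)
  qed
  interpret P: prob_space ?P by (intro prob_space_PiM \<mu>.prob_space_axioms)
  have "(\<integral>u. cis (\<Sum>p\<in>R \<times> I. t p * u p) \<partial>distr ?P (euclid (R \<times> I)) ?f)
    = complex_of_real (exp (- (\<Sum>p\<in>R \<times> I. \<Sum>q\<in>R \<times> I. t p * t q * block_cov K p q) / 2))" for t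
  proof -
    have m: "(\<lambda>x. \<Sum>p\<in>R \<times> I. t p * x p) \<in> borel_measurable (euclid (R \<times> I))" unfolding euclid_def by measurable
    have mi: "(\<lambda>u. \<Sum>s\<in>I. t (i, s) * u s) \<in> borel_measurable \<mu>" for i
      using entry by (intro borel_measurable_sum borel_measurable_times) auto
    have "(\<integral>u. cis (\<Sum>p\<in>R \<times> I. t p * u p) \<partial>distr ?P (euclid (R \<times> I)) ?f) = (\<integral>h. cis (\<Sum>p\<in>R \<times> I. t p * ?f h p) \<partial>?P)"
      by (intro integral_distr[OF f] cis_borel_measurable m)
    also have "\<dots> = (\<integral>h. (\<Prod>i\<in>R. cis (\<Sum>s\<in>I. t (i, s) * h i s)) \<partial>?P)"
    proof (rule Bochner_Integration.integral_cong[OF refl])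
      fix h :: "'a \<Rightarrow> 'b \<Rightarrow> real"
      have e: "(\<Sum>p\<in>R \<times> I. t p * ?f h p) = (\<Sum>i\<in>R. \<Sum>s\<in>I. t (i, s) * h i s)"
        by (simp add: sum.cartesian_product' cong: sum.cong)
      show "cis (\<Sum>p\<in>R \<times> I. t p * ?f h p) = (\<Prod>i\<in>R. cis (\<Sum>s\<in>I. t (i, s) * h i s))"
        unfolding e cis_conv_exp exp_sum[OF finR, symmetric] by (simp add: sum_distrib_left)
    qed
    also have "\<dots> = (\<Prod>i\<in>R. \<integral>u. cis (\<Sum>s\<in>I. t (i, s) * u s) \<partial>\<mu>)"
    proof (rule product_integral_prod[OF finR])
      show "integrable \<mu> (\<lambda>u. cis (\<Sum>s\<in>I. t (i, s) * u s))" for i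
        using mi[of i] by (intro \<mu>.integrable_const_bound[where B = 1]) auto
    qed
    also have "\<dots> = (\<Prod>i\<in>R. complex_of_real (exp (- (\<Sum>s\<in>I. \<Sum>s'\<in>I. t (i, s) * t (i, s') * K s s') / 2)))"
      using law by (simp add: gaussian_law_def)
    also have "\<dots> = complex_of_real (exp (\<Sum>i\<in>R. - (\<Sum>s\<in>I. \<Sum>s'\<in>I. t (i, s) * t (i, s') * K s s') / 2))"
      by (simp add: exp_sum[OF finR])
    also have "(\<Sum>i\<in>R. - (\<Sum>s\<in>I. \<Sum>s'\<in>I. t (i, s) * t (i, s') * K s s') / 2)
      = - (\<Sum>i\<in>R. \<Sum>s\<in>I. \<Sum>s'\<in>I. t (i, s) * t (i, s') * K s s') / 2"
      by (simp add: sum_negf sum_divide_distrib)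
    also have "(\<Sum>i\<in>R. \<Sum>s\<in>I. \<Sum>s'\<in>I. t (i, s) * t (i, s') * K s s') = (\<Sum>p\<in>R \<times> I. \<Sum>q\<in>R \<times> I. t p * t q * block_cov K p q)"
    proof -
      have "(\<Sum>q\<in>R \<times> I. t (i, s) * t q * block_cov K (i, s) q) = (\<Sum>s'\<in>I. t (i, s) * t (i, s') * K s s')" if "i \<in> R" for i s
      proof -
        have "(\<Sum>q\<in>R \<times> I. t (i, s) * t q * block_cov K (i, s) q) = (\<Sum>k\<in>R. if i = k then (\<Sum>s'\<in>I. t (i, s) * t (k, s') * K s s') else 0)"
          unfolding sum.cartesian_product' by (intro sum.cong refl) simp
        then show ?thesis using finR that by simp
      qed
      then show ?thesis by (simp add: sum.cartesian_product'[of _ R I] cong: sum.cong)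
    qed
    finally show ?thesis .
  qed
  then show ?thesis unfolding gaussian_law_def using P.prob_space_distr[OF f] by simp
qed

text \<open>For \<open>L = 1\<close> the infimum over the empty set is infinite and its inverse 0;
  otherwise the minimum is attained. The range ends at \<open>L - 1\<close>, so the output width
  does not count.\<close>

lemma min_width_bounds:
  assumes pos: "\<forall>i\<in>{1..L}. 1 \<le> n i"
  shows "0 \<le> inverse_min_width L n" "inverse_min_width L n \<le> 1"
    and "i \<in> {1..L - 1} \<Longrightarrow> 1 / real (n i) \<le> inverse_min_width L n"
    and "0 < c \<Longrightarrow> ereal c \<le> min_width L n \<Longrightarrow> inverse_min_width L n \<le> 1 / c"
proof -
  have "0 \<le> inverse_min_width L n \<and> inverse_min_width L n \<le> 1
    \<and> (i \<in> {1..L - 1} \<longrightarrow> 1 / real (n i) \<le> inverse_min_width L n)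
    \<and> (0 < c \<longrightarrow> ereal c \<le> min_width L n \<longrightarrow> inverse_min_width L n \<le> 1 / c)"
  proof (cases "{1..L - 1} = {}")
    case True
    then have "min_width L n = \<infinity>" unfolding min_width_def True by (simp add: top_ereal_def)
    then have "inverse_min_width L n = 0" by (simp add: inverse_min_width_def)
    then show ?thesis using True by auto
  next
    case False
    define w where "w = Min (n ` {1..L - 1})"
    have fne: "finite (n ` {1..L - 1})" "n ` {1..L - 1} \<noteq> {}" using False by auto
    have wle: "w \<le> n i" if "i \<in> {1..L - 1}" for i unfolding w_def using that by (intro Min_le) auto
    obtain k where k: "k \<in> {1..L - 1}" "w = n k" using Min_in[OF fne] by (auto simp: w_def)
    have w1: "1 \<le> w" using pos k by auto
    have mw: "min_width L n = ereal (real w)" unfolding min_width_def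
    proof (rule antisym)
      show "(INF i\<in>{1..L - 1}. ereal (real (n i))) \<le> ereal (real w)" unfolding k(2) using k(1) by (rule INF_lower)
      show "ereal (real w) \<le> (INF i\<in>{1..L - 1}. ereal (real (n i)))" using wle by (intro INF_greatest) simp
    qed
    have iw: "inverse_min_width L n = 1 / real w"
      using w1 by (simp add: inverse_min_width_def mw one_ereal_def)
    show ?thesis unfolding iw mw using w1 wle by (auto simp: frac_le)
  qed
  then show "0 \<le> inverse_min_width L n" "inverse_min_width L n \<le> 1"
    and "i \<in> {1..L - 1} \<Longrightarrow> 1 / real (n i) \<le> inverse_min_width L n"
    and "0 < c \<Longrightarrow> ereal c \<le> min_width L n \<Longrightarrow> inverse_min_width L n \<le> 1 / c" by auto
qed

section \<open>The output layer and the rate for posteriors\<close>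

context factored_network
begin

text \<open>Block diagonal, with one copy of \<open>A L\<close> for each output neuron.\<close>

definition out_matrix :: "nat \<times> 's \<Rightarrow> nat \<times> 's \<Rightarrow> real" where
  "out_matrix p q = (if fst p = fst q then A L (snd p) (snd q) else 0)"

definition out_map :: "nat \<Rightarrow> (nat \<times> 's \<Rightarrow> real) \<Rightarrow> nat \<times> 's \<Rightarrow> real" where
  "out_map m z = (\<lambda>p\<in>{1..m} \<times> S L. \<Sum>q\<in>{1..m} \<times> J L. out_matrix p q * z q)"

lemma out_map_measurable: "out_map m \<in> measurable (euclid ({1..m} \<times> J L)) (euclid ({1..m} \<times> S L))"
  unfolding out_map_def[abs_def] euclid_def[of "{1..m} \<times> J L"] by (rule measurable_linear_map) simp

lemma out_matrix_sum:
  assumes "i \<in> {1..m}"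
  shows "(\<Sum>q\<in>{1..m} \<times> J L. out_matrix (i, s) q * z q) = (\<Sum>j\<in>J L. A L s j * z (i, j))"
proof -
  have "(\<Sum>q\<in>{1..m} \<times> J L. out_matrix (i, s) q * z q) = (\<Sum>k\<in>{1..m}. if i = k then (\<Sum>j\<in>J L. A L s j * z (k, j)) else 0)"
    unfolding sum.cartesian_product' by (intro sum.cong refl) (simp add: out_matrix_def)
  then show ?thesis using assms by simp
qed

lemma network_eq_out_map:
  assumes L: "1 \<le> L"
  shows "network S a n \<sigma> x W L = out_map (n L) (network J a n reduced x W L)"
proof
  fix p :: "nat \<times> 's"
  obtain i s where p: "p = (i, s)" by force
  obtain l where l: "L = Suc l" using L by (cases L) auto
  show "network S a n \<sigma> x W L p = out_map (n L) (network J a n reduced x W L) p"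
  proof (cases "p \<in> {1..n L} \<times> S L")
    case True
    then have i: "i \<in> {1..n L}" and s: "s \<in> S L" by (auto simp: p)
    have "network S a n \<sigma> x W L (i, s) = lift L (whitened.row L (network J a n reduced x W L) i) s"
      using fun_cong[OF network_eq_lift[where n = n and l = L, OF order_refl i], of W s] s by simp
    also have "\<dots> = (\<Sum>j\<in>J L. A L s j * network J a n reduced x W L (i, j))"
      using s L by (simp add: lift_def whitened.row_def)
    also have "\<dots> = out_map (n L) (network J a n reduced x W L) p"
      using True out_matrix_sum[OF i, of s] by (simp add: out_map_def p)
    finally show ?thesis by (simp add: p)
  next
    case False
    \<comment> \<open>Off the index set both functions take the default value
      \<open>undefined\<close>, so they agree as functions.\<close>
    then have "out_map (n L) (network J a n reduced x W L) p = undefined" unfolding out_map_def by simp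
    moreover have "network S a n \<sigma> x W L p = undefined" using False unfolding l p network.simps by auto
    ultimately show ?thesis by simp
  qed
qed

lemma limit_output_law_eq:
  assumes L: "1 \<le> L"
  shows "limit_output_law S a \<sigma> x L m = distr (std_gaussian ({1..m} \<times> J L)) (euclid ({1..m} \<times> S L)) (out_map m)"
proof -
  have finSL: "finite (S L)" using finS by simp
  have rep: "limit_law S a \<sigma> x L = distr (std_gaussian (J L)) (euclid (S L)) (\<lambda>z. \<lambda>s\<in>S L. \<Sum>j\<in>J L. A L s j * z j)"
    using represents_lift[OF order_refl] L by (simp add: represents_def lift_def[abs_def])
  have law: "gaussian_law (S L) (\<lambda>s t. \<Sum>j\<in>J L. A L s j * A L t j) (limit_law S a \<sigma> x L)"
    unfolding rep by (rule gaussian_law_std[OF finSL finJ])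
  have l1: "gaussian_law ({1..m} \<times> S L) (block_cov (\<lambda>s t. \<Sum>j\<in>J L. A L s j * A L t j)) (limit_output_law S a \<sigma> x L m)"
    unfolding limit_output_law_def by (rule gaussian_law_PiM[OF _ finSL law]) simp
  have l2: "gaussian_law ({1..m} \<times> S L) (\<lambda>p q. \<Sum>r\<in>{1..m} \<times> J L. out_matrix p r * out_matrix q r)
    (distr (std_gaussian ({1..m} \<times> J L)) (euclid ({1..m} \<times> S L)) (out_map m))"
    unfolding out_map_def[abs_def] by (rule gaussian_law_std) (use finSL finJ in auto)
  show ?thesis
  proof (rule gaussian_law_unique[OF _ l1 l2])
    fix p q assume "p \<in> {1..m} \<times> S L" "q \<in> {1..m} \<times> S L"
    then obtain i s k t where pq: "p = (i, s)" "q = (k, t)" "i \<in> {1..m}" "k \<in> {1..m}" by auto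
    show "block_cov (\<lambda>s t. \<Sum>j\<in>J L. A L s j * A L t j) p q = (\<Sum>r\<in>{1..m} \<times> J L. out_matrix p r * out_matrix q r)"
      unfolding pq out_matrix_sum[OF pq(3), of s "out_matrix (k, t)"] by (auto simp: out_matrix_def)
  qed (use finSL in simp)
qed

text \<open>The output is a linear image of all \<open>m\<close> rows of the last whitened layer, so
  a test function of linear growth on outputs becomes one of the quartic class on these rows, up to
  a factor. The constant may depend on \<open>m\<close>, which is the fixed output width; only the
  widths up to \<open>L - 1\<close> have to grow.\<close>

lemma output_close:
  assumes L: "1 \<le> L"
  shows "\<exists>C\<ge>0. \<forall>n \<epsilon> H. admissible n (L - 1) \<epsilon> \<longrightarrow> n L = m \<longrightarrow> H \<in> borel_measurable (euclid ({1..m} \<times> S L)) \<longrightarrow>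
     (\<forall>u\<in>space (euclid ({1..m} \<times> S L)). \<bar>H u\<bar> \<le> 1 + L2_set u ({1..m} \<times> S L)) \<longrightarrow>
     integrable (network_law S a n \<sigma> x L) H \<and> integrable (limit_output_law S a \<sigma> x L m) H \<and>
     \<bar>(\<integral>u. H u \<partial>network_law S a n \<sigma> x L) - (\<integral>u. H u \<partial>limit_output_law S a \<sigma> x L m)\<bar> \<le> C * \<epsilon>"
proof -
  define l where "l = L - 1"
  have Ll: "Suc l = L" using L by (simp add: l_def)
  define X where "X = {1..m} \<times> J L"
  define Y where "Y = {1..m} \<times> S L"
  have finX: "finite X" and finY: "finite Y" using finJ finS by (auto simp: X_def Y_def)
  obtain C where C0: "0 \<le> C" and C: "\<forall>n \<epsilon> r H K. admissible n l \<epsilon> \<longrightarrow> inj_on r {1..m} \<longrightarrow> r ` {1..m} \<subseteq> {1..n (Suc l)} \<longrightarrow>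
     H \<in> borel_measurable (euclid ({1..m} \<times> J (Suc l))) \<longrightarrow> 0 < K \<longrightarrow>
     (\<forall>z\<in>space (euclid ({1..m} \<times> J (Suc l))). \<bar>H z\<bar> \<le> K * (1 + (\<Sum>x\<in>{1..m} \<times> J (Suc l). z x ^ 4))) \<longrightarrow>
     integrable (weight_law a n (Suc l)) (\<lambda>W. H (whitened.rows {1..m} r n W (Suc l))) \<and>
     \<bar>(\<integral>W. H (whitened.rows {1..m} r n W (Suc l)) \<partial>weight_law a n (Suc l)) - (\<integral>z. H z \<partial>std_gaussian ({1..m} \<times> J (Suc l)))\<bar> \<le> K * C * \<epsilon>"
    using whitened.law_close_scaled[OF whitened.law_close, where l = l and m = m] by (elim exE conjE)
  define w where "w = (\<Sum>p\<in>Y. \<Sum>q\<in>X. \<bar>out_matrix p q\<bar>)"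
  have w0: "0 \<le> w" by (simp add: w_def sum_nonneg)
  \<comment> \<open>\<open>1 + w\<close> is the growth constant after the output map; the cube comes
    from \<open>sum_abs_power4_le\<close>.\<close>
  define K where "K = (1 + w) * (1 + real (card X)) ^ 3"
  have K0: "0 < K" using w0 by (simp add: K_def)
  have main: "integrable (network_law S a n \<sigma> x L) H \<and> integrable (limit_output_law S a \<sigma> x L m) H \<and>
     \<bar>(\<integral>u. H u \<partial>network_law S a n \<sigma> x L) - (\<integral>u. H u \<partial>limit_output_law S a \<sigma> x L m)\<bar> \<le> K * C * \<epsilon>"
    if adm: "admissible n l \<epsilon>" and nL: "n L = m" and H: "H \<in> borel_measurable (euclid Y)"
      and Hb: "\<forall>u\<in>space (euclid Y). \<bar>H u\<bar> \<le> 1 + L2_set u Y" for n \<epsilon> H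
  proof -
    define G where "G z = H (out_map m z)" for z
    have om: "out_map m \<in> measurable (euclid X) (euclid Y)" unfolding X_def Y_def by (rule out_map_measurable)
    have Gm: "G \<in> borel_measurable (euclid X)" unfolding G_def by (rule measurable_compose[OF om H])
    have Gb: "\<bar>G z\<bar> \<le> K * (1 + (\<Sum>x\<in>X. z x ^ 4))" if z: "z \<in> space (euclid X)" for z
    proof -
      define u where "u = 1 + (\<Sum>q\<in>X. \<bar>z q\<bar>)"
      have u1: "1 \<le> u" by (simp add: u_def sum_nonneg)
      have "\<bar>G z\<bar> \<le> 1 + L2_set (out_map m z) Y" unfolding G_def using Hb measurable_space[OF om z] by simp
      also have "L2_set (out_map m z) Y \<le> (\<Sum>p\<in>Y. \<bar>out_map m z p\<bar>)" by (rule L2_set_le_sum_abs)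
      also have "\<dots> \<le> (\<Sum>p\<in>Y. (\<Sum>q\<in>X. \<bar>out_matrix p q\<bar>) * u)"
      proof (rule sum_mono)
        fix p assume "p \<in> Y"
        then have "\<bar>out_map m z p\<bar> = \<bar>\<Sum>q\<in>X. out_matrix p q * z q\<bar>" by (simp add: out_map_def X_def Y_def)
        also have "\<dots> \<le> (\<Sum>q\<in>X. \<bar>out_matrix p q\<bar> * u)"
        proof (intro order_trans[OF sum_abs] sum_mono)
          fix q assume "q \<in> X"
          then have "\<bar>z q\<bar> \<le> (\<Sum>q\<in>X. \<bar>z q\<bar>)" using finX by (intro member_le_sum) auto
          then show "\<bar>out_matrix p q * z q\<bar> \<le> \<bar>out_matrix p q\<bar> * u"
            unfolding abs_mult u_def by (intro mult_left_mono) auto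
        qed
        finally show "\<bar>out_map m z p\<bar> \<le> (\<Sum>q\<in>X. \<bar>out_matrix p q\<bar>) * u" by (simp add: sum_distrib_right)
      qed
      also have "\<dots> = w * u" by (simp add: w_def sum_distrib_right)
      also have "1 + w * u \<le> (1 + w) * u ^ 4"
      proof -
        have "u \<le> u ^ 4" using u1 by (intro self_le_power) auto
        then have "w * u \<le> w * u ^ 4" "1 \<le> u ^ 4" using w0 u1 by (auto intro: mult_left_mono)
        then show ?thesis unfolding distrib_right by linarith
      qed
      also have "\<dots> \<le> (1 + w) * ((1 + real (card X)) ^ 3 * (1 + (\<Sum>x\<in>X. z x ^ 4)))"
        unfolding u_def using w0 by (intro mult_left_mono sum_abs_power4_le finX) simp
      finally show ?thesis by (simp add: K_def mult.assoc)
    qed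
    \<comment> \<open>All output neurons are taken, so the renaming of rows is the identity.\<close>
    have id: "inj_on id {1..m}" "id ` {1..m} \<subseteq> {1..n (Suc l)}" using nL Ll by auto
    have rid: "whitened.rows {1..m} id n W L = network J a n reduced x W L" for W
      unfolding whitened.rows_def id_apply nL[symmetric] using Ll
      by (auto simp: fun_eq_iff restrict_def simp flip: Ll)
    have G4: "integrable (weight_law a n L) (\<lambda>W. G (network J a n reduced x W L)) \<and>
     \<bar>(\<integral>W. G (network J a n reduced x W L) \<partial>weight_law a n L) - (\<integral>z. G z \<partial>std_gaussian X)\<bar> \<le> K * C * \<epsilon>"
      using C[unfolded Ll, rule_format, OF adm id[unfolded Ll] Gm[unfolded X_def] K0 Gb[unfolded X_def]] unfolding rid X_def by simp
    have nm: "(\<lambda>W. network S a n \<sigma> x W L) \<in> measurable (weight_law a n L) (euclid Y)"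
      unfolding network_eq_out_map[OF L] nL
      using measurable_compose[OF whitened.net_measurable[where n = n, OF order_refl, of L, unfolded nL] out_map_measurable] unfolding Y_def .
    have netH: "H (network S a n \<sigma> x W L) = G (network J a n reduced x W L)" for W
      unfolding G_def network_eq_out_map[OF L] nL ..
    have F: "network_law S a n \<sigma> x L = distr (weight_law a n L) (euclid Y) (\<lambda>W. network S a n \<sigma> x W L)"
      by (simp add: network_law_def nL Y_def)
    have F1: "integrable (network_law S a n \<sigma> x L) H"
      unfolding F using G4 by (subst integrable_distr_eq[OF nm H]) (simp add: netH)
    have F2: "(\<integral>u. H u \<partial>network_law S a n \<sigma> x L) = (\<integral>W. G (network J a n reduced x W L) \<partial>weight_law a n L)"
      unfolding F by (subst integral_distr[OF nm H]) (simp add: netH)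
    have om': "out_map m \<in> measurable (std_gaussian X) (euclid Y)"
      using om unfolding measurable_cong_sets[OF std_gaussian_sets refl] .
    have E: "limit_output_law S a \<sigma> x L m = distr (std_gaussian X) (euclid Y) (out_map m)"
      unfolding X_def Y_def by (rule limit_output_law_eq[OF L])
    have E1: "integrable (limit_output_law S a \<sigma> x L m) H"
      unfolding E integrable_distr_eq[OF om' H] using std_gaussian_integrable_growth(1)[OF finX Gm Gb] by (simp add: G_def)
    have E2: "(\<integral>u. H u \<partial>limit_output_law S a \<sigma> x L m) = (\<integral>z. G z \<partial>std_gaussian X)"
      unfolding E integral_distr[OF om' H] by (simp add: G_def)
    show ?thesis using F1 E1 G4 unfolding F2 E2 by simp
  qed
  have "0 \<le> K * C" using K0 C0 by simp
  then show ?thesis using main unfolding Y_def l_def by (intro exI[of _ "K * C"]) blast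
qed

lemma network_law_prob:
  assumes L: "1 \<le> L" and n: "\<And>l. l < L \<Longrightarrow> 1 \<le> n l"
  shows "prob_space (network_law S a n \<sigma> x L)"
proof -
  have "(\<lambda>W. network S a n \<sigma> x W L) \<in> measurable (weight_law a n L) (euclid ({1..n L} \<times> S L))"
    unfolding network_eq_out_map[OF L]
    using measurable_compose[OF whitened.net_measurable[where n = n, OF order_refl, of L] out_map_measurable] .
  then show ?thesis unfolding network_law_def using n by (intro prob_space.prob_space_distr prob_space_weight_law)
qed

lemma limit_output_law_prob:
  assumes L: "1 \<le> L"
  shows "prob_space (limit_output_law S a \<sigma> x L m)"
  unfolding limit_output_law_eq[OF L]
  using out_map_measurable[of m] unfolding measurable_cong_sets[OF std_gaussian_sets refl, symmetric]
  by (intro prob_space.prob_space_distr prob_space_std_gaussian)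

end

context lipschitz_network
begin

text \<open>\<open>output_close\<close> gives distance \<open>C * \<epsilon>\<close> against test
  functions of linear growth, and \<open>posterior_wasserstein1_le\<close> turns this into a bound
  for posteriors as soon as \<open>\<epsilon>\<close> is small enough.\<close>

theorem posterior_rate:
  assumes L: "1 \<le> L"
    and g0: "\<forall>u\<in>space (euclid ({1..m} \<times> S L)). 0 \<le> g u"
    and glip: "lipschitz_functional ({1..m} \<times> S L) g"
    and gB: "\<exists>B. \<forall>u\<in>space (euclid ({1..m} \<times> S L)). g u \<le> B"
    and Zpos: "0 < (\<integral>u. g u \<partial>limit_output_law S a \<sigma> x L m)"
  shows "\<exists>c>0. \<forall>n. n 0 = 1 \<and> n L = m \<and> (\<forall>i\<in>{1..L}. 1 \<le> n i) \<and> ereal c \<le> min_width L n \<longrightarrow>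
    0 < (\<integral>u. g u \<partial>network_law S a n \<sigma> x L) \<and> prob_space (posterior g (network_law S a n \<sigma> x L)) \<and>
    prob_space (posterior g (limit_output_law S a \<sigma> x L m)) \<and>
    wasserstein1 ({1..m} \<times> S L) (posterior g (network_law S a n \<sigma> x L)) (posterior g (limit_output_law S a \<sigma> x L m))
      \<le> ennreal (c * inverse_min_width L n)"
proof -
  obtain J A B where "J 0 = {} \<and> (\<forall>l>L. J l = {}) \<and> (\<forall>l. 1 \<le> l \<longrightarrow> l \<le> L \<longrightarrow> factors l (J l) (A l) (B l))"
    using all_factors_exist by (elim exE)
  then interpret factored_network S a \<sigma> x L J A B
    by unfold_locales auto
  define Y where "Y = {1..m} \<times> S L"
  have finY: "finite Y" using finS by (simp add: Y_def)
  let ?G = "limit_output_law S a \<sigma> x L m"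
  obtain C where C0: "0 \<le> C" and C: "\<forall>n \<epsilon> H. admissible n (L - 1) \<epsilon> \<longrightarrow> n L = m \<longrightarrow> H \<in> borel_measurable (euclid Y) \<longrightarrow>
     (\<forall>u\<in>space (euclid Y). \<bar>H u\<bar> \<le> 1 + L2_set u Y) \<longrightarrow>
     integrable (network_law S a n \<sigma> x L) H \<and> integrable ?G H \<and>
     \<bar>(\<integral>u. H u \<partial>network_law S a n \<sigma> x L) - (\<integral>u. H u \<partial>?G)\<bar> \<le> C * \<epsilon>"
    using output_close[OF L, of m] unfolding Y_def by (elim exE conjE)
  obtain B0 where B0: "\<forall>u\<in>space (euclid Y). g u \<le> B0" using gB unfolding Y_def by (elim exE)
  define b where "b = max 1 B0"
  have b1: "1 \<le> b" by (simp add: b_def)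
  have gb: "g u \<le> b" if "u \<in> space (euclid Y)" for u using B0 that by (auto simp: b_def intro: order_trans)
  have gm: "g \<in> borel_measurable (euclid Y)"
    using glip unfolding Y_def[symmetric] by (intro lipschitz1_measurable[OF finY] lipschitz_functional_lipschitz1)
  define Z where "Z = (\<integral>u. g u \<partial>?G)"
  have Z0: "0 < Z" using Zpos by (simp add: Z_def)
  define N where "N = (\<integral>u. L2_set u Y \<partial>?G)"
  have N0: "0 \<le> N" unfolding N_def by (intro Bochner_Integration.integral_nonneg) simp
  have setsG: "sets ?G = sets (euclid Y)" by (simp add: limit_output_law_def Y_def)
  have spG: "space ?G = space (euclid Y)" by (rule sets_eq_imp_space_eq[OF setsG])
  have gG: "\<forall>u\<in>space ?G. 0 \<le> g u \<and> g u \<le> b" using g0 gb by (simp add: spG Y_def)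
  have gmG: "g \<in> borel_measurable ?G" using gm unfolding measurable_cong_sets[OF setsG refl] .
  \<comment> \<open>With \<open>\<epsilon> \<le> 1 / c\<close>, the part \<open>c1\<close>
    guarantees that the normalising constant moves by at most half of \<open>Z\<close>, while
    \<open>c2\<close> is the factor in the posterior bound. Adding 1 keeps \<open>c\<close>
    positive, and \<open>c\<close> serves as threshold and as rate constant.\<close>
  define c1 where "c1 = 2 * b * C / Z"
  define c2 where "c2 = 2 * (2 * b * C / Z + 2 * b\<^sup>2 * N * C / Z\<^sup>2)"
  define c where "c = 1 + c1 + c2"
  have c10: "0 \<le> c1" using b1 C0 Z0 by (simp add: c1_def)
  have c20: "0 \<le> c2" using b1 C0 Z0 N0 by (simp add: c2_def)
  have cpos: "0 < c" using c10 c20 by (simp add: c_def)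
  show ?thesis
  proof (intro exI[of _ c] conjI allI impI cpos)
    fix n assume n: "n 0 = 1 \<and> n L = m \<and> (\<forall>i\<in>{1..L}. 1 \<le> n i) \<and> ereal c \<le> min_width L n"
    define \<epsilon> where "\<epsilon> = inverse_min_width L n"
    let ?F = "network_law S a n \<sigma> x L"
    have npos: "\<forall>i\<in>{1..L}. 1 \<le> n i" using n by blast
    note mw = min_width_bounds[OF npos, folded \<epsilon>_def]
    have \<epsilon>c: "\<epsilon> \<le> 1 / c" using mw(4)[OF cpos] n by simp
    have "1 \<le> n i \<and> 1 / real (n i) \<le> \<epsilon>" if i: "i \<in> {1..L - 1}" for i using npos mw(3)[OF i] i by auto
    then have adm: "admissible n (L - 1) \<epsilon>" using n mw(1,2) by (simp add: admissible_def)
    have nl: "1 \<le> n l" if "l < L" for l using n npos that by (cases "l = 0") auto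
    have nL: "n L = m" using n by simp
    have prF: "prob_space ?F" by (rule network_law_prob[OF L nl])
    have prG: "prob_space ?G" by (rule limit_output_law_prob[OF L])
    have setsF: "sets ?F = sets (euclid Y)" by (simp add: network_law_def nL Y_def)
    have spF: "space ?F = space (euclid Y)" by (rule sets_eq_imp_space_eq[OF setsF])
    have close: "\<bar>(\<integral>u. H u \<partial>?F) - (\<integral>u. H u \<partial>?G)\<bar> \<le> C * \<epsilon>"
      if "H \<in> borel_measurable (euclid Y)" "\<And>u. u \<in> space (euclid Y) \<Longrightarrow> \<bar>H u\<bar> \<le> 1 + L2_set u Y" for H
      using C adm nL that by blast
    have L2: "integrable ?F (\<lambda>u. L2_set u Y) \<and> integrable ?G (\<lambda>u. L2_set u Y)"
      using C[rule_format, OF adm nL L2_set_measurable] by simp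
    have small: "b * (C * \<epsilon>) \<le> Z / 2"
    proof -
      have "c1 * \<epsilon> \<le> c * (1 / c)" using \<epsilon>c c10 c20 mw(1) cpos by (intro mult_mono) (auto simp: c_def)
      then have "2 * b * C / Z * \<epsilon> \<le> 1" using cpos by (simp add: c1_def)
      then show ?thesis using Z0 by (simp add: field_simps)
    qed
    have g0Y: "0 \<le> g u" if "u \<in> space (euclid Y)" for u using g0 that by (simp add: Y_def)
    note PW = posterior_wasserstein1_le[OF prF prG setsF setsG L2[THEN conjunct1] L2[THEN conjunct2] gm g0Y gb b1 Zpos close small[unfolded Z_def]]
    have Fpos: "0 < (\<integral>u. g u \<partial>?F)" by (rule PW(1))
    then show "0 < (\<integral>u. g u \<partial>?F)" .
    have gF: "\<forall>u\<in>space ?F. 0 \<le> g u \<and> g u \<le> b" using g0Y gb by (simp add: spF)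
    have gmF: "g \<in> borel_measurable ?F" using gm unfolding measurable_cong_sets[OF setsF refl] .
    show "prob_space (posterior g ?F)" by (rule posterior_laws(1)[OF prF gmF gF Fpos])
    show "prob_space (posterior g ?G)" by (rule posterior_laws(1)[OF prG gmG gG Zpos])
    have "wasserstein1 Y (posterior g ?F) (posterior g ?G)
      \<le> ennreal (2 * (2 * b * (C * \<epsilon>) / Z + 2 * b\<^sup>2 * N * (C * \<epsilon>) / Z\<^sup>2))"
      unfolding Z_def N_def by (rule PW(2))
    also have "2 * (2 * b * (C * \<epsilon>) / Z + 2 * b\<^sup>2 * N * (C * \<epsilon>) / Z\<^sup>2) = c2 * \<epsilon>"
      by (simp add: c2_def algebra_simps)
    also have "ennreal (c2 * \<epsilon>) \<le> ennreal (c * \<epsilon>)"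
      using mw(1) c10 by (intro ennreal_leI mult_right_mono) (auto simp: c_def)
    finally show "wasserstein1 ({1..m} \<times> S L) (posterior g ?F) (posterior g ?G) \<le> ennreal (c * inverse_min_width L n)"
      by (simp add: Y_def \<epsilon>_def)
  qed
qed

end

theorem corollary5p3:
  fixes train :: "((real ^ 'd) \<times> 'y) set" and test :: "(real ^ 'd) set"
    and xs :: "nat \<Rightarrow> real ^ 'd" and k L n\<^sub>L :: nat
    and S :: "nat \<Rightarrow> (('d \<times> nat) + 's) set" and a :: "nat \<Rightarrow> nat"
    and \<sigma> :: "nat \<Rightarrow> (('d \<times> nat) + 's \<Rightarrow> real) \<Rightarrow> nat \<times> (('d \<times> nat) + 's) \<Rightarrow> real"
    and g :: "(nat \<times> (('d \<times> nat) + 's) \<Rightarrow> real) \<Rightarrow> real"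
  assumes "finite train" and "finite test"
    and "bij_betw xs {1..k} (fst ` train \<union> test)"
    and "1 \<le> L" and "1 \<le> n\<^sub>L"
    and "S 0 = Inl ` (UNIV \<times> {1..k})"
    and "\<And>l. l \<in> {1..L} \<Longrightarrow> finite (S l)"
    and "\<And>l. l \<in> {1..L} \<Longrightarrow> lipschitz_map (S (l - 1)) ({1..a l} \<times> S l) (\<sigma> l)"
    and "\<And>u. u \<in> space (euclid ({1..n\<^sub>L} \<times> S L)) \<Longrightarrow> 0 \<le> g u"
    and "lipschitz_functional ({1..n\<^sub>L} \<times> S L) g"
    and "\<exists>B. \<forall>u\<in>space (euclid ({1..n\<^sub>L} \<times> S L)). g u \<le> B"
    and "0 < (\<integral>u. g u \<partial>limit_output_law S a \<sigma> (network_input xs) L n\<^sub>L)"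
  shows
    "(\<exists>c::real. \<forall>n. n 0 = 1 \<and> n L = n\<^sub>L \<and> (\<forall>i\<in>{1..L}. 1 \<le> n i) \<and> ereal c \<le> min_width L n \<longrightarrow>
        (let F = network_law S a n \<sigma> (network_input xs) L;
             G = limit_output_law S a \<sigma> (network_input xs) L n\<^sub>L
         in 0 < (\<integral>u. g u \<partial>F) \<and> prob_space (posterior g F) \<and> prob_space (posterior g G) \<and>
            wasserstein1 ({1..n\<^sub>L} \<times> S L) (posterior g F) (posterior g G)
              \<le> ennreal (c * sqrt (inverse_min_width L n)))) \<and>
     ((\<forall>l\<in>{1..L}. invertible_matrix (S l) (limit_covariance S a \<sigma> (network_input xs) l)) \<longrightarrow>
      (\<exists>c::real. \<forall>n. n 0 = 1 \<and> n L = n\<^sub>L \<and> (\<forall>i\<in>{1..L}. 1 \<le> n i) \<and> ereal c \<le> min_width L n \<longrightarrow>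
        (let F = network_law S a n \<sigma> (network_input xs) L;
             G = limit_output_law S a \<sigma> (network_input xs) L n\<^sub>L
         in 0 < (\<integral>u. g u \<partial>F) \<and> prob_space (posterior g F) \<and> prob_space (posterior g G) \<and>
            wasserstein1 ({1..n\<^sub>L} \<times> S L) (posterior g F) (posterior g G)
              \<le> ennreal (c * inverse_min_width L n))))"
proof -
  let ?x = "network_input xs :: ('d \<times> nat) + 's \<Rightarrow> real"
  \<comment> \<open>Layer 0 is the copy of the input index set, finite by its form; the finiteness
    assumption starts at layer 1.\<close>
  have "finite (S l)" if "l \<le> L" for l
    using assms(6,7) that by (cases "l = 0") auto
  then interpret lipschitz_network S a \<sigma> ?x L
    by unfold_locales (use assms(8) in auto)
  obtain c where c: "0 < c" and rate: "\<forall>n. n 0 = 1 \<and> n L = n\<^sub>L \<and> (\<forall>i\<in>{1..L}. 1 \<le> n i) \<and> ereal c \<le> min_width L n \<longrightarrow>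
    0 < (\<integral>u. g u \<partial>network_law S a n \<sigma> ?x L) \<and> prob_space (posterior g (network_law S a n \<sigma> ?x L)) \<and>
    prob_space (posterior g (limit_output_law S a \<sigma> ?x L n\<^sub>L)) \<and>
    wasserstein1 ({1..n\<^sub>L} \<times> S L) (posterior g (network_law S a n \<sigma> ?x L)) (posterior g (limit_output_law S a \<sigma> ?x L n\<^sub>L))
      \<le> ennreal (c * inverse_min_width L n)"
    using posterior_rate[OF assms(4) _ assms(10-12)] assms(9) by blast
  \<comment> \<open>The inverse width is at most 1 and so at most its square root; thus the weaker
    rate follows with the same constant.\<close>
  have sqrt: "ennreal (c * inverse_min_width L n) \<le> ennreal (c * sqrt (inverse_min_width L n))"
    if "\<forall>i\<in>{1..L}. 1 \<le> n i" for n
  proof -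
    define \<epsilon> where "\<epsilon> = inverse_min_width L n"
    have "0 \<le> \<epsilon>" "\<epsilon> \<le> 1" using min_width_bounds(1,2)[OF that] by (auto simp: \<epsilon>_def)
    then have "\<epsilon>\<^sup>2 \<le> \<epsilon>" by (simp add: power2_eq_square mult_left_le)
    then have "\<epsilon> \<le> sqrt \<epsilon>" by (rule real_le_rsqrt)
    then show ?thesis using c by (intro ennreal_leI mult_left_mono) (auto simp: \<epsilon>_def)
  qed
  show ?thesis
  proof (intro conjI impI exI[of _ c] allI)
    fix n assume n: "n 0 = 1 \<and> n L = n\<^sub>L \<and> (\<forall>i\<in>{1..L}. 1 \<le> n i) \<and> ereal c \<le> min_width L n"
    from rate[rule_format, OF n] sqrt[of n] n
    show "let F = network_law S a n \<sigma> ?x L; G = limit_output_law S a \<sigma> ?x L n\<^sub>L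
         in 0 < (\<integral>u. g u \<partial>F) \<and> prob_space (posterior g F) \<and> prob_space (posterior g G) \<and>
            wasserstein1 ({1..n\<^sub>L} \<times> S L) (posterior g F) (posterior g G)
              \<le> ennreal (c * sqrt (inverse_min_width L n))"
      unfolding Let_def by (blast intro: order_trans)
  next
    fix n assume "n 0 = 1 \<and> n L = n\<^sub>L \<and> (\<forall>i\<in>{1..L}. 1 \<le> n i) \<and> ereal c \<le> min_width L n"
    from rate[rule_format, OF this]
    show "let F = network_law S a n \<sigma> ?x L; G = limit_output_law S a \<sigma> ?x L n\<^sub>L
         in 0 < (\<integral>u. g u \<partial>F) \<and> prob_space (posterior g F) \<and> prob_space (posterior g G) \<and>
            wasserstein1 ({1..n\<^sub>L} \<times> S L) (posterior g F) (posterior g G)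
              \<le> ennreal (c * inverse_min_width L n)"
      unfolding Let_def .
  qed
qed

end
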